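(* Let $n\ge1$ and $k\ge2$ be integers and let $\varphi(x)=|x|^2$ on $\mathbb{R}^{4n}$. Then the weighted $k$-Bergman projection $P$ satisfies $$Pf=f-\mathscr D_0^*N_\varphi\mathscr D_0f\qquad\text{for every } f\in\mathrm{Dom}(\mathscr D_0).$$
   Context: Primed indices $A',B',A_1',\dots$ range over $\{0',1'\}$; unprimed indices $A,B$ range over $\{0,\dots,2n-1\}$; $i=\sqrt{-1}$. Vector fields on $\mathbb{R}^{4n}$: for $l=0,\dots,n-1$, $Z_{(2l)0'}=\partial_{x_{4l+1}}+i\partial_{x_{4l+2}}$, $Z_{(2l)1'}=-\partial_{x_{4l+3}}-i\partial_{x_{4l+4}}$, $Z_{(2l+1)0'}=\partial_{x_{4l+3}}-i\partial_{x_{4l+4}}$, $Z_{(2l+1)1'}=\partial_{x_{4l+1}}-i\partial_{x_{4l+2}}$. Put $Z_A^{0'}:=Z_{A1'}$, $Z_A^{1'}:=-Z_{A0'}$. Spaces: $\mathscr V_0=\odot^k\mathbb{C}^2$ (tuples $(f_{A_1'\ldots A_k'})$ symmetric in all indices), $\mathscr V_1=\odot^{k-1}\mathbb{C}^2\otimes\mathbb{C}^{2n}$ (tuples $(f_{A_2'\ldots A_k'A})$ symmetric in the primed indices; also written $f_{AA_2'\ldots A_k'}$), $\mathscr V_2=\odot^{k-2}\mathbb{C}^2\otimes\wedge^2\mathbb{C}^{2n}$ (tuples $(f_{ABA_3'\ldots A_k'})$ symmetric in the primed indices and antisymmetric in $A,B$). The inner product $\langle f,g\rangle$ on each $\mathscr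 V_j$ is the sum of $f_I\overline{g_I}$ over all index tuples $I$ (all values of every index). $L^2_\varphi(\mathbb{R}^{4n},\mathscr V_j)$ is the Hilbert space with inner product $\langle f,g\rangle_\varphi=\int_{\mathbb{R}^{4n}}\langle f,g\rangle e^{-2\varphi}dV$ ($dV$ Lebesgue measure) and norm $\|f\|_\varphi=\langle f,f\rangle_\varphi^{1/2}$. Operators: $(\mathscr D_0f)_{A_2'\ldots A_k'A}=\sum_{A_1'=0',1'}Z_A^{A_1'}f_{A_1'A_2'\ldots A_k'}$, and $(\mathscr D_1h)_{ABA_3'\ldots A_k'}=\sum_{A'=0',1'}\big(Z_A^{A'}h_{BA'A_3'\ldots A_k'}-Z_B^{A'}h_{AA'A_3'\ldots A_k'}\big)$. They are viewed as densely defined closed operators $L^2_\varphi(\mathbb{R}^{4n},\mathscr V_0)\to L^2_\varphi(\mathbb{R}^{4n},\mathscr V_1)\to L^2_\varphi(\mathbb{R}^{4n},\mathscr V_2)$, acting in the sense of distributions, with $\mathrm{Dom}(\mathscr D_j)=\{f\in L^2_\varphi(\mathbb{R}^{4n},\mathscr V_j):\mathscr D_jf\in L^2_\varphi(\mathbb{R}^{4n},\mathscr V_{j+1})\}$. $\mathscr D_0^*,\mathscr D_1^*$ are their Hilbert space adjoints with respect to $\langle\cdot,\cdot\rangle_\varphi$. $\Box_\varphi=\mathscr D_0\mathscr D_0^*+\mathscr D_1^*\mathscr D_1$ on $L^2_\varphi(\mathbb{R}^{4n},\mathscr V_1)$, with $\mathrm{Dom}(\Box_\varphi)=\{f\in\mathrm{Dom}(\mathscr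 D_0^* )\cap\mathrm{Dom}(\mathscr D_1):\mathscr D_0^*f\in\mathrm{Dom}(\mathscr D_0),\ \mathscr D_1f\in\mathrm{Dom}(\mathscr D_1^* )\}$. $N_\varphi$ denotes the bounded inverse of $\Box_\varphi$ on $L^2_\varphi(\mathbb{R}^{4n},\mathscr V_1)$ (it exists for $\varphi=|x|^2$, $k\ge2$). The weighted $k$-Bergman space is the closed subspace $A^2_{(k)}(\mathbb{R}^{4n},\varphi)=\{f\in L^2_\varphi(\mathbb{R}^{4n},\mathscr V_0):\mathscr D_0f=0\}$, and $P:L^2_\varphi(\mathbb{R}^{4n},\mathscr V_0)\to A^2_{(k)}(\mathbb{R}^{4n},\varphi)$, the weighted $k$-Bergman projection, is the orthogonal projection. *)

theory Defs
  imports "HOL-Analysis.Analysis" "HOL-Library.Multiset"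
begin

text \<open>
  With \<open>n = CARD('n)\<close>, the space $\mathbb{R}^{4n}$ is \<open>real^4^'n\<close>: the coordinate $x_{4l+j}$
  ($j = 1,\ldots,4$) is \<open>x $ l $ j\<close>, where the literal \<open>4\<close> of type \<open>4\<close> is the same element as \<open>0\<close>.
  A primed index is an element of type \<open>2\<close> (\<open>0\<close> is $0'$, \<open>1\<close> is $1'$), a string
  $A_1' \ldots A_m'$ of them is a list, and an unprimed index $A = 2l + a$ in
  $\{0,\ldots,2n-1\}$ is the pair \<open>(l, a)\<close>.
\<close>

type_synonym 'n space = "real^4^'n"
type_synonym 'n uidx = "'n \<times> 2"
type_synonym idx0 = "2 list"
type_synonym 'n idx1 = "2 list \<times> 'n uidx"
type_synonym 'n idx2 = "'n uidx \<times> 'n uidx \<times> 2 list"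


subsection \<open>Test functions, distributions and the vector fields\<close>

definition pd :: "'n::finite \<Rightarrow> 4 \<Rightarrow> ('n space \<Rightarrow> complex) \<Rightarrow> 'n space \<Rightarrow> complex" where
  "pd l j \<eta> x = frechet_derivative \<eta> (at x) (axis l (axis j 1))"

fun iter_pd :: "('n::finite \<times> 4) list \<Rightarrow> ('n space \<Rightarrow> complex) \<Rightarrow> 'n space \<Rightarrow> complex" where
  "iter_pd [] \<eta> = \<eta>"
| "iter_pd ((l, j) # ds) \<eta> = pd l j (iter_pd ds \<eta>)"

text \<open>Complex-valued $C^\infty_c$ functions: all iterated partial derivatives exist and are
  (Frechet) differentiable, hence in particular continuous.\<close>

definition test_fun :: "('n::finite space \<Rightarrow> complex) \<Rightarrow> bool" where
  "test_fun \<eta> \<longleftrightarrow> (\<forall>ds. iter_pd ds \<eta> differentiable_on UNIV) \<and> compact (closure {x. \<eta> x \<noteq> 0})"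

definition Z_low :: "'n::finite uidx \<Rightarrow> 2 \<Rightarrow> ('n space \<Rightarrow> complex) \<Rightarrow> 'n space \<Rightarrow> complex" where
  "Z_low A A' \<eta> x = (let l = fst A in
     if snd A = 0 then
       (if A' = 0 then pd l 1 \<eta> x + \<i> * pd l 2 \<eta> x else - pd l 3 \<eta> x - \<i> * pd l 4 \<eta> x)
     else
       (if A' = 0 then pd l 3 \<eta> x - \<i> * pd l 4 \<eta> x else pd l 1 \<eta> x - \<i> * pd l 2 \<eta> x))"

definition Z_up :: "'n::finite uidx \<Rightarrow> 2 \<Rightarrow> ('n space \<Rightarrow> complex) \<Rightarrow> 'n space \<Rightarrow> complex" where
  "Z_up A A' \<eta> x = (if A' = 0 then Z_low A 1 \<eta> x else - Z_low A 0 \<eta> x)"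

text \<open>Distributions are functionals on test functions; \<open>distr_of g\<close> is the regular distribution
  of a function \<open>g\<close>, with the bilinear (unconjugated) pairing. A constant-coefficient vector
  field \<open>Z\<close> acts on a distribution \<open>T\<close> by \<open>(Z T) \<eta> = - T (Z \<eta>)\<close>.\<close>

type_synonym 'n distribution = "('n space \<Rightarrow> complex) \<Rightarrow> complex"

definition distr_of :: "('n::finite space \<Rightarrow> complex) \<Rightarrow> 'n distribution" where
  "distr_of g \<eta> = (LINT x|lborel. g x * \<eta> x)"

definition Z_distr :: "'n::finite uidx \<Rightarrow> 2 \<Rightarrow> 'n distribution \<Rightarrow> 'n distribution" where
  "Z_distr A A' T \<eta> = - T (Z_up A A' \<eta>)"


subsection \<open>The tuple spaces and the weighted spaces of square integrable functions\<close>

definition I0 :: "nat \<Rightarrow> idx0 set" where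
  "I0 k = {s. length s = k}"

definition I1 :: "nat \<Rightarrow> 'n::finite idx1 set" where
  "I1 k = {(s, A). length s = k - 1}"

definition I2 :: "nat \<Rightarrow> 'n::finite idx2 set" where
  "I2 k = {(A, B, s). length s = k - 2}"

text \<open>A tuple is a function on the whole index type that vanishes off the index set.
  Two lists are permutations of each other iff their multisets agree.\<close>

definition V0 :: "nat \<Rightarrow> (idx0 \<Rightarrow> complex) set" where
  "V0 k = {v. (\<forall>i. i \<notin> I0 k \<longrightarrow> v i = 0) \<and> (\<forall>s t. mset s = mset t \<longrightarrow> v s = v t)}"

definition V1 :: "nat \<Rightarrow> ('n::finite idx1 \<Rightarrow> complex) set" where
  "V1 k = {v. (\<forall>i. i \<notin> I1 k \<longrightarrow> v i = 0) \<and>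
              (\<forall>s t A. mset s = mset t \<longrightarrow> v (s, A) = v (t, A))}"

definition V2 :: "nat \<Rightarrow> ('n::finite idx2 \<Rightarrow> complex) set" where
  "V2 k = {v. (\<forall>i. i \<notin> I2 k \<longrightarrow> v i = 0) \<and>
              (\<forall>s t A B. mset s = mset t \<longrightarrow> v (A, B, s) = v (A, B, t)) \<and>
              (\<forall>s A B. v (A, B, s) = - v (B, A, s))}"

text \<open>Elements of $L^2_\varphi$ are given by everywhere defined Borel representatives; equality of
  elements is equality almost everywhere.\<close>

definition L2 :: "('n::finite space \<Rightarrow> real) \<Rightarrow> ('i \<Rightarrow> complex) set \<Rightarrow> ('n space \<Rightarrow> 'i \<Rightarrow> complex) set"
  where
  "L2 \<phi> V = {f. (\<forall>x. f x \<in> V) \<and>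
     (\<forall>i. (\<lambda>x. f x i) \<in> borel_measurable lborel \<and>
          integrable lborel (\<lambda>x. (norm (f x i))\<^sup>2 * exp (- 2 * \<phi> x)))}"

definition ip :: "('n::finite space \<Rightarrow> real) \<Rightarrow> 'i set \<Rightarrow>
    ('n space \<Rightarrow> 'i \<Rightarrow> complex) \<Rightarrow> ('n space \<Rightarrow> 'i \<Rightarrow> complex) \<Rightarrow> complex" where
  "ip \<phi> I f g = (LINT x|lborel. (\<Sum>i\<in>I. f x i * cnj (g x i)) * complex_of_real (exp (- 2 * \<phi> x)))"

definition nrm :: "('n::finite space \<Rightarrow> real) \<Rightarrow> 'i set \<Rightarrow> ('n space \<Rightarrow> 'i \<Rightarrow> complex) \<Rightarrow> real" where
  "nrm \<phi> I f = sqrt (Re (ip \<phi> I f f))"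


subsection \<open>The operators\<close>

text \<open>Unbounded operators are represented by their graphs (on representatives), so that the
  domain of \<open>T\<close> is \<open>Domain T\<close>; \<open>app T f\<close> is the value, determined up to a null set.\<close>

definition app :: "('a \<times> 'b) set \<Rightarrow> 'a \<Rightarrow> 'b" where
  "app T f = (SOME g. (f, g) \<in> T)"

definition D0 :: "('n::finite space \<Rightarrow> real) \<Rightarrow> nat \<Rightarrow>
    (('n space \<Rightarrow> idx0 \<Rightarrow> complex) \<times> ('n space \<Rightarrow> 'n idx1 \<Rightarrow> complex)) set" where
  "D0 \<phi> k = {(f, g). f \<in> L2 \<phi> (V0 k) \<and> g \<in> L2 \<phi> (V1 k) \<and>
     (\<forall>(s, A) \<in> I1 k. \<forall>\<eta>. test_fun \<eta> \<longrightarrow>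
        (\<Sum>A'\<in>UNIV. Z_distr A A' (distr_of (\<lambda>x. f x (A' # s))) \<eta>) = distr_of (\<lambda>x. g x (s, A)) \<eta>)}"

definition D1 :: "('n::finite space \<Rightarrow> real) \<Rightarrow> nat \<Rightarrow>
    (('n space \<Rightarrow> 'n idx1 \<Rightarrow> complex) \<times> ('n space \<Rightarrow> 'n idx2 \<Rightarrow> complex)) set" where
  "D1 \<phi> k = {(h, g). h \<in> L2 \<phi> (V1 k) \<and> g \<in> L2 \<phi> (V2 k) \<and>
     (\<forall>(A, B, s) \<in> I2 k. \<forall>\<eta>. test_fun \<eta> \<longrightarrow>
        (\<Sum>A'\<in>UNIV. Z_distr A A' (distr_of (\<lambda>x. h x (A' # s, B))) \<eta>
                    - Z_distr B A' (distr_of (\<lambda>x. h x (A' # s, A))) \<eta>)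
        = distr_of (\<lambda>x. g x (A, B, s)) \<eta>)}"

definition D0_adj :: "('n::finite space \<Rightarrow> real) \<Rightarrow> nat \<Rightarrow>
    (('n space \<Rightarrow> 'n idx1 \<Rightarrow> complex) \<times> ('n space \<Rightarrow> idx0 \<Rightarrow> complex)) set" where
  "D0_adj \<phi> k = {(g, h). g \<in> L2 \<phi> (V1 k) \<and> h \<in> L2 \<phi> (V0 k) \<and>
     (\<forall>(f, Df) \<in> D0 \<phi> k. ip \<phi> (I1 k) Df g = ip \<phi> (I0 k) f h)}"

definition D1_adj :: "('n::finite space \<Rightarrow> real) \<Rightarrow> nat \<Rightarrow>
    (('n space \<Rightarrow> 'n idx2 \<Rightarrow> complex) \<times> ('n space \<Rightarrow> 'n idx1 \<Rightarrow> complex)) set" where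
  "D1_adj \<phi> k = {(g, h). g \<in> L2 \<phi> (V2 k) \<and> h \<in> L2 \<phi> (V1 k) \<and>
     (\<forall>(f, Df) \<in> D1 \<phi> k. ip \<phi> (I2 k) Df g = ip \<phi> (I1 k) f h)}"

definition Box :: "('n::finite space \<Rightarrow> real) \<Rightarrow> nat \<Rightarrow>
    (('n space \<Rightarrow> 'n idx1 \<Rightarrow> complex) \<times> ('n space \<Rightarrow> 'n idx1 \<Rightarrow> complex)) set" where
  "Box \<phi> k = {(u, \<lambda>x i. a x i + b x i) | u a b.
     \<exists>v w. (u, v) \<in> D0_adj \<phi> k \<and> (v, a) \<in> D0 \<phi> k \<and> (u, w) \<in> D1 \<phi> k \<and> (w, b) \<in> D1_adj \<phi> k}"

definition bounded_inverse_Box :: "('n::finite space \<Rightarrow> real) \<Rightarrow> nat \<Rightarrow>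
    (('n space \<Rightarrow> 'n idx1 \<Rightarrow> complex) \<Rightarrow> ('n space \<Rightarrow> 'n idx1 \<Rightarrow> complex)) \<Rightarrow> bool" where
  "bounded_inverse_Box \<phi> k N \<longleftrightarrow>
     (\<forall>g \<in> L2 \<phi> (V1 k). (N g, g) \<in> Box \<phi> k) \<and>
     (\<forall>(u, g) \<in> Box \<phi> k. AE x in lborel. N g x = u x) \<and>
     (\<exists>C. \<forall>g \<in> L2 \<phi> (V1 k). nrm \<phi> (I1 k) (N g) \<le> C * nrm \<phi> (I1 k) g)"

text \<open>\<open>N_op\<close> is unspecified if \<open>Box\<close> has no bounded inverse; any statement about its values
  therefore requires the existence of the inverse.\<close>

definition N_op :: "('n::finite space \<Rightarrow> real) \<Rightarrow> nat \<Rightarrow>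
    ('n space \<Rightarrow> 'n idx1 \<Rightarrow> complex) \<Rightarrow> ('n space \<Rightarrow> 'n idx1 \<Rightarrow> complex)" where
  "N_op \<phi> k = (SOME N. bounded_inverse_Box \<phi> k N)"

definition bergman :: "('n::finite space \<Rightarrow> real) \<Rightarrow> nat \<Rightarrow> ('n space \<Rightarrow> idx0 \<Rightarrow> complex) set" where
  "bergman \<phi> k = {f. (f, \<lambda>x i. 0) \<in> D0 \<phi> k}"

text \<open>Orthogonal projection onto the closed subspace \<open>bergman \<phi> k\<close>, with values determined up to
  a null set.\<close>

definition bergman_proj :: "('n::finite space \<Rightarrow> real) \<Rightarrow> nat \<Rightarrow>
    ('n space \<Rightarrow> idx0 \<Rightarrow> complex) \<Rightarrow> ('n space \<Rightarrow> idx0 \<Rightarrow> complex)" where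
  "bergman_proj \<phi> k f =
     (SOME p. p \<in> bergman \<phi> k \<and> (\<forall>h \<in> bergman \<phi> k. ip \<phi> (I0 k) (\<lambda>x i. f x i - p x i) h = 0))"

end

theory Submission
  imports Defs "HOL-Probability.Distributions" "HOL-Library.Function_Algebras"
begin

text \<open>For the weight $e^{-2|x|^2}$ the fields $Z_A^{A'}$ are annihilation operators: their coefficient
vectors are orthogonal of squared length $2$, so the weighted adjoints satisfy
$[Z_A^{A'}, (Z_B^{B'})^*] = 8\,\delta_{AB}\delta_{A'B'}$ on polynomials (\<open>Z_adj_commutator\<close>). Moving
these commutators through $\|\mathscr D_1 h\|^2$ yields
$16\|h\|^2 \le \|\mathscr D_1 h\|^2 + 4\|\mathscr D_0^* h\|^2$ for polynomial tuples $h$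
(\<open>basic_estimate\<close>); the factor $4$ is a bound for $2k/(k-1)$, which is where $k \ge 2$ enters.

The estimate is only ever applied to polynomials, because everything can be approximated by them in the
graph norms at once. On polynomials $\mathscr D_0$, $\mathscr D_1$ lower the degree by one and
$\mathscr D_0^*$, $\mathscr D_1^*$ raise it by one, so $\Box_\varphi$ maps the polynomial tuples
of bounded degree to themselves. That space has finite dimension and $\Box_\varphi$ is injective on it by the
estimate, hence $\Box_\varphi H = p$ has a polynomial solution $H$ for each polynomial tuple $p$ (\<open>pBox_surj\<close>).
Since $\mathscr D_1 \mathscr D_0 = 0$, the two parts of $\Box_\varphi H$ are orthogonal, and therefore $H$,
$\mathscr D_0^* H$, $\mathscr D_1 H$, $\mathscr D_0\mathscr D_0^* H$ and $\mathscr D_1^*\mathscr D_1 H$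
are all bounded in norm by $\|p\|$ (\<open>pBox_bounds\<close>). If polynomials $p_n$ tend to $g$, then the
five sequences belonging to $p_n$ are Cauchy; their limits solve $\Box_\varphi u = g$ because $L^2_\varphi$ is complete
and the graphs of the four operators are closed (\<open>Box_solvable\<close>). Uniqueness of the solution
follows from solvability and the symmetry of $\Box_\varphi$, so $N_\varphi$ exists.

Three facts from analysis support this. Polynomials are dense in $L^2$ of the Gaussian measure
(\<open>pol_dense\<close>). The distributional operators contain the polynomial ones, by integration by parts
(\<open>pol_parts\<close>). Conversely, an identity tested against $C^\infty_c$ may be tested against polynomials times the
weight (\<open>test_identity_extends\<close>), by means of smooth cutoffs with small gradient; this is what identifies the
Hilbert space adjoints on polynomials with explicit formulas.

For the projection let $g = \mathscr D_0 f$ and $u = N_\varphi g$. The component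
$b = \mathscr D_1^*\mathscr D_1 u$ is a limit of $\mathscr D_1^*$ of polynomials, hence orthogonal to the range of
$\mathscr D_0$, which contains $g$ and $g - b = \mathscr D_0\mathscr D_0^* u$; so $b = 0$. Hence $\mathscr D_0(f - \mathscr D_0^* u) = 0$,
while $\mathscr D_0^* u$ is orthogonal to the kernel of $\mathscr D_0$. These two properties characterise $Pf = f - \mathscr D_0^* u$.\<close>

section \<open>Square integrability for the Gaussian weight\<close>

lemma borel_measurable_cnj [measurable (raw)]:
  "f \<in> borel_measurable M \<Longrightarrow> (\<lambda>x. cnj (f x)) \<in> borel_measurable M"
  by (rule measurable_compose[of f M borel cnj borel])
    (auto intro!: borel_measurable_continuous_onI continuous_intros)

text \<open>The Gaussian is a product over the coordinates, so its integral is a power of the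
one-dimensional Gaussian integral.\<close>

lemma integrable_exp_neg_norm_sq:
  "integrable lborel (\<lambda>x::'a::euclidean_space. exp (- (norm x)\<^sup>2))"
proof -
  have one: "integrable lborel (\<lambda>x::real. exp (- x\<^sup>2))"
  proof -
    have "integrable lborel (\<lambda>x. sqrt pi * normal_density 0 (1 / sqrt 2) x)"
      by (intro integrable_mult_right integrable_normal_density) simp
    then show ?thesis
      by (simp add: normal_density_def real_sqrt_divide power_divide)
  qed

  have "(\<integral>\<^sup>+x. ennreal (exp (- (norm x)\<^sup>2)) \<partial>(lborel :: 'a measure))
      = (\<integral>\<^sup>+x. (\<Prod>b\<in>Basis. ennreal (exp (- (x \<bullet> b)\<^sup>2))) \<partial>(lborel :: 'a measure))"
  proof (rule nn_integral_cong)
    fix x :: 'a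
    have "(norm x)\<^sup>2 = (\<Sum>b\<in>Basis. (x \<bullet> b)\<^sup>2)"
      by (subst power2_norm_eq_inner, subst euclidean_inner) (simp add: power2_eq_square)
    then show "ennreal (exp (- (norm x)\<^sup>2)) = (\<Prod>b\<in>Basis. ennreal (exp (- (x \<bullet> b)\<^sup>2)))"
      by (simp add: prod_ennreal exp_sum[symmetric] sum_negf[symmetric])
  qed
  also have "\<dots> = (\<Prod>b\<in>(Basis::'a set). \<integral>\<^sup>+x. ennreal (exp (- x\<^sup>2)) \<partial>lborel)"
    by (subst nn_integral_lborel_prod) auto
  also have "\<dots> < \<infinity>"
    using one by (simp add: integrable_iff_bounded less_top[symmetric] ennreal_prod_eq_top power_eq_top_ennreal)
  finally show ?thesis
    by (simp add: integrable_iff_bounded)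
qed

text \<open>The weight $e^{-2\varphi}$ for $\varphi = |x|^2$.\<close>

definition gw :: "'a::euclidean_space \<Rightarrow> real" where
  "gw x = exp (- 2 * (norm x)\<^sup>2)"

lemma gw_pos [simp]: "gw x > 0" "gw x \<ge> 0" "gw x \<noteq> 0"
  by (simp_all add: gw_def)

lemma gw_measurable [measurable]: "gw \<in> borel_measurable borel"
  unfolding gw_def by measurable

text \<open>At most exponential growth: a class that is closed under products, contains the polynomials and
the functions $e^{t|x_j|}$, and is square integrable for the weight.\<close>

definition exptype :: "('a::euclidean_space \<Rightarrow> complex) \<Rightarrow> bool" where
  "exptype f \<longleftrightarrow> (\<exists>C c. \<forall>x. norm (f x) \<le> C * exp (c * norm x))"

lemma exptypeI: "(\<And>x. norm (f x) \<le> C * exp (c * norm x)) \<Longrightarrow> exptype f"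
  unfolding exptype_def by blast

lemma exptypeE:
  fixes f :: "'a::euclidean_space \<Rightarrow> complex"
  assumes "exptype f"
  obtains C c where "C \<ge> 0" "c \<ge> 0" "\<And>x. norm (f x) \<le> C * exp (c * norm x)"
proof -
  obtain C c where *: "\<And>x. norm (f x) \<le> C * exp (c * norm x)"
    using assms unfolding exptype_def by blast
  show ?thesis
  proof (rule that[of "\<bar>C\<bar>" "\<bar>c\<bar>"])
    fix x :: 'a
    have "C * exp (c * norm x) \<le> \<bar>C\<bar> * exp (\<bar>c\<bar> * norm x)"
      by (intro mult_mono) (auto intro: mult_right_mono)
    with *[of x] show "norm (f x) \<le> \<bar>C\<bar> * exp (\<bar>c\<bar> * norm x)" by linarith
  qed auto
qed

lemma exptype_const: "exptype (\<lambda>x. c)"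
  by (rule exptypeI[of _ "norm c" 0]) simp

lemma exptype_add:
  fixes f :: "'a::euclidean_space \<Rightarrow> complex"
  assumes "exptype f" "exptype g" shows "exptype (\<lambda>x. f x + g x)"
proof -
  obtain C c where f: "C \<ge> 0" "c \<ge> 0" "\<And>x. norm (f x) \<le> C * exp (c * norm x)"
    by (metis exptypeE[OF assms(1)])
  obtain D d where g: "D \<ge> 0" "d \<ge> 0" "\<And>x. norm (g x) \<le> D * exp (d * norm x)"
    by (metis exptypeE[OF assms(2)])
  show ?thesis
  proof (rule exptypeI)
    fix x :: 'a
    have "C * exp (c * norm x) \<le> C * exp ((c + d) * norm x)"
      using f g by (intro mult_left_mono) (auto simp: distrib_right)
    moreover have "D * exp (d * norm x) \<le> D * exp ((c + d) * norm x)"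
      using f g by (intro mult_left_mono) (auto simp: distrib_right)
    ultimately show "norm (f x + g x) \<le> (C + D) * exp ((c + d) * norm x)"
      using f(3)[of x] g(3)[of x] norm_triangle_ineq[of "f x" "g x"] by (simp add: distrib_right)
  qed
qed

lemma exptype_mult:
  fixes f :: "'a::euclidean_space \<Rightarrow> complex"
  assumes "exptype f" "exptype g" shows "exptype (\<lambda>x. f x * g x)"
proof -
  obtain C c where f: "C \<ge> 0" "c \<ge> 0" "\<And>x. norm (f x) \<le> C * exp (c * norm x)"
    by (metis exptypeE[OF assms(1)])
  obtain D d where g: "D \<ge> 0" "d \<ge> 0" "\<And>x. norm (g x) \<le> D * exp (d * norm x)"
    by (metis exptypeE[OF assms(2)])
  show ?thesis
  proof (rule exptypeI)
    fix x :: 'a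
    have "norm (f x * g x) \<le> (C * exp (c * norm x)) * (D * exp (d * norm x))"
      unfolding norm_mult using f g by (intro mult_mono) auto
    then show "norm (f x * g x) \<le> (C * D) * exp ((c + d) * norm x)"
      by (simp add: exp_add algebra_simps)
  qed
qed

definition sql2 :: "('a::euclidean_space \<Rightarrow> complex) \<Rightarrow> bool" where
  "sql2 f \<longleftrightarrow> f \<in> borel_measurable borel \<and> integrable lborel (\<lambda>x. (norm (f x))\<^sup>2 * gw x)"

definition sip :: "('a::euclidean_space \<Rightarrow> complex) \<Rightarrow> ('a \<Rightarrow> complex) \<Rightarrow> complex" where
  "sip f g = (LINT x|lborel. f x * cnj (g x) * complex_of_real (gw x))"

definition nsq :: "('a::euclidean_space \<Rightarrow> complex) \<Rightarrow> real" where
  "nsq f = (LINT x|lborel. (norm (f x))\<^sup>2 * gw x)"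

lemma sql2_meas [measurable_dest]: "sql2 f \<Longrightarrow> f \<in> borel_measurable borel"
  by (simp add: sql2_def)

lemma sql2_bounded:
  assumes "sql2 g" "f \<in> borel_measurable borel" "\<And>x. norm (f x) \<le> C * norm (g x)"
  shows "sql2 f"
  unfolding sql2_def
proof
  show "integrable lborel (\<lambda>x. (norm (f x))\<^sup>2 * gw x)"
  proof (rule Bochner_Integration.integrable_bound)
    show "integrable lborel (\<lambda>x. C\<^sup>2 * ((norm (g x))\<^sup>2 * gw x))"
      using assms(1) by (auto simp: sql2_def)
    show "AE x in lborel. norm ((norm (f x))\<^sup>2 * gw x) \<le> norm (C\<^sup>2 * ((norm (g x))\<^sup>2 * gw x))"
    proof (intro AE_I2)
      fix x
      have "(norm (f x))\<^sup>2 \<le> (C * norm (g x))\<^sup>2"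
        using assms(3)[of x] by (intro power_mono) auto
      then show "norm ((norm (f x))\<^sup>2 * gw x) \<le> norm (C\<^sup>2 * ((norm (g x))\<^sup>2 * gw x))"
        by (simp add: power_mult_distrib abs_mult mult.assoc[symmetric] mult_right_mono)
    qed
  qed (use assms in measurable)
qed fact

text \<open>$2cr - 2r^2 \le c^2 - r^2$, so one factor $e^{-|x|^2}$ survives.\<close>

lemma sql2_exptype:
  fixes f :: "'a::euclidean_space \<Rightarrow> complex"
  assumes "exptype f" "f \<in> borel_measurable borel" shows "sql2 f"
  unfolding sql2_def
proof
  obtain C c where f: "C \<ge> 0" "c \<ge> 0" "\<And>x. norm (f x) \<le> C * exp (c * norm x)"
    by (metis exptypeE[OF assms(1)])
  show "integrable lborel (\<lambda>x. (norm (f x))\<^sup>2 * gw x)"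
  proof (rule Bochner_Integration.integrable_bound)
    show "integrable lborel (\<lambda>x::'a. (C\<^sup>2 * exp (c\<^sup>2)) * exp (- (norm x)\<^sup>2))"
      by (intro integrable_mult_right integrable_exp_neg_norm_sq)
    show "AE x in lborel. norm ((norm (f x))\<^sup>2 * gw x) \<le> norm ((C\<^sup>2 * exp (c\<^sup>2)) * exp (- (norm x)\<^sup>2))"
    proof (intro AE_I2)
      fix x :: 'a
      have e: "2 * (c * norm x) - 2 * (norm x)\<^sup>2 \<le> c\<^sup>2 - (norm x)\<^sup>2"
        using zero_le_power2[of "c - norm x"] by (simp add: power2_eq_square algebra_simps)
      have "(norm (f x))\<^sup>2 * gw x \<le> (C * exp (c * norm x))\<^sup>2 * gw x"
        using f(3)[of x] by (intro mult_right_mono power_mono) auto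
      also have "\<dots> = C\<^sup>2 * exp (2 * (c * norm x) - 2 * (norm x)\<^sup>2)"
        by (simp add: power_mult_distrib gw_def exp_double[symmetric] exp_diff exp_minus field_simps)
      also have "\<dots> \<le> C\<^sup>2 * exp (c\<^sup>2 - (norm x)\<^sup>2)"
        using e by (intro mult_left_mono) auto
      also have "\<dots> = (C\<^sup>2 * exp (c\<^sup>2)) * exp (- (norm x)\<^sup>2)"
        by (simp add: exp_diff exp_minus field_simps)
      finally show "norm ((norm (f x))\<^sup>2 * gw x) \<le> norm ((C\<^sup>2 * exp (c\<^sup>2)) * exp (- (norm x)\<^sup>2))"
        by simp
    qed
  qed (use assms in measurable)
qed fact

lemma norm_sq_add_le: "(norm (a + b))\<^sup>2 \<le> 2 * (norm a)\<^sup>2 + 2 * (norm (b::'a::real_normed_vector))\<^sup>2"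
proof -
  have "(norm (a + b))\<^sup>2 \<le> (norm a + norm b)\<^sup>2"
    by (intro power_mono norm_triangle_ineq) auto
  also have "\<dots> \<le> 2 * (norm a)\<^sup>2 + 2 * (norm b)\<^sup>2"
    using zero_le_power2[of "norm a - norm b"] by (simp add: power2_eq_square algebra_simps)
  finally show ?thesis .
qed

lemma sql2_0 [simp]: "sql2 (\<lambda>x. 0)"
  by (simp add: sql2_def)

lemma sql2_add: assumes "sql2 f" "sql2 g" shows "sql2 (\<lambda>x. f x + g x)"
  unfolding sql2_def
proof
  show [measurable]: "(\<lambda>x. f x + g x) \<in> borel_measurable borel"
    using assms by (auto simp: sql2_def)
  show "integrable lborel (\<lambda>x. (norm (f x + g x))\<^sup>2 * gw x)"
  proof (rule Bochner_Integration.integrable_bound)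
    show "integrable lborel (\<lambda>x. 2 * ((norm (f x))\<^sup>2 * gw x) + 2 * ((norm (g x))\<^sup>2 * gw x))"
      using assms by (auto simp: sql2_def)
    show "AE x in lborel. norm ((norm (f x + g x))\<^sup>2 * gw x)
        \<le> norm (2 * ((norm (f x))\<^sup>2 * gw x) + 2 * ((norm (g x))\<^sup>2 * gw x))"
    proof (intro AE_I2)
      fix x
      have "(norm (f x + g x))\<^sup>2 * gw x \<le> (2 * (norm (f x))\<^sup>2 + 2 * (norm (g x))\<^sup>2) * gw x"
        by (intro mult_right_mono norm_sq_add_le) auto
      then show "norm ((norm (f x + g x))\<^sup>2 * gw x)
        \<le> norm (2 * ((norm (f x))\<^sup>2 * gw x) + 2 * ((norm (g x))\<^sup>2 * gw x))"
        by (simp add: algebra_simps)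
    qed
  qed measurable
qed

lemma sql2_scale: "sql2 f \<Longrightarrow> sql2 (\<lambda>x. c * f x)"
  by (rule sql2_bounded[of f _ "norm c"]) (auto simp: sql2_def norm_mult)

lemma sql2_diff: "sql2 f \<Longrightarrow> sql2 g \<Longrightarrow> sql2 (\<lambda>x. f x - g x)"
  using sql2_add[OF _ sql2_scale[of g "-1"]] by simp

lemma sql2_sum: "(\<And>i. i \<in> I \<Longrightarrow> sql2 (f i)) \<Longrightarrow> sql2 (\<lambda>x. \<Sum>i\<in>I. f i x)"
  by (induction I rule: infinite_finite_induct) (auto intro: sql2_add)

lemma norm_mult_le_sq: "norm (a * b :: 'a::real_normed_algebra) \<le> (norm a)\<^sup>2 + (norm b)\<^sup>2"
proof -
  have "norm (a * b) \<le> norm a * norm b" by (rule norm_mult_ineq)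
  moreover have "2 * (norm a * norm b) \<le> (norm a)\<^sup>2 + (norm b)\<^sup>2"
    using sum_squares_bound[of "norm a" "norm b"] by simp
  moreover have "0 \<le> norm a * norm b" by simp
  ultimately show ?thesis by linarith
qed

lemma sql2_integrable_mult:
  assumes "sql2 f" "sql2 g"
  shows "integrable lborel (\<lambda>x. norm (f x) * norm (g x) * gw x)"
proof (rule Bochner_Integration.integrable_bound)
  show "integrable lborel (\<lambda>x. (norm (f x))\<^sup>2 * gw x + (norm (g x))\<^sup>2 * gw x)"
    using assms by (auto simp: sql2_def)
  show "AE x in lborel. norm (norm (f x) * norm (g x) * gw x)
      \<le> norm ((norm (f x))\<^sup>2 * gw x + (norm (g x))\<^sup>2 * gw x)"
  proof (intro AE_I2)
    fix x
    have "norm (f x * g x) * gw x \<le> ((norm (f x))\<^sup>2 + (norm (g x))\<^sup>2) * gw x"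
      by (intro mult_right_mono norm_mult_le_sq) auto
    then show "norm (norm (f x) * norm (g x) * gw x) \<le> norm ((norm (f x))\<^sup>2 * gw x + (norm (g x))\<^sup>2 * gw x)"
      by (simp add: algebra_simps norm_mult abs_mult)
  qed
qed (use assms in measurable)

lemma sql2_integrable:
  assumes "sql2 f" "sql2 g"
  shows "integrable lborel (\<lambda>x. f x * cnj (g x) * complex_of_real (gw x))"
proof (rule Bochner_Integration.integrable_bound[OF sql2_integrable_mult[OF assms]])
  show "(\<lambda>x. f x * cnj (g x) * complex_of_real (gw x)) \<in> borel_measurable lborel"
    using assms by measurable
qed (auto simp: norm_mult abs_mult)

lemma sip_add_left: "sql2 f \<Longrightarrow> sql2 g \<Longrightarrow> sql2 h \<Longrightarrow> sip (\<lambda>x. f x + g x) h = sip f h + sip g h"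
  unfolding sip_def by (simp add: distrib_right sql2_integrable)

lemma sip_add_right: "sql2 f \<Longrightarrow> sql2 g \<Longrightarrow> sql2 h \<Longrightarrow> sip h (\<lambda>x. f x + g x) = sip h f + sip h g"
  unfolding sip_def by (simp add: distrib_right distrib_left sql2_integrable)

lemma sip_diff_left: "sql2 f \<Longrightarrow> sql2 g \<Longrightarrow> sql2 h \<Longrightarrow> sip (\<lambda>x. f x - g x) h = sip f h - sip g h"
  unfolding sip_def by (simp add: left_diff_distrib sql2_integrable)

lemma sip_diff_right: "sql2 f \<Longrightarrow> sql2 g \<Longrightarrow> sql2 h \<Longrightarrow> sip h (\<lambda>x. f x - g x) = sip h f - sip h g"
  unfolding sip_def by (simp add: left_diff_distrib right_diff_distrib sql2_integrable)

lemma sip_scale_left: "sip (\<lambda>x. c * f x) g = c * sip f g"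
  unfolding sip_def by (simp add: mult.assoc)

lemma sip_scale_right: "sip f (\<lambda>x. c * g x) = cnj c * sip f g"
  unfolding sip_def by (simp add: mult.assoc mult.left_commute)

lemma sip_0 [simp]: "sip (\<lambda>x. 0) g = 0" "sip f (\<lambda>x. 0) = 0"
  by (simp_all add: sip_def)

lemma sip_sum_left: "(\<And>i. i \<in> I \<Longrightarrow> sql2 (f i)) \<Longrightarrow> sql2 g \<Longrightarrow>
    sip (\<lambda>x. \<Sum>i\<in>I. f i x) g = (\<Sum>i\<in>I. sip (f i) g)"
  by (induction I rule: infinite_finite_induct) (auto simp: sip_add_left sql2_sum)

lemma sip_sum_right: "(\<And>i. i \<in> I \<Longrightarrow> sql2 (f i)) \<Longrightarrow> sql2 g \<Longrightarrow>
    sip g (\<lambda>x. \<Sum>i\<in>I. f i x) = (\<Sum>i\<in>I. sip g (f i))"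
  by (induction I rule: infinite_finite_induct) (auto simp: sip_add_right sql2_sum)

lemma sip_cnj: "sip g f = cnj (sip f g)"
proof -
  have "cnj (sip f g) = (LINT x|lborel. cnj (f x * cnj (g x) * complex_of_real (gw x)))"
    unfolding sip_def by (simp del: complex_cnj_mult)
  then show ?thesis by (simp add: sip_def mult.commute)
qed

lemma sip_self: "sip f f = complex_of_real (nsq f)"
proof -
  have *: "f x * cnj (f x) * complex_of_real (gw x) = complex_of_real ((norm (f x))\<^sup>2 * gw x)" for x
    by (simp add: complex_norm_square del: of_real_power)
  show ?thesis
    unfolding sip_def nsq_def * by (rule integral_complex_of_real)
qed

lemma nsq_nonneg [simp]: "nsq f \<ge> 0"
  by (simp add: nsq_def)

lemma nsq_add_le: assumes "sql2 f" "sql2 g" shows "nsq (\<lambda>x. f x + g x) \<le> 2 * nsq f + 2 * nsq g"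
proof -
  have "nsq (\<lambda>x. f x + g x) \<le> (LINT x|lborel. 2 * ((norm (f x))\<^sup>2 * gw x) + 2 * ((norm (g x))\<^sup>2 * gw x))"
    unfolding nsq_def
  proof (rule integral_mono)
    fix x
    have "(norm (f x + g x))\<^sup>2 * gw x \<le> (2 * (norm (f x))\<^sup>2 + 2 * (norm (g x))\<^sup>2) * gw x"
      by (intro mult_right_mono norm_sq_add_le) auto
    then show "(norm (f x + g x))\<^sup>2 * gw x \<le> 2 * ((norm (f x))\<^sup>2 * gw x) + 2 * ((norm (g x))\<^sup>2 * gw x)"
      by (simp add: algebra_simps)
  qed (use assms sql2_add[OF assms] in \<open>auto simp: sql2_def\<close>)
  also have "\<dots> = 2 * nsq f + 2 * nsq g"
    using assms unfolding nsq_def by (subst Bochner_Integration.integral_add) (auto simp: sql2_def)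
  finally show ?thesis .
qed

lemma nsq_scale: "nsq (\<lambda>x. c * f x) = (norm c)\<^sup>2 * nsq f"
  by (simp add: nsq_def norm_mult power_mult_distrib mult.assoc)

lemma nsq_uminus_commute: "nsq (\<lambda>x. f x - g x) = nsq (\<lambda>x. g x - f x)"
  by (simp add: nsq_def norm_minus_commute)

lemma nsq_mono:
  assumes "sql2 g" "sql2 f" "\<And>x. norm (f x) \<le> C * norm (g x)"
  shows "nsq f \<le> C\<^sup>2 * nsq g"
proof -
  have "nsq f \<le> (LINT x|lborel. C\<^sup>2 * ((norm (g x))\<^sup>2 * gw x))"
    unfolding nsq_def
  proof (rule integral_mono)
    fix x
    have "(norm (f x))\<^sup>2 \<le> (C * norm (g x))\<^sup>2"
      using assms(3)[of x] by (intro power_mono) auto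
    then show "(norm (f x))\<^sup>2 * gw x \<le> C\<^sup>2 * ((norm (g x))\<^sup>2 * gw x)"
      by (simp add: power_mult_distrib mult.assoc[symmetric] mult_right_mono)
  qed (use assms in \<open>auto simp: sql2_def\<close>)
  then show ?thesis by (simp add: nsq_def)
qed

text \<open>The Cauchy-Schwarz inequality with a free parameter $t$, obtained by integrating the arithmetic-geometric
mean inequality. The choice $t = 1$ gives Cauchy estimates, a large $t$ gives continuity of the inner product.\<close>

lemma norm_sip_le:
  assumes "sql2 f" "sql2 g" "t > 0"
  shows "2 * norm (sip f g) \<le> t * nsq f + nsq g / t"
proof -
  have "norm (sip f g) \<le> (LINT x|lborel. norm (f x * cnj (g x) * complex_of_real (gw x)))"
    unfolding sip_def by (rule integral_norm_bound)
  also have "\<dots> \<le> (LINT x|lborel. t / 2 * ((norm (f x))\<^sup>2 * gw x) + 1 / (2 * t) * ((norm (g x))\<^sup>2 * gw x))"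
  proof (rule integral_mono)
    show "integrable lborel (\<lambda>x. norm (f x * cnj (g x) * complex_of_real (gw x)))"
      using sql2_integrable[OF assms(1,2)] by (rule integrable_norm)
    show "integrable lborel (\<lambda>x. t / 2 * ((norm (f x))\<^sup>2 * gw x) + 1 / (2 * t) * ((norm (g x))\<^sup>2 * gw x))"
      using assms by (auto simp: sql2_def)
    fix x
    have "0 \<le> (t * norm (f x) - norm (g x))\<^sup>2 / (2 * t)" using assms by auto
    also have "\<dots> = t / 2 * (norm (f x))\<^sup>2 + 1 / (2 * t) * (norm (g x))\<^sup>2 - norm (f x) * norm (g x)"
      using assms(3) by (simp add: power2_eq_square field_simps)
    finally have "norm (f x) * norm (g x) * gw x
        \<le> (t / 2 * (norm (f x))\<^sup>2 + 1 / (2 * t) * (norm (g x))\<^sup>2) * gw x"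
      by (intro mult_right_mono) auto
    then show "norm (f x * cnj (g x) * complex_of_real (gw x))
        \<le> t / 2 * ((norm (f x))\<^sup>2 * gw x) + 1 / (2 * t) * ((norm (g x))\<^sup>2 * gw x)"
      by (simp add: norm_mult distrib_right)
  qed
  also have "\<dots> = t / 2 * nsq f + 1 / (2 * t) * nsq g"
    using assms unfolding nsq_def by (subst Bochner_Integration.integral_add) (auto simp: sql2_def)
  finally show ?thesis by (simp add: field_simps)
qed

lemma tendsto_sip_left:
  assumes "\<And>n. sql2 (f n)" "sql2 g" "sql2 h" "(\<lambda>n. nsq (\<lambda>x. f n x - g x)) \<longlonglongrightarrow> 0"
  shows "(\<lambda>n. sip (f n) h) \<longlonglongrightarrow> sip g h"
proof (rule LIMSEQ_I)
  fix e :: real assume e: "e > 0"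
  \<comment> \<open>The summand 1 keeps t positive when h vanishes.\<close>
  define t where "t = (nsq h + 1) / e"
  have nh: "nsq h + 1 > 0" by (simp add: add_nonneg_pos)
  have t: "t > 0" using e nh by (simp add: t_def)
  obtain N where N: "\<And>n. n \<ge> N \<Longrightarrow> nsq (\<lambda>x. f n x - g x) < e / t"
    using LIMSEQ_D[OF assms(4), of "e / t"] e t by (auto simp: abs_less_iff)
  show "\<exists>N. \<forall>n\<ge>N. norm (sip (f n) h - sip g h) < e"
  proof (intro exI[of _ N] allI impI)
    fix n assume "n \<ge> N"
    have "2 * norm (sip (\<lambda>x. f n x - g x) h) \<le> t * nsq (\<lambda>x. f n x - g x) + nsq h / t"
      by (intro norm_sip_le sql2_diff assms t)
    also have "t * nsq (\<lambda>x. f n x - g x) < e" using N[OF \<open>n \<ge> N\<close>] t by (simp add: field_simps)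
    also have "nsq h / t \<le> e"
      using e nh by (simp add: t_def field_simps)
    finally show "norm (sip (f n) h - sip g h) < e"
      using assms by (simp add: sip_diff_left)
  qed
qed

lemma nsq_eq_0_iff: "sql2 f \<Longrightarrow> nsq f = 0 \<longleftrightarrow> (AE x in lborel. f x = 0)"
  unfolding nsq_def sql2_def by (subst integral_nonneg_eq_0_iff_AE) auto

lemma nsq_tendsto_dominated:
  assumes "\<And>n. F n \<in> borel_measurable borel" "f \<in> borel_measurable borel" "sql2 h"
    and "\<And>x. (\<lambda>n. F n x) \<longlonglongrightarrow> f x" "\<And>n x. norm (F n x) \<le> C * norm (h x)"
  shows "(\<lambda>n. nsq (\<lambda>x. F n x - f x)) \<longlonglongrightarrow> 0"
proof -
  have lim: "norm (f x) \<le> C * norm (h x)" for x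
    using assms(4,5) by (intro Lim_bounded[OF tendsto_norm[OF assms(4)[of x]]]) auto
  have "(\<lambda>n. nsq (\<lambda>x. F n x - f x)) \<longlonglongrightarrow> (LINT x|(lborel :: 'a measure). 0)"
    unfolding nsq_def
  proof (rule integral_dominated_convergence)
    show "integrable lborel (\<lambda>x. (2 * C)\<^sup>2 * ((norm (h x))\<^sup>2 * gw x))"
      using assms(3) by (auto simp: sql2_def)
    show "AE x in lborel. (\<lambda>n. (norm (F n x - f x))\<^sup>2 * gw x) \<longlonglongrightarrow> 0"
    proof (intro AE_I2)
      fix x
      have "(\<lambda>n. (norm (F n x - f x))\<^sup>2 * gw x) \<longlonglongrightarrow> (norm (f x - f x))\<^sup>2 * gw x"
        by (intro tendsto_intros assms)
      then show "(\<lambda>n. (norm (F n x - f x))\<^sup>2 * gw x) \<longlonglongrightarrow> 0" by simp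
    qed
    show "AE x in lborel. norm ((norm (F n x - f x))\<^sup>2 * gw x) \<le> (2 * C)\<^sup>2 * ((norm (h x))\<^sup>2 * gw x)" for n
    proof (intro AE_I2)
      fix x
      have "norm (F n x - f x) \<le> 2 * C * norm (h x)"
        using lim[of x] assms(5)[of n x] norm_triangle_ineq4[of "F n x" "f x"] by simp
      then have "(norm (F n x - f x))\<^sup>2 \<le> (2 * C * norm (h x))\<^sup>2" by (intro power_mono) auto
      then show "norm ((norm (F n x - f x))\<^sup>2 * gw x) \<le> (2 * C)\<^sup>2 * ((norm (h x))\<^sup>2 * gw x)"
        by (simp add: power_mult_distrib mult.assoc[symmetric] mult_right_mono)
    qed
  qed (use assms in measurable)
  then show ?thesis by simp
qed

section \<open>Partial derivatives and the Gaussian\<close>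

abbreviation ax :: "'n::finite \<Rightarrow> 4 \<Rightarrow> 'n space" where
  "ax l j \<equiv> axis l (axis j 1)"

text \<open>Reads off a partial derivative from any derivative of the function; the rules below are instances.\<close>

lemma pd_eqI: "(f has_derivative D) (at x) \<Longrightarrow> pd l j f x = D (ax l j)"
  unfolding pd_def by (metis frechet_derivative_at)

lemma pd_const [simp]: "pd l j (\<lambda>x. c) = (\<lambda>x. 0)"
  by (rule ext) (simp add: pd_eqI[OF has_derivative_const])

lemma pd_add:
  assumes "f differentiable (at x)" "g differentiable (at x)"
  shows "pd l j (\<lambda>x. f x + g x) x = pd l j f x + pd l j g x"
  using pd_eqI[OF has_derivative_add[OF assms[unfolded frechet_derivative_works]]] by (simp add: pd_def)

lemma pd_mult:
  assumes "f differentiable (at x)" "g differentiable (at x)"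
  shows "pd l j (\<lambda>x. f x * g x) x = f x * pd l j g x + pd l j f x * g x"
  using pd_eqI[OF has_derivative_mult[OF assms[unfolded frechet_derivative_works]]] by (simp add: pd_def)

lemma pd_scale:
  assumes "f differentiable (at x)"
  shows "pd l j (\<lambda>x. c * f x) x = c * pd l j f x"
  using pd_mult[of "\<lambda>x. c" x f l j] assms by simp

lemma has_derivative_cnj:
  "(f has_derivative D) F \<Longrightarrow> ((\<lambda>x. cnj (f x)) has_derivative (\<lambda>x. cnj (D x))) F"
  by (rule bounded_linear.has_derivative[OF bounded_linear_cnj])

lemma differentiable_cnj: "f differentiable F \<Longrightarrow> (\<lambda>x. cnj (f x)) differentiable F"
  unfolding differentiable_def by (blast intro: has_derivative_cnj)

lemma pd_cnj:
  assumes "f differentiable (at x)" shows "pd l j (\<lambda>x. cnj (f x)) x = cnj (pd l j f x)"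
  using pd_eqI[OF has_derivative_cnj[OF assms[unfolded frechet_derivative_works]]] by (simp add: pd_def)

lemma has_derivative_of_real_chain:
  assumes "(f has_derivative D) (at x)" "(g has_real_derivative g') (at (f x))"
  shows "((\<lambda>x. complex_of_real (g (f x))) has_derivative (\<lambda>h. complex_of_real (g' * D h))) (at x)"
  using bounded_linear.has_derivative[OF bounded_linear_of_real
      has_derivative_compose[OF assms(1) assms(2)[unfolded has_field_derivative_def]]]
  by (simp add: o_def)

lemma coord_has_derivative:
  "((\<lambda>x. complex_of_real (x $ l $ j)) has_derivative (\<lambda>h. complex_of_real (h $ l $ j))) (at x)"
  by (rule bounded_linear_imp_has_derivative)
    (intro bounded_linear_compose[OF bounded_linear_of_real] bounded_linear_compose[OF bounded_linear_vec_nth]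
      bounded_linear_vec_nth)

lemma coord_differentiable: "(\<lambda>x. complex_of_real (x $ l $ j)) differentiable (at x)"
  using coord_has_derivative unfolding differentiable_def by blast

lemma pd_coord: "pd l j (\<lambda>x. complex_of_real (x $ l' $ j')) x = (if l = l' \<and> j = j' then 1 else 0)"
  by (auto simp: pd_eqI[OF coord_has_derivative] axis_def)

lemma norm_sq_has_derivative:
  "((\<lambda>x::'a::euclidean_space. (norm x)\<^sup>2) has_derivative (\<lambda>h. 2 * (x \<bullet> h))) (at x)"
  unfolding power2_norm_eq_inner by (auto intro!: derivative_eq_intros simp: inner_commute)

lemma gw_has_derivative:
  "((\<lambda>x. complex_of_real (gw x)) has_derivative (\<lambda>h. complex_of_real (gw x * (- 4) * (x \<bullet> h)))) (at x)"
proof -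
  have "((\<lambda>s. exp (- 2 * s)) has_real_derivative exp (- 2 * (norm x)\<^sup>2) * (- 2)) (at ((norm x)\<^sup>2))"
    by (auto intro!: derivative_eq_intros)
  from has_derivative_of_real_chain[OF norm_sq_has_derivative this] show ?thesis
    by (simp add: gw_def mult_ac)
qed

lemma gw_differentiable: "(\<lambda>x. complex_of_real (gw x)) differentiable (at x)"
  using gw_has_derivative unfolding differentiable_def by blast

lemma inner_ax: "x \<bullet> ax l j = x $ l $ j"
  by (simp add: inner_axis)

lemma pd_gw: "pd l j (\<lambda>x. complex_of_real (gw x)) x = - 4 * complex_of_real (x $ l $ j) * complex_of_real (gw x)"
  by (simp add: pd_eqI[OF gw_has_derivative] inner_ax mult_ac)

section \<open>Polynomials\<close>

text \<open>Polynomials of degree less than $d$, so that \<open>pol 0\<close> contains only the zero function. With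
this shift differentiation maps \<open>pol d\<close> to \<open>pol (d - 1)\<close> without exception, in spite of the truncated subtraction.\<close>

inductive pol :: "nat \<Rightarrow> ('n::finite space \<Rightarrow> complex) \<Rightarrow> bool" where
  pol_zero: "pol d (\<lambda>x. 0)"
| pol_const: "pol (Suc d) (\<lambda>x. c)"
| pol_add: "pol d f \<Longrightarrow> pol d g \<Longrightarrow> pol d (\<lambda>x. f x + g x)"
| pol_coord: "pol d f \<Longrightarrow> pol (Suc d) (\<lambda>x. complex_of_real (x $ l $ j) * f x)"

lemma pol_0: "pol d f \<Longrightarrow> d = 0 \<Longrightarrow> f = (\<lambda>x. 0)"
  by (induction rule: pol.induct) auto

lemma pol_Suc: "pol d f \<Longrightarrow> pol (Suc d) f"
  by (induction rule: pol.induct) (auto intro: pol.intros)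

lemma pol_mono: "pol d f \<Longrightarrow> d \<le> e \<Longrightarrow> pol e f"
  by (induction e) (auto simp: le_Suc_eq intro: pol_Suc)

lemma pol_scale: "pol d f \<Longrightarrow> pol d (\<lambda>x. c * f x)"
proof (induction rule: pol.induct)
  case (pol_coord d f l j)
  then show ?case using pol.pol_coord[of d "\<lambda>x. c * f x" l j] by (simp add: mult_ac)
qed (auto simp: distrib_left intro: pol.intros)

lemma pol_cnj: "pol d f \<Longrightarrow> pol d (\<lambda>x. cnj (f x))"
  by (induction rule: pol.induct) (auto intro: pol.intros)

lemma pol_diff: "pol d f \<Longrightarrow> pol d g \<Longrightarrow> pol d (\<lambda>x. f x - g x)"
  using pol_add[OF _ pol_scale[of d g "-1"]] by simp

lemma pol_sum: "(\<And>i. i \<in> I \<Longrightarrow> pol d (f i)) \<Longrightarrow> pol d (\<lambda>x. \<Sum>i\<in>I. f i x)"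
  by (induction I rule: infinite_finite_induct) (auto intro: pol.intros)

lemma pol_differentiable: "pol d f \<Longrightarrow> f differentiable (at x)"
  by (induction rule: pol.induct) (auto intro: differentiable_mult coord_differentiable)

lemma pol_continuous: "pol d f \<Longrightarrow> continuous_on UNIV f"
  by (meson pol_differentiable differentiable_imp_continuous_on differentiable_at_imp_differentiable_on)

lemma pol_measurable: "pol d f \<Longrightarrow> f \<in> borel_measurable borel"
  by (intro borel_measurable_continuous_onI pol_continuous)

lemma exptype_coord: "exptype (\<lambda>x::'n::finite space. complex_of_real (x $ l $ j))"
proof (rule exptypeI)
  fix x :: "'n space"
  have "\<bar>x $ l $ j\<bar> \<le> norm x"
    by (rule order_trans[OF component_le_norm_cart Finite_Cartesian_Product.norm_nth_le])
  also have "\<dots> \<le> exp (norm x)" using exp_ge_add_one_self[of "norm x"] by linarith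
  finally show "norm (complex_of_real (x $ l $ j)) \<le> 1 * exp (1 * norm x)" by simp
qed

lemma pol_exptype: "pol d f \<Longrightarrow> exptype f"
  by (induction rule: pol.induct) (auto intro: exptype_const exptype_add exptype_mult exptype_coord)

lemma pol_sql2: "pol d f \<Longrightarrow> sql2 f"
  by (intro sql2_exptype pol_exptype pol_measurable)

lemma pd_coord_mult:
  assumes "f differentiable (at x)"
  shows "pd l j (\<lambda>x. complex_of_real (x $ l' $ j') * f x) x
    = complex_of_real (x $ l' $ j') * pd l j f x + (if l = l' \<and> j = j' then f x else 0)"
  by (simp add: pd_mult[OF coord_differentiable assms] pd_coord)

lemma pol_pd: "pol d f \<Longrightarrow> pol (d - 1) (pd l j f)"
proof (induction rule: pol.induct)
  case (pol_add d f g)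
  have "pd l j (\<lambda>x. f x + g x) = (\<lambda>x. pd l j f x + pd l j g x)"
    using pol_add by (auto intro: pd_add pol_differentiable)
  then show ?case using pol_add by (auto intro: pol.pol_add)
next
  case (pol_coord d f l' j')
  have *: "pd l j (\<lambda>x. complex_of_real (x $ l' $ j') * f x)
    = (\<lambda>x. complex_of_real (x $ l' $ j') * pd l j f x + (if l = l' \<and> j = j' then f x else 0))"
    using pol_coord by (auto intro!: pd_coord_mult pol_differentiable)
  have "pol d (\<lambda>x. complex_of_real (x $ l' $ j') * pd l j f x)"
  proof (cases d)
    case 0
    then show ?thesis using pol_0[OF pol_coord.hyps] by (simp add: pol_zero)
  next
    case (Suc e)
    then show ?thesis using pol.pol_coord[OF pol_coord.IH] by simp
  qed
  then show ?case unfolding * using pol_coord.hyps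
    by (cases "l = l' \<and> j = j'") (auto simp del: One_nat_def intro: pol.pol_add)
qed (auto intro: pol.intros)

lemma pd_commute_pol: "pol d f \<Longrightarrow> pd l j (pd l' j' f) = pd l' j' (pd l j f)"
proof (induction rule: pol.induct)
  case (pol_add d f g)
  have "pd l j (\<lambda>x. f x + g x) = (\<lambda>x. pd l j f x + pd l j g x)" for l j
    using pol_add by (auto intro: pd_add pol_differentiable)
  moreover have "pd l j (\<lambda>x. pd m i f x + pd m i g x) = (\<lambda>x. pd l j (pd m i f) x + pd l j (pd m i g) x)" for l j m i
    using pol_add by (auto intro: pd_add pol_differentiable pol_pd)
  ultimately show ?case using pol_add by simp
next
  case (pol_coord d f m i)
  note df = pol_differentiable[OF pol_coord.hyps] pol_differentiable[OF pol_pd[OF pol_coord.hyps]]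
  have 1: "pd l j (\<lambda>x. complex_of_real (x $ m $ i) * f x)
    = (\<lambda>x. complex_of_real (x $ m $ i) * pd l j f x + (if l = m \<and> j = i then 1 else 0) * f x)" for l j
    by (rule ext) (simp add: pd_coord_mult df)
  have 2: "pd l j (\<lambda>x. complex_of_real (x $ m $ i) * pd l' j' f x + c * f x) x
      = complex_of_real (x $ m $ i) * pd l j (pd l' j' f) x + (if l = m \<and> j = i then pd l' j' f x else 0)
        + c * pd l j f x" for l j l' j' c x
    by (subst pd_add) (auto intro: differentiable_mult coord_differentiable simp: df pd_coord_mult pd_scale)
  show ?case
    by (rule ext) (simp only: 1 2, simp add: pol_coord.IH)
qed auto

section \<open>Integration by parts\<close>

lemma continuous_supp_integrable:
  fixes f :: "'a::euclidean_space \<Rightarrow> complex"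
  assumes "continuous_on UNIV f" "\<And>x. norm x > R \<Longrightarrow> f x = 0"
  shows "integrable lborel f"
proof -
  have "integrable lborel (\<lambda>x. indicator (cball 0 R) x *\<^sub>R f x)"
    using assms(1) by (intro borel_integrable_compact) (auto intro: continuous_on_subset)
  also have "(\<lambda>x. indicator (cball 0 R) x *\<^sub>R f x) = f"
    using assms(2) by (auto simp: indicator_def fun_eq_iff)
  finally show ?thesis .
qed

text \<open>The integral of every difference quotient vanishes by translation invariance. The
quotients are bounded by $M$ and vanish off a fixed ball, so the limit may be taken under the integral.\<close>

lemma integral_pd_eq_0:
  fixes F :: "'n::finite space \<Rightarrow> complex"
  assumes diff: "\<And>x. F differentiable (at x)"
    and supp: "\<And>x. norm x > R \<Longrightarrow> F x = 0"
    and bound: "\<And>x. norm (pd l j F x) \<le> M"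
  shows "(LINT x|lborel. pd l j F x) = 0"
proof -
  have cont: "continuous_on UNIV F"
    using diff by (meson differentiable_imp_continuous_on differentiable_at_imp_differentiable_on)
  have [measurable]: "F \<in> borel_measurable borel"
    by (intro borel_measurable_continuous_onI cont)
  have M: "M \<ge> 0" using bound[of 0] norm_ge_zero order_trans by blast
  have intF: "integrable lborel F"
    by (rule continuous_supp_integrable[OF cont supp])
  define q where "q n x = complex_of_real (real (Suc n)) * (F (x + (1 / real (Suc n)) *\<^sub>R ax l j) - F x)" for n x
  have [measurable]: "q n \<in> borel_measurable borel" for n
    unfolding q_def by measurable
  have line: "((\<lambda>s. F (x + s *\<^sub>R ax l j)) has_vector_derivative pd l j F (x + s *\<^sub>R ax l j)) (at s within S)" for x s S
  proof -
    have "((\<lambda>s. x + s *\<^sub>R ax l j) has_derivative (\<lambda>h. h *\<^sub>R ax l j)) (at s within S)"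
      by (auto intro!: derivative_eq_intros)
    moreover have "(F has_derivative frechet_derivative F (at (x + s *\<^sub>R ax l j))) (at (x + s *\<^sub>R ax l j))"
      using diff frechet_derivative_works by blast
    ultimately have "((\<lambda>s. F (x + s *\<^sub>R ax l j)) has_derivative
        (\<lambda>h. frechet_derivative F (at (x + s *\<^sub>R ax l j)) (h *\<^sub>R ax l j))) (at s within S)"
      by (rule has_derivative_compose)
    moreover have "frechet_derivative F (at (x + s *\<^sub>R ax l j)) (h *\<^sub>R ax l j) = h *\<^sub>R pd l j F (x + s *\<^sub>R ax l j)" for h
      unfolding pd_def using linear_frechet_derivative[OF diff] by (simp add: linear_cmul)
    ultimately show ?thesis unfolding has_vector_derivative_def by simp
  qed
  have lim: "(\<lambda>n. q n x) \<longlonglongrightarrow> pd l j F x" for x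
  proof -
    have "((\<lambda>s. F (x + s *\<^sub>R ax l j)) has_vector_derivative pd l j F x) (at 0)"
      using line[of x 0 UNIV] by simp
    then have "((\<lambda>h. norm (F (x + h *\<^sub>R ax l j) - F x - h *\<^sub>R pd l j F x) / \<bar>h\<bar>) \<longlongrightarrow> 0) (at 0)"
      by (simp add: has_vector_derivative_def has_derivative_iff_norm)
    moreover have "filterlim (\<lambda>n. 1 / real (Suc n)) (at 0) sequentially"
      unfolding filterlim_at using LIMSEQ_Suc[OF lim_1_over_n[where 'a = real]] by auto
    ultimately have "(\<lambda>n. norm (F (x + (1 / real (Suc n)) *\<^sub>R ax l j) - F x - (1 / real (Suc n)) *\<^sub>R pd l j F x)
        / \<bar>1 / real (Suc n)\<bar>) \<longlonglongrightarrow> 0"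
      by (rule filterlim_compose)
    moreover have "norm (F (x + (1 / real (Suc n)) *\<^sub>R ax l j) - F x - (1 / real (Suc n)) *\<^sub>R pd l j F x)
        / \<bar>1 / real (Suc n)\<bar> = norm (q n x - pd l j F x)" for n
    proof -
      have "q n x - pd l j F x = complex_of_real (real (Suc n)) *
          (F (x + (1 / real (Suc n)) *\<^sub>R ax l j) - F x - (1 / real (Suc n)) *\<^sub>R pd l j F x)"
        by (simp add: q_def scaleR_conv_of_real right_diff_distrib del: of_nat_Suc)
      then show ?thesis by (simp add: norm_mult del: of_nat_Suc)
    qed
    ultimately show ?thesis by (simp add: Lim_null[of _ "pd l j F x"] tendsto_norm_zero_iff)
  qed
  have qM: "norm (q n x) \<le> M" for n x
  proof -
    have "norm (F (x + (1 / real (Suc n)) *\<^sub>R ax l j) - F (x + 0 *\<^sub>R ax l j)) \<le> M * norm (1 / real (Suc n) - 0)"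
      using bound M line
      by (intro differentiable_bound[of UNIV _ "\<lambda>s h. h *\<^sub>R pd l j F (x + s *\<^sub>R ax l j)"])
        (auto simp: has_vector_derivative_def intro!: onorm_bound, metis abs_ge_zero mult.commute mult_right_mono)
    then have *: "norm (F (x + (1 / real (Suc n)) *\<^sub>R ax l j) - F x) \<le> M / real (Suc n)" by simp
    have "norm (q n x) = real (Suc n) * norm (F (x + (1 / real (Suc n)) *\<^sub>R ax l j) - F x)"
      unfolding q_def norm_mult norm_of_real by simp
    also have "\<dots> \<le> real (Suc n) * (M / real (Suc n))"
      using * by (intro mult_left_mono) auto
    finally show ?thesis by simp
  qed
  have q0: "q n x = 0" if "norm x > R + 1" for n x
  proof -
    let ?h = "(1 / real (Suc n)) *\<^sub>R ax l j"
    have "norm ?h \<le> 1" by simp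
    moreover have "norm x \<le> norm (x + ?h) + norm ?h"
      using norm_triangle_ineq4[of "x + ?h" ?h] by simp
    ultimately have "norm (x + ?h) > R" using that by linarith
    then show ?thesis using that supp by (simp add: q_def)
  qed
  have "(\<lambda>n. LINT x|lborel. q n x) \<longlonglongrightarrow> (LINT x|lborel. pd l j F x)"
  proof (rule integral_dominated_convergence)
    show "integrable lborel (\<lambda>x::'n space. M * indicator (cball 0 (R + 1)) x)"
      by (intro integrable_mult_right integrable_real_indicator) (use emeasure_bounded_finite[OF bounded_cball] in auto)
    show "AE x in lborel. norm (q n x) \<le> M * indicator (cball 0 (R + 1)) x" for n
      using qM[of n] q0[of _ n] by (intro AE_I2) (auto simp: indicator_def not_le)
    show "pd l j F \<in> borel_measurable lborel"
      using borel_measurable_LIMSEQ_metric[of q lborel "pd l j F"] lim by simp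
  qed (use lim in auto)
  moreover have "(LINT x|lborel. q n x) = 0" for n
  proof -
    let ?a = "(1 / real (Suc n)) *\<^sub>R ax l j"
    have "integrable lborel (\<lambda>x. F (?a + x))"
      using intF by (subst (asm) lborel_distr_plus[of ?a, symmetric]) (simp add: integrable_distr_eq)
    moreover have "(LINT x|lborel. F (?a + x)) = (LINT x|lborel. F x)"
      by (subst lborel_distr_plus[of ?a, symmetric]) (simp add: integral_distr)
    ultimately show ?thesis using intF by (simp add: q_def add.commute)
  qed
  ultimately have "(\<lambda>n. 0) \<longlonglongrightarrow> (LINT x|lborel. pd l j F x)" by simp
  then show ?thesis using LIMSEQ_unique tendsto_const by blast
qed

section \<open>The fields as annihilation operators\<close>

text \<open>The coefficient of $\partial_{x_{4l+j}}$ in $Z_A^{A'}$ for $A = 2l + s$ and $A' = a$.\<close>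

definition Z_coeff :: "2 \<Rightarrow> 2 \<Rightarrow> 4 \<Rightarrow> complex" where
  "Z_coeff s a j =
    (if s = 0 then
       (if a = 0 then (if j = 3 then - 1 else if j = 4 then - \<i> else 0)
        else (if j = 1 then - 1 else if j = 2 then - \<i> else 0))
     else
       (if a = 0 then (if j = 1 then 1 else if j = 2 then - \<i> else 0)
        else (if j = 3 then - 1 else if j = 4 then \<i> else 0)))"

lemma Z_up_eq: "Z_up A a f x = (\<Sum>j\<in>UNIV. Z_coeff (snd A) a j * pd (fst A) j f x)"
  by (simp add: Z_up_def Z_low_def Let_def Z_coeff_def sum_4)

text \<open>The reason for all commutation relations: the four coefficient vectors belonging to one $l$ are
orthogonal and of squared length $2$.\<close>

lemma Z_coeff_orth: "(\<Sum>j\<in>UNIV. Z_coeff s a j * cnj (Z_coeff t b j)) = (if s = t \<and> a = b then 2 else 0)"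
proof -
  have "s = 0 \<or> s = 1" "t = 0 \<or> t = 1" "a = 0 \<or> a = 1" "b = 0 \<or> b = 1"
    using exhaust_2[of s] exhaust_2[of t] exhaust_2[of a] exhaust_2[of b] by auto
  then show ?thesis by (elim disjE) (simp_all add: Z_coeff_def sum_4)
qed

text \<open>The weighted adjoint $-\partial_j + 4x_j$ of $\partial_j$.\<close>

definition creation :: "'n::finite \<Rightarrow> 4 \<Rightarrow> ('n space \<Rightarrow> complex) \<Rightarrow> 'n space \<Rightarrow> complex" where
  "creation l j f x = 4 * (complex_of_real (x $ l $ j) * f x) - pd l j f x"

text \<open>The formal adjoint of $Z_A^{A'}$ for the weighted inner product.\<close>

definition Z_adj :: "'n::finite uidx \<Rightarrow> 2 \<Rightarrow> ('n space \<Rightarrow> complex) \<Rightarrow> 'n space \<Rightarrow> complex" where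
  "Z_adj A a f x = (\<Sum>j\<in>UNIV. cnj (Z_coeff (snd A) a j) * creation (fst A) j f x)"

lemma pol_creation: "pol d f \<Longrightarrow> pol (Suc d) (creation l j f)"
  unfolding creation_def by (intro pol_diff pol_scale pol_coord pol_mono[OF pol_pd]) auto

lemma pol_Z_adj: "pol d f \<Longrightarrow> pol (Suc d) (Z_adj A a f)"
  unfolding Z_adj_def by (intro pol_sum pol_scale pol_creation)

lemma pol_Z: "pol d f \<Longrightarrow> pol (d - 1) (Z_up A a f)"
  unfolding Z_up_eq by (intro pol_sum pol_scale pol_pd)

lemma pol_Z': "pol (Suc d) f \<Longrightarrow> pol d (Z_up A a f)"
  using pol_Z[of "Suc d"] by simp

lemma pd_sum: "(\<And>i. i \<in> I \<Longrightarrow> f i differentiable (at x)) \<Longrightarrow>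
    pd l j (\<lambda>x. \<Sum>i\<in>I. f i x) x = (\<Sum>i\<in>I. pd l j (f i) x)"
  by (induction I rule: infinite_finite_induct) (simp_all add: pd_add)

lemma pd_diff:
  assumes "f differentiable (at x)" "g differentiable (at x)"
  shows "pd l j (\<lambda>x. f x - g x) x = pd l j f x - pd l j g x"
proof -
  have "pd l j (\<lambda>x. f x + (- 1) * g x) x = pd l j f x + (- 1) * pd l j g x"
    by (simp only: pd_add pd_scale assms differentiable_mult differentiable_const)
  then show ?thesis by simp
qed

lemma pd_creation:
  assumes "pol d f"
  shows "pd l j (creation m i f) x = creation m i (pd l j f) x + (if l = m \<and> j = i then 4 * f x else 0)"
proof -
  have d: "f differentiable (at x)" "pd m i f differentiable (at x)"
    using assms by (auto intro: pol_differentiable pol_pd)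
  have "pd l j (creation m i f) x = 4 * pd l j (\<lambda>x. complex_of_real (x $ m $ i) * f x) x - pd l j (pd m i f) x"
    unfolding creation_def
    by (simp only: pd_diff pd_scale d differentiable_mult coord_differentiable differentiable_const)
  also have "\<dots> = creation m i (pd l j f) x + (if l = m \<and> j = i then 4 * f x else 0)"
    by (simp add: pd_coord_mult[OF d(1)] creation_def pd_commute_pol[OF assms, of l j m i])
  finally show ?thesis .
qed

lemma Z_sum: "(\<And>i. i \<in> I \<Longrightarrow> pol d (f i)) \<Longrightarrow>
    Z_up A a (\<lambda>x. \<Sum>i\<in>I. f i x) x = (\<Sum>i\<in>I. Z_up A a (f i) x)"
  unfolding Z_up_eq
  by (subst pd_sum) (auto intro: pol_differentiable simp: sum_distrib_left intro: sum.swap)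

lemma Z_scale: "pol d f \<Longrightarrow> Z_up A a (\<lambda>x. c * f x) x = c * Z_up A a f x"
  unfolding Z_up_eq by (simp add: pd_scale pol_differentiable sum_distrib_left mult_ac)

lemma Z_add: "pol d f \<Longrightarrow> pol d g \<Longrightarrow> Z_up A a (\<lambda>x. f x + g x) x = Z_up A a f x + Z_up A a g x"
  unfolding Z_up_eq by (simp add: pd_add pol_differentiable sum.distrib distrib_left)

lemma Z_adj_scale: "pol d f \<Longrightarrow> Z_adj A a (\<lambda>x. c * f x) x = c * Z_adj A a f x"
  unfolding Z_adj_def creation_def
  by (simp add: pd_scale pol_differentiable sum_distrib_left right_diff_distrib mult_ac)

lemma Z_adj_add: "pol d f \<Longrightarrow> pol d g \<Longrightarrow> Z_adj A a (\<lambda>x. f x + g x) x = Z_adj A a f x + Z_adj A a g x"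
  unfolding Z_adj_def creation_def sum.distrib[symmetric]
  by (intro sum.cong refl) (simp add: pd_add pol_differentiable algebra_simps)

lemma Z_adj_0 [simp]: "Z_adj A a (\<lambda>x. 0) x = 0"
  by (simp add: Z_adj_def creation_def)

lemma Z_adj_sum: "(\<And>i. i \<in> I \<Longrightarrow> pol d (f i)) \<Longrightarrow>
    Z_adj A a (\<lambda>x. \<Sum>i\<in>I. f i x) x = (\<Sum>i\<in>I. Z_adj A a (f i) x)"
proof (induction I rule: infinite_finite_induct)
  case (insert i I)
  then show ?case using Z_adj_add[of d "f i" "\<lambda>x. \<Sum>i\<in>I. f i x" A a x] by (simp add: pol_sum)
qed auto

text \<open>$[\partial_j, -\partial_i + 4x_i] = 4\delta_{ij}$, combined with the orthogonality of the coefficient vectors.\<close>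

lemma Z_adj_commutator:
  assumes "pol d f"
  shows "Z_up A a (Z_adj B b f) x = Z_adj B b (Z_up A a f) x + (if A = B \<and> a = b then 8 * f x else 0)"
proof -
  have "Z_up A a (Z_adj B b f) x =
      (\<Sum>j\<in>UNIV. Z_coeff (snd A) a j * (\<Sum>i\<in>UNIV. cnj (Z_coeff (snd B) b i) * pd (fst A) j (creation (fst B) i f) x))"
    unfolding Z_up_eq Z_adj_def
    by (intro sum.cong refl arg_cong2[of _ _ _ _ "(*)"])
      (subst pd_sum, auto intro!: pol_differentiable pol_scale pol_creation assms simp: pd_scale[OF pol_differentiable[OF pol_creation[OF assms]]])
  also have "\<dots> = (\<Sum>j\<in>UNIV. \<Sum>i\<in>UNIV. Z_coeff (snd A) a j * cnj (Z_coeff (snd B) b i) * creation (fst B) i (pd (fst A) j f) x)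
      + (\<Sum>j\<in>UNIV. \<Sum>i\<in>UNIV. if fst A = fst B \<and> j = i then Z_coeff (snd A) a j * cnj (Z_coeff (snd B) b i) * (4 * f x) else 0)"
    unfolding sum.distrib[symmetric] sum_distrib_left
    by (intro sum.cong refl) (simp add: pd_creation[OF assms] algebra_simps)
  also have "(\<Sum>j\<in>UNIV. \<Sum>i\<in>UNIV. if fst A = fst B \<and> j = i then Z_coeff (snd A) a j * cnj (Z_coeff (snd B) b i) * (4 * f x) else 0)
      = (if fst A = fst B then (\<Sum>j\<in>UNIV. Z_coeff (snd A) a j * cnj (Z_coeff (snd B) b j)) * (4 * f x) else 0)"
    by (auto simp: sum_distrib_right)
  also have "\<dots> = (if A = B \<and> a = b then 8 * f x else 0)"
    by (auto simp: Z_coeff_orth prod_eq_iff)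
  also have "(\<Sum>j\<in>UNIV. \<Sum>i\<in>UNIV. Z_coeff (snd A) a j * cnj (Z_coeff (snd B) b i) * creation (fst B) i (pd (fst A) j f) x)
      = Z_adj B b (Z_up A a f) x"
  proof -
    have "Z_adj B b (Z_up A a f) x = Z_adj B b (\<lambda>x. \<Sum>j\<in>UNIV. Z_coeff (snd A) a j * pd (fst A) j f x) x"
      by (simp add: Z_up_eq[abs_def])
    also have "\<dots> = (\<Sum>j\<in>UNIV. Z_coeff (snd A) a j * Z_adj B b (pd (fst A) j f) x)"
      by (subst Z_adj_sum[of _ "d - 1"]) (auto intro!: pol_scale pol_pd assms simp: Z_adj_scale[OF pol_pd[OF assms]] simp del: One_nat_def)
    finally show ?thesis by (simp add: Z_adj_def sum_distrib_left mult_ac)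
  qed
  finally show ?thesis .
qed

lemma Z_commute:
  assumes "pol d f" shows "Z_up A a (Z_up B b f) x = Z_up B b (Z_up A a f) x"
proof -
  have *: "Z_up A a (Z_up B b f) x =
      (\<Sum>j\<in>UNIV. \<Sum>i\<in>UNIV. Z_coeff (snd A) a j * Z_coeff (snd B) b i * pd (fst A) j (pd (fst B) i f) x)" for A B a b
  proof -
    have "pd (fst A) j (Z_up B b f) x = (\<Sum>i\<in>UNIV. Z_coeff (snd B) b i * pd (fst A) j (pd (fst B) i f) x)" for j
      unfolding Z_up_eq[abs_def]
      by (subst pd_sum) (auto intro!: pol_differentiable pol_scale pol_pd assms
          simp: pd_scale[OF pol_differentiable[OF pol_pd[OF assms]]])
    then show ?thesis by (simp add: Z_up_eq[of A a] sum_distrib_left mult_ac)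
  qed
  show ?thesis
    unfolding * by (subst sum.swap) (simp add: pd_commute_pol[OF assms, of "fst A" _ "fst B"] mult_ac)
qed

text \<open>Differentiating the weight turns $Z_A^{A'}$ into its weighted adjoint. This is the form in which
adjoints appear when a distribution is tested against a conjugated polynomial times the weight.\<close>

lemma Z_gauss:
  assumes "f differentiable (at x)"
  shows "Z_up A a (\<lambda>x. cnj (f x) * complex_of_real (gw x)) x = - cnj (Z_adj A a f x) * complex_of_real (gw x)"
proof -
  have "pd l j (\<lambda>x. cnj (f x) * complex_of_real (gw x)) x = - cnj (creation l j f x) * complex_of_real (gw x)" for l j
    by (simp add: pd_mult[OF differentiable_cnj[OF assms] gw_differentiable] pd_gw pd_cnj[OF assms] creation_def algebra_simps)
  then show ?thesis
    by (simp add: Z_up_eq Z_adj_def sum_distrib_left sum_distrib_right sum_negf mult_ac)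
qed

lemma Z_mult:
  assumes "f differentiable (at x)" "g differentiable (at x)"
  shows "Z_up A a (\<lambda>x. f x * g x) x = Z_up A a f x * g x + f x * Z_up A a g x"
  unfolding Z_up_eq
  by (simp add: pd_mult[OF assms] sum_distrib_left sum_distrib_right sum.distrib distrib_left mult_ac)

section \<open>Smooth cutoffs\<close>

text \<open>$s^{-m}e^{-1/s}$, extended by zero. The family over $m$ is closed under differentiation up to linear
combinations, which gives smoothness without computing higher derivatives.\<close>

definition flat_exp :: "nat \<Rightarrow> real \<Rightarrow> real" where
  "flat_exp m s = (if s \<le> 0 then 0 else exp (- 1 / s) / s ^ m)"

lemma flat_exp_0: "s \<le> 0 \<Longrightarrow> flat_exp m s = 0" by (simp add: flat_exp_def)

text \<open>At $0$ the difference quotient is the next member of the family, which tends to $0$ because exponentials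
dominate powers.\<close>

lemma flat_exp_has_derivative:
  "(flat_exp m has_real_derivative (flat_exp (m + 2) s - real m * flat_exp (m + 1) s)) (at s)"
proof -
  consider "s < 0" | "s = 0" | "s > 0" by linarith
  then show ?thesis
  proof cases
    case 1
    have "((\<lambda>s. 0) has_real_derivative 0) (at s)" by simp
    then have "(flat_exp m has_real_derivative 0) (at s)"
      by (rule has_field_derivative_transform_within_open[of _ _ _ "{..<0}"]) (use 1 in \<open>auto simp: flat_exp_0\<close>)
    then show ?thesis using 1 by (simp add: flat_exp_0)
  next
    case 3
    have "((\<lambda>s. exp (- 1 / s) / s ^ m) has_real_derivative (flat_exp (m + 2) s - real m * flat_exp (m + 1) s)) (at s)"
      using 3 by (auto intro!: derivative_eq_intros simp: flat_exp_def power2_eq_square field_simps)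
        (cases m; simp add: field_simps)
    then show ?thesis
      by (rule has_field_derivative_transform_within_open[of _ _ _ "{0<..}"]) (use 3 in \<open>auto simp: flat_exp_def\<close>)
  next
    case 2
    have "((\<lambda>y::real. y ^ Suc m / exp y) \<longlongrightarrow> 0) at_top"
      by (rule tendsto_power_div_exp_0)
    then have "((\<lambda>h::real. inverse h ^ Suc m / exp (inverse h)) \<longlongrightarrow> 0) (at_right 0)"
      by (rule filterlim_compose[OF _ filterlim_inverse_at_top_right])
    then have r: "((\<lambda>h. flat_exp m h / h) \<longlongrightarrow> 0) (at_right 0)"
      by (rule Lim_transform_eventually)
        (auto simp: eventually_at_filter flat_exp_def exp_minus field_simps power_inverse intro!: always_eventually)
    have l: "((\<lambda>h. flat_exp m h / h) \<longlongrightarrow> 0) (at_left 0)"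
      by (rule Lim_transform_eventually[of "\<lambda>_. 0"])
        (auto simp: eventually_at_filter flat_exp_def intro!: always_eventually)
    have "((\<lambda>h. flat_exp m h / h) \<longlongrightarrow> 0) (at 0)"
      using l r by (simp add: filterlim_split_at)
    then show ?thesis using 2 by (simp add: DERIV_def flat_exp_0)
  qed
qed

text \<open>With $y = 1/s$ this is $y^2 e^{-y} \le 2$. Only this member occurs in the gradient of the cutoff.\<close>

lemma flat_exp_2_bound: "0 \<le> flat_exp 2 s" "flat_exp 2 s \<le> 2"
proof -
  show "0 \<le> flat_exp 2 s" by (simp add: flat_exp_def)
  show "flat_exp 2 s \<le> 2"
  proof (cases "s > 0")
    case True
    have "1 + 1/s + (1/s)\<^sup>2 / 2 \<le> exp (1 / s)"
      using True by (intro exp_lower_Taylor_quadratic) auto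
    moreover have "0 \<le> 1 / s" using True by simp
    ultimately have "(1/s)\<^sup>2 / 2 \<le> exp (1 / s)" by linarith
    then show ?thesis using True by (simp add: flat_exp_def exp_minus field_simps)
  qed (simp add: flat_exp_def)
qed

definition tau :: "real \<Rightarrow> 'n::finite space \<Rightarrow> real" where
  "tau R x = 1 - (norm x)\<^sup>2 / R\<^sup>2"

lemma flat_exp_tau_has_derivative:
  "((\<lambda>x. complex_of_real (flat_exp m (tau R x))) has_derivative
    (\<lambda>h. complex_of_real ((flat_exp (m + 2) (tau R x) - real m * flat_exp (m + 1) (tau R x)) * (- (2 * (x \<bullet> h)) / R\<^sup>2)))) (at x)"
proof (rule has_derivative_of_real_chain[OF _ flat_exp_has_derivative])
  have "((\<lambda>x. 1 - (norm x)\<^sup>2 * (1 / R\<^sup>2)) has_derivative (\<lambda>h. 0 - 2 * (x \<bullet> h) * (1 / R\<^sup>2))) (at x)"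
    by (intro has_derivative_diff has_derivative_const has_derivative_mult_left norm_sq_has_derivative)
  then show "(tau R has_derivative (\<lambda>h. - (2 * (x \<bullet> h)) / R\<^sup>2)) (at x)"
    by (simp add: tau_def[abs_def])
qed

lemma flat_exp_tau_differentiable: "(\<lambda>x. complex_of_real (flat_exp m (tau R x))) differentiable (at x)"
  using flat_exp_tau_has_derivative unfolding differentiable_def by blast

lemma pd_flat_exp_tau: "pd l j (\<lambda>x. complex_of_real (flat_exp m (tau R x))) x =
    complex_of_real ((flat_exp (m + 2) (tau R x) - real m * flat_exp (m + 1) (tau R x)) * (- 2 / R\<^sup>2)) * complex_of_real (x $ l $ j)"
  by (simp add: pd_eqI[OF flat_exp_tau_has_derivative] inner_ax)

text \<open>A class of functions supported in the ball of radius $R$ that is stable under partial derivatives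
by construction, so that its members are test functions.\<close>

inductive cutfam :: "real \<Rightarrow> ('n::finite space \<Rightarrow> complex) \<Rightarrow> bool" for R where
  cutfam_base: "pol d p \<Longrightarrow> cutfam R (\<lambda>x. p x * complex_of_real (gw x) * complex_of_real (flat_exp m (tau R x)))"
| cutfam_add: "cutfam R f \<Longrightarrow> cutfam R g \<Longrightarrow> cutfam R (\<lambda>x. f x + g x)"

lemma cutfam_differentiable: "cutfam R f \<Longrightarrow> f differentiable (at x)"
  by (induction rule: cutfam.induct)
    (auto intro!: differentiable_mult gw_differentiable flat_exp_tau_differentiable intro: pol_differentiable)

lemma cutfam_pd: "cutfam R f \<Longrightarrow> cutfam R (pd l j f)"
proof (induction rule: cutfam.induct)
  case (cutfam_base d p m)
  have d: "p differentiable (at x)" for x using cutfam_base by (rule pol_differentiable)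
  let ?G = "\<lambda>x. complex_of_real (gw x)" and ?E = "\<lambda>m x. complex_of_real (flat_exp m (tau R x))"
  define q where "q c x = c * (complex_of_real (x $ l $ j) * p x)" for c x
  have q: "pol (Suc d) (q c)" for c
    unfolding q_def by (intro pol_scale pol_coord cutfam_base)
  have "pd l j (\<lambda>x. p x * ?G x * ?E m x) = (\<lambda>x. ((pd l j p x * ?G x * ?E m x + q (- 4) x * ?G x * ?E m x)
      + q (- 2 / complex_of_real (R\<^sup>2)) x * ?G x * ?E (m + 2) x)
      + q (complex_of_real (2 * real m / R\<^sup>2)) x * ?G x * ?E (m + 1) x)"
    by (rule ext) (simp add: pd_mult differentiable_mult d gw_differentiable flat_exp_tau_differentiable pd_gw pd_flat_exp_tau q_def
        algebra_simps)
  then show ?case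
    by (simp only:) (intro cutfam.cutfam_add cutfam.cutfam_base[OF q] cutfam.cutfam_base[OF pol_pd[OF cutfam_base]])
next
  case (cutfam_add f g)
  have "pd l j (\<lambda>x. f x + g x) = (\<lambda>x. pd l j f x + pd l j g x)"
    using cutfam_add by (auto intro: pd_add cutfam_differentiable)
  then show ?case using cutfam_add by (auto intro: cutfam.intros)
qed

lemma cutfam_supp: "cutfam R f \<Longrightarrow> R > 0 \<Longrightarrow> norm x \<ge> R \<Longrightarrow> f x = 0"
proof (induction rule: cutfam.induct)
  case (cutfam_base d p m)
  then have "R\<^sup>2 \<le> (norm x)\<^sup>2" by (intro power_mono) auto
  then have "tau R x \<le> 0" using cutfam_base by (simp add: tau_def)
  then show ?case by (simp add: flat_exp_0)
qed auto

lemma cutfam_test_fun: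
  assumes "cutfam R f" "R > 0" shows "test_fun f"
  unfolding test_fun_def
proof
  have "cutfam R (iter_pd ds f)" for ds
    by (induction ds) (auto intro: assms cutfam_pd)
  then show "\<forall>ds. iter_pd ds f differentiable_on UNIV"
    by (meson cutfam_differentiable differentiable_at_imp_differentiable_on)
  have "{x. f x \<noteq> 0} \<subseteq> cball 0 R"
    using cutfam_supp[OF assms] by (force simp: not_le)
  then have "bounded {x. f x \<noteq> 0}" using bounded_cball bounded_subset by blast
  then show "compact (closure {x. f x \<noteq> 0})" by (simp add: compact_closure)
qed

text \<open>The factor $e$ normalises the value at the origin to $1$. As $R \to \infty$ the function tends to $1$ pointwise, and its
gradient is of order $1/R$.\<close>

definition chi :: "real \<Rightarrow> 'n::finite space \<Rightarrow> complex" where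
  "chi R x = complex_of_real (exp 1) * complex_of_real (flat_exp 0 (tau R x))"

lemma chi_differentiable: "chi R differentiable (at x)"
  unfolding chi_def[abs_def] by (intro differentiable_mult flat_exp_tau_differentiable differentiable_const)

lemma chi_bound: "norm (chi R x) \<le> exp 1"
proof -
  have "flat_exp 0 s \<le> 1" for s by (simp add: flat_exp_def)
  moreover have "0 \<le> flat_exp 0 s" for s by (simp add: flat_exp_def)
  ultimately show ?thesis by (simp add: chi_def norm_mult)
qed

lemma chi_limit: "(\<lambda>n. chi (real (Suc n)) x) \<longlonglongrightarrow> 1"
proof -
  have "(\<lambda>n. (1 / real (Suc n))\<^sup>2) \<longlonglongrightarrow> 0\<^sup>2"
    by (intro tendsto_power LIMSEQ_Suc[OF lim_1_over_n])
  then have "(\<lambda>n. 1 - (norm x)\<^sup>2 * (1 / real (Suc n))\<^sup>2) \<longlonglongrightarrow> 1 - (norm x)\<^sup>2 * 0"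
    by (intro tendsto_intros) auto
  then have "(\<lambda>n. tau (real (Suc n)) x) \<longlonglongrightarrow> 1"
    by (simp add: tau_def power_divide)
  then have "(\<lambda>n. flat_exp 0 (tau (real (Suc n)) x)) \<longlonglongrightarrow> flat_exp 0 1"
    by (rule isCont_tendsto_compose[OF DERIV_isCont[OF flat_exp_has_derivative]])
  then have "(\<lambda>n. chi (real (Suc n)) x) \<longlonglongrightarrow> complex_of_real (exp 1) * complex_of_real (flat_exp 0 1)"
    unfolding chi_def by (intro tendsto_intros)
  also have "complex_of_real (exp 1) * complex_of_real (flat_exp 0 1) = 1"
    unfolding of_real_mult[symmetric] by (simp add: flat_exp_def exp_minus)
  finally show ?thesis .
qed

lemma pd_chi_bound:
  assumes "R \<ge> 1" shows "norm (pd l j (chi R) x) \<le> 4 * exp 1 / R"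
proof (cases "norm x \<le> R")
  case True
  have pd: "pd l j (chi R) x = complex_of_real (exp 1 * flat_exp 2 (tau R x) * (- 2 / R\<^sup>2) * x $ l $ j)"
    unfolding chi_def[abs_def] by (simp add: pd_scale[OF flat_exp_tau_differentiable] pd_flat_exp_tau numeral_2_eq_2)
  have c: "\<bar>x $ l $ j\<bar> \<le> R"
    using order_trans[OF order_trans[OF component_le_norm_cart Finite_Cartesian_Product.norm_nth_le] True] .
  have "norm (pd l j (chi R) x) = exp 1 * flat_exp 2 (tau R x) * (2 / R\<^sup>2) * \<bar>x $ l $ j\<bar>"
    unfolding pd norm_of_real using flat_exp_2_bound(1)[of "tau R x"] by (simp add: abs_mult)
  also have "\<dots> \<le> exp 1 * 2 * (2 / R\<^sup>2) * R"
    using flat_exp_2_bound[of "tau R x"] c assms by (intro mult_mono) auto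
  also have "\<dots> = 4 * exp 1 / R" using assms by (simp add: power2_eq_square field_simps)
  finally show ?thesis .
next
  case False
  then have "R\<^sup>2 \<le> (norm x)\<^sup>2" using assms by (intro power_mono) auto
  then have "tau R x \<le> 0" using assms by (simp add: tau_def)
  then show ?thesis
    using assms unfolding chi_def[abs_def]
    by (simp add: pd_scale[OF flat_exp_tau_differentiable] pd_flat_exp_tau flat_exp_0)
qed

lemma Z_coeff_bound: "norm (Z_coeff s a j) \<le> 1"
  by (simp add: Z_coeff_def)

lemma Z_chi_bound:
  assumes "R \<ge> 1" shows "norm (Z_up A a (chi R) x) \<le> 16 * exp 1 / R"
proof -
  have "norm (Z_up A a (chi R) x) \<le> (\<Sum>j\<in>(UNIV::4 set). 4 * exp 1 / R)"
    unfolding Z_up_eq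
  proof (rule sum_norm_le)
    fix j :: 4
    have "norm (Z_coeff (snd A) a j * pd (fst A) j (chi R) x) \<le> 1 * (4 * exp 1 / R)"
      unfolding norm_mult by (intro mult_mono Z_coeff_bound pd_chi_bound assms) auto
    then show "norm (Z_coeff (snd A) a j * pd (fst A) j (chi R) x) \<le> 4 * exp 1 / R" by simp
  qed
  then show ?thesis by simp
qed

text \<open>The test function that stands for the pairing with $p$ in the weighted space.\<close>

definition eta :: "('n::finite space \<Rightarrow> complex) \<Rightarrow> real \<Rightarrow> 'n space \<Rightarrow> complex" where
  "eta p R x = (cnj (p x) * complex_of_real (gw x)) * chi R x"

lemma eta_test_fun: assumes "pol d p" "R > 0" shows "test_fun (eta p R)"
proof (rule cutfam_test_fun[OF _ assms(2)])
  have "cutfam R (\<lambda>x. (complex_of_real (exp 1) * cnj (p x)) * complex_of_real (gw x) * complex_of_real (flat_exp 0 (tau R x)))"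
    by (rule cutfam_base[OF pol_scale[OF pol_cnj[OF assms(1)]]])
  then show "cutfam R (eta p R)" by (simp add: eta_def[abs_def] chi_def mult_ac)
qed

lemma Z_eta:
  assumes "pol d p"
  shows "Z_up A a (eta p R) x =
    (cnj (p x) * Z_up A a (chi R) x - cnj (Z_adj A a p x) * chi R x) * complex_of_real (gw x)"
proof -
  have d: "p differentiable (at x)" by (rule pol_differentiable[OF assms])
  show ?thesis
    unfolding eta_def[abs_def]
    by (subst Z_mult) (auto intro!: differentiable_mult gw_differentiable differentiable_cnj d chi_differentiable
        simp: Z_gauss[OF d] algebra_simps)
qed

section \<open>From test functions to polynomials\<close>

text \<open>Dominated convergence: the product of two square integrable functions and the weight is a majorant.\<close>

lemma integral_cutoff_limit:
  assumes f: "sql2 f" and h: "sql2 h" and g: "\<And>n. g n \<in> borel_measurable borel" "G \<in> borel_measurable borel"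
    and lim: "\<And>x. (\<lambda>n. g n x) \<longlonglongrightarrow> G x" and bound: "\<And>n x. norm (g n x) \<le> C * norm (h x)"
  shows "(\<lambda>n. LINT x|lborel. f x * (g n x * complex_of_real (gw x))) \<longlonglongrightarrow>
    (LINT x|lborel. f x * (G x * complex_of_real (gw x)))"
proof (rule integral_dominated_convergence)
  note [measurable] = sql2_meas[OF f] g
  show "(\<lambda>x. f x * (G x * complex_of_real (gw x))) \<in> borel_measurable lborel" by measurable
  show "(\<lambda>x. f x * (g n x * complex_of_real (gw x))) \<in> borel_measurable lborel" for n by measurable
  show "integrable lborel (\<lambda>x. C * (norm (f x) * norm (h x) * gw x))"
    by (intro integrable_mult_right sql2_integrable_mult f h)
  show "AE x in lborel. (\<lambda>n. f x * (g n x * complex_of_real (gw x))) \<longlonglongrightarrow> f x * (G x * complex_of_real (gw x))"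
    by (intro AE_I2 tendsto_intros lim)
  show "AE x in lborel. norm (f x * (g n x * complex_of_real (gw x))) \<le> C * (norm (f x) * norm (h x) * gw x)" for n
  proof (intro AE_I2)
    fix x
    have "norm (f x) * (norm (g n x) * gw x) \<le> norm (f x) * ((C * norm (h x)) * gw x)"
      by (intro mult_left_mono mult_right_mono bound) auto
    then show "norm (f x * (g n x * complex_of_real (gw x))) \<le> C * (norm (f x) * norm (h x) * gw x)"
      by (simp add: norm_mult mult_ac)
  qed
qed

lemma chi_measurable: "chi R \<in> borel_measurable borel"
  by (intro borel_measurable_continuous_onI differentiable_imp_continuous_on)
     (auto intro: chi_differentiable differentiable_at_imp_differentiable_on)

lemma Z_chi_measurable: "Z_up A a (chi R) \<in> borel_measurable borel"
proof -
  have "pd l j (chi R) \<in> borel_measurable borel" for l j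
  proof (rule borel_measurable_continuous_onI)
    have "pd l j (chi R) = (\<lambda>x. complex_of_real (exp 1) * (complex_of_real (flat_exp 2 (tau R x)) *
        (complex_of_real (- 2 / R\<^sup>2) * complex_of_real (x $ l $ j))))"
      unfolding chi_def[abs_def]
      by (rule ext) (simp add: pd_scale[OF flat_exp_tau_differentiable] pd_flat_exp_tau numeral_2_eq_2)
    then have "pd l j (chi R) differentiable (at x)" for x
      by (simp only:) (intro differentiable_mult differentiable_const coord_differentiable flat_exp_tau_differentiable)
    then show "continuous_on UNIV (pd l j (chi R))"
      by (meson differentiable_imp_continuous_on differentiable_at_imp_differentiable_on)
  qed
  then show ?thesis unfolding Z_up_eq by measurable
qed

lemma cutoff_limit_Z:
  assumes f: "sql2 f" and p: "pol d p"
  shows "(\<lambda>n. LINT x|lborel. f x * Z_up A a (eta p (real (Suc n))) x) \<longlonglongrightarrow> - sip f (Z_adj A a p)"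
proof -
  let ?R = "\<lambda>n. real (Suc n)"
  let ?g = "\<lambda>n x. cnj (p x) * Z_up A a (chi (?R n)) x - cnj (Z_adj A a p x) * chi (?R n) x"
  let ?h = "\<lambda>x. complex_of_real (norm (p x)) + complex_of_real (norm (Z_adj A a p x))"
  note [measurable] = pol_measurable[OF p] pol_measurable[OF pol_Z_adj[OF p]] Z_chi_measurable chi_measurable
  have abs: "sql2 (\<lambda>x. complex_of_real (norm (q x)))" if "pol e q" for e q
    by (rule sql2_bounded[OF pol_sql2[OF that], of _ 1]) (use pol_measurable[OF that] in auto)
  have "(\<lambda>n. LINT x|lborel. f x * (?g n x * complex_of_real (gw x))) \<longlonglongrightarrow>
    (LINT x|lborel. f x * ((cnj (p x) * 0 - cnj (Z_adj A a p x) * 1) * complex_of_real (gw x)))"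
  proof (rule integral_cutoff_limit[where h = ?h and C = "16 * exp 1", OF f])
    show "sql2 ?h" by (intro sql2_add abs[OF p] abs[OF pol_Z_adj[OF p]])
    fix x
    have "(\<lambda>n. Z_up A a (chi (?R n)) x) \<longlonglongrightarrow> 0"
    proof (rule Lim_null_comparison)
      show "eventually (\<lambda>n. norm (Z_up A a (chi (?R n)) x) \<le> (16 * exp 1) * (1 / ?R n)) sequentially"
        using Z_chi_bound[of "?R n" A a x for n] by (intro always_eventually) auto
      show "(\<lambda>n. (16 * exp 1) * (1 / ?R n)) \<longlonglongrightarrow> 0"
        by (intro tendsto_mult_right_zero LIMSEQ_Suc[OF lim_1_over_n])
    qed
    then show "(\<lambda>n. ?g n x) \<longlonglongrightarrow> cnj (p x) * 0 - cnj (Z_adj A a p x) * 1"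
      by (intro tendsto_intros chi_limit)
    fix n
    have "norm (Z_up A a (chi (?R n)) x) \<le> 16 * exp 1 / ?R n" by (rule Z_chi_bound) auto
    also have "\<dots> \<le> 16 * exp 1" by (simp add: field_simps)
    finally have z: "norm (Z_up A a (chi (?R n)) x) \<le> 16 * exp 1" .
    have c: "norm (chi (?R n) x) \<le> 16 * exp 1" using chi_bound[of "?R n" x] exp_gt_zero[of "1::real"] by linarith
    have "norm (?g n x) \<le> norm (p x) * norm (Z_up A a (chi (?R n)) x) + norm (Z_adj A a p x) * norm (chi (?R n) x)"
      using norm_triangle_ineq4 by (metis complex_mod_cnj norm_mult)
    also have "\<dots> \<le> norm (p x) * (16 * exp 1) + norm (Z_adj A a p x) * (16 * exp 1)"
      by (intro add_mono mult_left_mono z c) auto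
    also have "\<dots> = 16 * exp 1 * norm (?h x)"
      unfolding of_real_add[symmetric] norm_of_real by (simp add: algebra_simps)
    finally show "norm (?g n x) \<le> 16 * exp 1 * norm (?h x)" .
  qed measurable
  also have "(LINT x|lborel. f x * ((cnj (p x) * 0 - cnj (Z_adj A a p x) * 1) * complex_of_real (gw x)))
      = - sip f (Z_adj A a p)"
    unfolding sip_def by (simp add: mult.assoc)
  finally show ?thesis unfolding Z_eta[OF p] .
qed

lemma cutoff_limit:
  assumes f: "sql2 f" and p: "pol d p"
  shows "(\<lambda>n. LINT x|lborel. f x * eta p (real (Suc n)) x) \<longlonglongrightarrow> sip f p"
proof -
  let ?R = "\<lambda>n. real (Suc n)"
  note [measurable] = pol_measurable[OF p] chi_measurable
  have "(\<lambda>n. LINT x|lborel. f x * ((cnj (p x) * chi (?R n) x) * complex_of_real (gw x))) \<longlonglongrightarrow>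
    (LINT x|lborel. f x * ((cnj (p x) * 1) * complex_of_real (gw x)))"
  proof (rule integral_cutoff_limit[where h = p and C = "exp 1", OF f pol_sql2[OF p]])
    fix x
    show "(\<lambda>n. cnj (p x) * chi (?R n) x) \<longlonglongrightarrow> cnj (p x) * 1"
      by (intro tendsto_intros chi_limit)
    fix n
    show "norm (cnj (p x) * chi (?R n) x) \<le> exp 1 * norm (p x)"
      using mult_left_mono[OF chi_bound[of "?R n" x], of "norm (p x)"] by (simp add: norm_mult mult.commute)
  qed measurable
  then show ?thesis unfolding sip_def eta_def by (simp add: mult_ac)
qed

text \<open>The terms with the derivative of the cutoff disappear in the limit, so the test functions
\<open>eta p R\<close> turn a distributional equation into an equation for weighted inner products with adjoint
operators. The finite family $R$ covers $\mathscr D_0$ and $\mathscr D_1$ alike.\<close>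

lemma test_identity_extends:
  assumes f: "\<And>r. r \<in> R \<Longrightarrow> sql2 (f r)" and g: "sql2 g"
    and id: "\<And>\<eta>. test_fun \<eta> \<Longrightarrow> (\<Sum>r\<in>R. c r * (LINT x|lborel. f r x * Z_up (A r) (a r) \<eta> x)) = (LINT x|lborel. g x * \<eta> x)"
    and p: "pol d p"
  shows "(\<Sum>r\<in>R. c r * sip (f r) (Z_adj (A r) (a r) p)) = - sip g p"
proof -
  have "(\<lambda>n. \<Sum>r\<in>R. c r * (LINT x|lborel. f r x * Z_up (A r) (a r) (eta p (real (Suc n))) x))
      \<longlonglongrightarrow> (\<Sum>r\<in>R. c r * (- sip (f r) (Z_adj (A r) (a r) p)))"
    by (intro tendsto_sum tendsto_mult[OF tendsto_const] cutoff_limit_Z[OF f p])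
  also have "(\<lambda>n. \<Sum>r\<in>R. c r * (LINT x|lborel. f r x * Z_up (A r) (a r) (eta p (real (Suc n))) x))
      = (\<lambda>n. LINT x|lborel. g x * eta p (real (Suc n)) x)"
    by (intro ext id eta_test_fun[OF p]) auto
  finally have "(\<Sum>r\<in>R. c r * (- sip (f r) (Z_adj (A r) (a r) p))) = sip g p"
    using cutoff_limit[OF g p] LIMSEQ_unique by blast
  then show ?thesis by (simp add: sum_negf minus_equation_iff[of _ "sip g p"] eq_commute)
qed

section \<open>Test functions\<close>

lemma test_fun_differentiable: "test_fun \<eta> \<Longrightarrow> \<eta> differentiable (at x)"
  unfolding test_fun_def by (metis UNIV_I differentiable_on_def iter_pd.simps(1))

lemma test_fun_pd: "test_fun \<eta> \<Longrightarrow> pd l j \<eta> differentiable (at x)"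
  unfolding test_fun_def by (metis UNIV_I differentiable_on_def iter_pd.simps)

lemma test_fun_continuous:
  assumes "test_fun \<eta>" shows "continuous_on UNIV \<eta>" "continuous_on UNIV (pd l j \<eta>)"
  using assms test_fun_differentiable test_fun_pd
  by (meson differentiable_imp_continuous_on differentiable_at_imp_differentiable_on)+

lemma test_fun_supp:
  assumes "test_fun \<eta>" obtains R where "R > 0" "\<And>x. norm x > R \<Longrightarrow> \<eta> x = 0"
proof -
  have "bounded (closure {x. \<eta> x \<noteq> 0})"
    using assms compact_imp_bounded unfolding test_fun_def by blast
  then obtain R where "R > 0" "\<forall>x\<in>closure {x. \<eta> x \<noteq> 0}. norm x \<le> R" by (metis bounded_pos)
  then show ?thesis using that[of R] closure_subset[of "{x. \<eta> x \<noteq> 0}"] by (force simp: not_le[symmetric])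
qed

lemma pd_supp:
  assumes "\<And>x. norm x > R \<Longrightarrow> \<eta> x = 0" "norm (x::'n::finite space) > R"
  shows "pd l j \<eta> x = 0"
proof -
  have "open {x::'n space. norm x > R}"
    by (intro open_Collect_less continuous_intros)
  then have "(\<eta> has_derivative (\<lambda>h. 0)) (at x)"
    by (intro has_derivative_transform_within_open[OF has_derivative_const, of "{x. norm x > R}" x 0]) (use assms in auto)
  then show ?thesis by (simp add: pd_eqI)
qed

lemma continuous_supp_bound:
  fixes f :: "'a::euclidean_space \<Rightarrow> complex"
  assumes "continuous_on UNIV f" "\<And>x. norm x > R \<Longrightarrow> f x = 0"
  obtains M where "M > 0" "\<And>x. norm (f x) \<le> M"
proof -
  have "compact (f ` cball 0 R)"
    by (intro compact_continuous_image continuous_on_subset[OF assms(1)]) auto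
  then obtain M where M: "M > 0" "\<forall>y\<in>f ` cball 0 R. norm y \<le> M"
    by (metis compact_imp_bounded bounded_pos)
  have "norm (f x) \<le> M" for x
    using M assms(2)[of x] by (cases "norm x \<le> R") auto
  then show ?thesis using that M by blast
qed

lemma pol_parts:
  assumes p: "pol d p" and t: "test_fun \<eta>"
  shows "(LINT x|lborel. p x * pd l j \<eta> x) = - (LINT x|lborel. pd l j p x * \<eta> x)"
proof -
  obtain R where R: "R > 0" "\<And>x. norm x > R \<Longrightarrow> \<eta> x = 0" by (metis test_fun_supp[OF t])
  have supp: "pd l j \<eta> x = 0" if "norm x > R" for x using pd_supp[OF R(2) that] .
  have eq: "pd l j (\<lambda>x. p x * \<eta> x) = (\<lambda>x. p x * pd l j \<eta> x + pd l j p x * \<eta> x)"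
    by (rule ext) (intro pd_mult pol_differentiable[OF p] test_fun_differentiable[OF t])
  have cont: "continuous_on UNIV (\<lambda>x. p x * pd l j \<eta> x)" "continuous_on UNIV (\<lambda>x. pd l j p x * \<eta> x)"
    by (intro continuous_intros pol_continuous[OF p] pol_continuous[OF pol_pd[OF p]] test_fun_continuous[OF t])+
  have z: "p x * pd l j \<eta> x + pd l j p x * \<eta> x = 0" if "norm x > R" for x
    using supp[OF that] R(2)[OF that] by simp
  obtain M where "M > 0" "\<And>x. norm (p x * pd l j \<eta> x + pd l j p x * \<eta> x) \<le> M"
    by (rule continuous_supp_bound[OF continuous_on_add[OF cont] z]) blast+
  then have "\<And>x. norm (pd l j (\<lambda>x. p x * \<eta> x) x) \<le> M" unfolding eq by blast
  then have "(LINT x|lborel. pd l j (\<lambda>x. p x * \<eta> x) x) = 0"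
    by (rule integral_pd_eq_0[rotated 2])
      (auto intro!: differentiable_mult pol_differentiable[OF p] test_fun_differentiable[OF t] R)
  then have "(LINT x|lborel. p x * pd l j \<eta> x) + (LINT x|lborel. pd l j p x * \<eta> x) = 0"
    unfolding eq by (subst (asm) Bochner_Integration.integral_add) (auto intro!: continuous_supp_integrable[where R = R] cont supp R)
  then show ?thesis by (simp add: eq_neg_iff_add_eq_0)
qed

text \<open>The weight is bounded below on the support, so dividing by it stays in the space. Hence pairing with a test
function is continuous in the weighted norm.\<close>

lemma test_pairing_as_sip:
  assumes "continuous_on UNIV \<eta>" "\<And>x. norm (x::'a::euclidean_space) > R \<Longrightarrow> \<eta> x = 0"
  obtains h where "sql2 h" "\<And>f. (LINT x|lborel. f x * \<eta> x) = sip f h"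
proof
  let ?h = "\<lambda>x. cnj (\<eta> x) * complex_of_real (inverse (gw x))"
  have m [measurable]: "\<eta> \<in> borel_measurable borel"
    by (intro borel_measurable_continuous_onI assms)
  have "continuous_on UNIV ?h"
    unfolding gw_def by (intro continuous_intros assms) auto
  then obtain M where "M > 0" "\<And>x. norm (?h x) \<le> M"
  proof (rule continuous_supp_bound)
    show "?h x = 0" if "norm x > R" for x using assms(2)[OF that] by simp
  qed blast+
  then show "sql2 ?h"
    by (intro sql2_exptype exptypeI[of _ M 0]) auto
  show "(LINT x|lborel. f x * \<eta> x) = sip f ?h" for f
    unfolding sip_def by (intro Bochner_Integration.integral_cong refl) (simp flip: of_real_mult)
qed

lemma test_pairing_Z:
  assumes "test_fun \<eta>"
  obtains h where "sql2 h" "\<And>f. (LINT x|lborel. f x * Z_up A a \<eta> x) = sip f h"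
proof -
  obtain R where R: "R > 0" "\<And>x. norm x > R \<Longrightarrow> \<eta> x = 0" by (metis test_fun_supp[OF assms])
  have "continuous_on UNIV (Z_up A a \<eta>)"
    unfolding Z_up_eq by (intro continuous_intros test_fun_continuous assms)
  moreover have "Z_up A a \<eta> x = 0" if "norm x > R" for x
    using pd_supp[OF R(2) that] by (simp add: Z_up_eq)
  ultimately show ?thesis using test_pairing_as_sip that by blast
qed

lemma test_pairing:
  assumes "test_fun \<eta>"
  obtains h where "sql2 h" "\<And>f. (LINT x|lborel. f x * \<eta> x) = sip f h"
proof -
  obtain R where "R > 0" "\<And>x. norm x > R \<Longrightarrow> \<eta> x = 0" by (metis test_fun_supp[OF assms])
  then show ?thesis using test_pairing_as_sip[OF test_fun_continuous(1)[OF assms]] that by blast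
qed

lemma pol_test_Z:
  assumes p: "pol d p" and t: "test_fun \<eta>"
  shows "(LINT x|lborel. p x * Z_up A a \<eta> x) = - (LINT x|lborel. Z_up A a p x * \<eta> x)"
proof -
  obtain R where R: "R > 0" "\<And>x. norm x > R \<Longrightarrow> \<eta> x = 0" by (metis test_fun_supp[OF t])
  have i1: "integrable lborel (\<lambda>x. p x * pd (fst A) j \<eta> x)" for j
    by (intro continuous_supp_integrable[where R = R] continuous_intros pol_continuous[OF p] test_fun_continuous[OF t]) (simp add: pd_supp[OF R(2)])
  have i2: "integrable lborel (\<lambda>x. pd (fst A) j p x * \<eta> x)" for j
    by (intro continuous_supp_integrable[where R = R] continuous_intros pol_continuous[OF pol_pd[OF p]] test_fun_continuous[OF t]) (simp add: R)
  have "(LINT x|lborel. p x * Z_up A a \<eta> x)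
      = (LINT x|lborel. (\<Sum>j\<in>UNIV. Z_coeff (snd A) a j * (p x * pd (fst A) j \<eta> x)))"
    by (simp add: Z_up_eq sum_distrib_left mult_ac)
  also have "\<dots> = (\<Sum>j\<in>UNIV. Z_coeff (snd A) a j * (LINT x|lborel. p x * pd (fst A) j \<eta> x))"
    using i1 by (subst Bochner_Integration.integral_sum) auto
  also have "\<dots> = - (\<Sum>j\<in>UNIV. Z_coeff (snd A) a j * (LINT x|lborel. pd (fst A) j p x * \<eta> x))"
    by (simp add: pol_parts[OF p t] sum_negf)
  also have "(\<Sum>j\<in>UNIV. Z_coeff (snd A) a j * (LINT x|lborel. pd (fst A) j p x * \<eta> x))
      = (LINT x|lborel. (\<Sum>j\<in>UNIV. Z_coeff (snd A) a j * (pd (fst A) j p x * \<eta> x)))"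
    using i2 by (subst Bochner_Integration.integral_sum) auto
  also have "\<dots> = (LINT x|lborel. Z_up A a p x * \<eta> x)"
    by (simp add: Z_up_eq sum_distrib_left sum_distrib_right mult_ac)
  finally show ?thesis .
qed

text \<open>A special case of the passage from test functions to polynomials, applied to a polynomial.\<close>

lemma sip_Z_adj:
  assumes p: "pol d p" and q: "pol e q"
  shows "sip (Z_up A a p) q = sip p (Z_adj A a q)"
proof -
  have "(\<Sum>r\<in>{()}. (- 1) * sip p (Z_adj A a q)) = - sip (Z_up A a p) q"
    by (rule test_identity_extends[OF _ pol_sql2[OF pol_Z[OF p]] _ q, of "{()}" "\<lambda>_. p" "\<lambda>_. - 1" "\<lambda>_. A" "\<lambda>_. a"])
      (use pol_sql2[OF p] pol_test_Z[OF p] in auto)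
  then show ?thesis by simp
qed

section \<open>Density of the polynomials\<close>

text \<open>The closure of the polynomials in the weighted space.\<close>

definition approximable :: "('n::finite space \<Rightarrow> complex) \<Rightarrow> bool" where
  "approximable f \<longleftrightarrow> sql2 f \<and> (\<forall>e>0. \<exists>d p. pol d p \<and> nsq (\<lambda>x. f x - p x) < e)"

lemma approximable_sql2: "approximable f \<Longrightarrow> sql2 f" by (simp add: approximable_def)

lemma nsq_triangle:
  assumes "sql2 f" "sql2 g" "sql2 h"
  shows "nsq (\<lambda>x. f x - h x) \<le> 2 * nsq (\<lambda>x. f x - g x) + 2 * nsq (\<lambda>x. g x - h x)"
  using nsq_add_le[OF sql2_diff[OF assms(1,2)] sql2_diff[OF assms(2,3)]] by simp

lemma approximable_pol: "pol d p \<Longrightarrow> approximable p"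
  unfolding approximable_def by (auto intro!: pol_sql2 exI[of _ d] exI[of _ p] simp: nsq_def)

lemma approximable_closed:
  assumes f: "sql2 f" and *: "\<And>e. e > 0 \<Longrightarrow> \<exists>g. approximable g \<and> nsq (\<lambda>x. f x - g x) < e"
  shows "approximable f"
  unfolding approximable_def
proof (intro conjI allI impI f)
  fix e :: real assume e: "e > 0"
  obtain g where g: "approximable g" "nsq (\<lambda>x. f x - g x) < e / 4" using *[of "e / 4"] e by auto
  obtain d p where p: "pol d p" "nsq (\<lambda>x. g x - p x) < e / 4"
    using g(1) e unfolding approximable_def by (meson divide_pos_pos zero_less_numeral)
  have "nsq (\<lambda>x. f x - p x) < e"
    using nsq_triangle[OF f approximable_sql2[OF g(1)] pol_sql2[OF p(1)]] g p by linarith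
  then show "\<exists>d p. pol d p \<and> nsq (\<lambda>x. f x - p x) < e" using p by blast
qed

lemma approximable_limit:
  assumes "\<And>n. approximable (F n)" "sql2 f" "(\<lambda>n. nsq (\<lambda>x. F n x - f x)) \<longlonglongrightarrow> 0"
  shows "approximable f"
proof (rule approximable_closed[OF assms(2)])
  fix e :: real assume "e > 0"
  then obtain n where "nsq (\<lambda>x. F n x - f x) < e"
    using LIMSEQ_D[OF assms(3), of e] by (auto simp: abs_less_iff)
  then show "\<exists>g. approximable g \<and> nsq (\<lambda>x. f x - g x) < e"
    using assms(1) by (subst (asm) nsq_uminus_commute) blast
qed

lemma approximable_add: assumes "approximable f" "approximable g" shows "approximable (\<lambda>x. f x + g x)"
  unfolding approximable_def
proof (intro conjI allI impI sql2_add approximable_sql2 assms)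
  fix e :: real assume e: "e > 0"
  obtain d p where p: "pol d p" "nsq (\<lambda>x. f x - p x) < e / 4"
    using assms(1) e unfolding approximable_def by (meson divide_pos_pos zero_less_numeral)
  obtain d' q where q: "pol d' q" "nsq (\<lambda>x. g x - q x) < e / 4"
    using assms(2) e unfolding approximable_def by (meson divide_pos_pos zero_less_numeral)
  have "nsq (\<lambda>x. (f x - p x) + (g x - q x)) < e"
    using nsq_add_le[OF sql2_diff[OF approximable_sql2[OF assms(1)] pol_sql2[OF p(1)]]
        sql2_diff[OF approximable_sql2[OF assms(2)] pol_sql2[OF q(1)]]] p q by linarith
  then have "nsq (\<lambda>x. (f x + g x) - (p x + q x)) < e" by (simp add: algebra_simps)
  moreover have "pol (max d d') (\<lambda>x. p x + q x)"
    using p q by (intro pol_add) (auto elim: pol_mono)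
  ultimately show "\<exists>d r. pol d r \<and> nsq (\<lambda>x. (f x + g x) - r x) < e"
    by (intro exI[of _ "max d d'"] exI[of _ "\<lambda>x. p x + q x"]) auto
qed

lemma approximable_scale: assumes "approximable f" shows "approximable (\<lambda>x. c * f x)"
  unfolding approximable_def
proof (intro conjI allI impI sql2_scale approximable_sql2 assms)
  fix e :: real assume e: "e > 0"
  have c: "(norm c)\<^sup>2 + 1 > 0" by (simp add: add_nonneg_pos)
  then obtain d p where p: "pol d p" "nsq (\<lambda>x. f x - p x) < e / ((norm c)\<^sup>2 + 1)"
    using assms e unfolding approximable_def by (meson divide_pos_pos)
  have "nsq (\<lambda>x. c * f x - c * p x) = (norm c)\<^sup>2 * nsq (\<lambda>x. f x - p x)"
    using nsq_scale[of c "\<lambda>x. f x - p x"] by (simp add: right_diff_distrib)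
  also have "\<dots> \<le> ((norm c)\<^sup>2 + 1) * nsq (\<lambda>x. f x - p x)" by (intro mult_right_mono) auto
  also have "\<dots> < e" using p(2) c by (simp add: pos_less_divide_eq mult.commute)
  finally show "\<exists>d r. pol d r \<and> nsq (\<lambda>x. c * f x - r x) < e" using pol_scale[OF p(1)] by blast
qed

lemma approximable_sum: "(\<And>i. i \<in> I \<Longrightarrow> approximable (f i)) \<Longrightarrow> approximable (\<lambda>x. \<Sum>i\<in>I. f i x)"
  by (induction I rule: infinite_finite_induct) (auto intro: approximable_add approximable_pol pol_zero)

text \<open>The bounded functions whose multiplication operators preserve the closure of the polynomials. They
form an algebra that is closed under bounded pointwise limits, so the sets whose indicators belong to it form a $\sigma$-algebra.\<close>

definition multiplier :: "('n::finite space \<Rightarrow> complex) \<Rightarrow> bool" where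
  "multiplier F \<longleftrightarrow> F \<in> borel_measurable borel \<and> (\<exists>C. \<forall>x. norm (F x) \<le> C) \<and> (\<forall>g. approximable g \<longrightarrow> approximable (\<lambda>x. F x * g x))"

lemma multiplier_const: "multiplier (\<lambda>x. c)"
  by (auto simp: multiplier_def intro: approximable_scale)

lemma multiplier_add: assumes "multiplier F" "multiplier G" shows "multiplier (\<lambda>x. F x + G x)"
proof -
  obtain C D where "\<forall>x. norm (F x) \<le> C" "\<forall>x. norm (G x) \<le> D" using assms by (auto simp: multiplier_def)
  then have "\<forall>x. norm (F x + G x) \<le> C + D" by (meson norm_triangle_mono)
  then show ?thesis using assms by (auto simp: multiplier_def distrib_right intro: approximable_add)
qed

lemma multiplier_mult: assumes "multiplier F" "multiplier G" shows "multiplier (\<lambda>x. F x * G x)"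
proof -
  obtain C D where *: "\<forall>x. norm (F x) \<le> C" "\<forall>x. norm (G x) \<le> D" using assms by (auto simp: multiplier_def)
  have "norm (F x * G x) \<le> C * D" for x
    unfolding norm_mult using * order_trans[OF norm_ge_zero] by (intro mult_mono) blast+
  then show ?thesis using assms by (auto simp: multiplier_def mult.assoc)
qed

lemma multiplier_limit:
  fixes F :: "nat \<Rightarrow> 'n::finite space \<Rightarrow> complex"
  assumes "\<And>n. multiplier (F n)" "\<And>x. (\<lambda>n. F n x) \<longlonglongrightarrow> G x" "\<And>n x. norm (F n x) \<le> C"
  shows "multiplier G"
  unfolding multiplier_def
proof (intro conjI allI impI)
  have Fm [measurable]: "F n \<in> borel_measurable borel" for n using assms(1) by (simp add: multiplier_def)
  show Gm [measurable]: "G \<in> borel_measurable borel"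
    by (rule borel_measurable_LIMSEQ_metric[OF Fm assms(2)])
  have GC: "norm (G x) \<le> C" for x
    by (rule Lim_bounded[OF tendsto_norm[OF assms(2)]]) (use assms(3) in auto)
  then show "\<exists>C. \<forall>x. norm (G x) \<le> C" by blast
  fix g :: "'n space \<Rightarrow> complex" assume g: "approximable g"
  note [measurable] = sql2_meas[OF approximable_sql2[OF g]]
  have bd: "norm (H * g x) \<le> C * norm (g x)" if "norm H \<le> C" for H x
    unfolding norm_mult by (intro mult_right_mono that) auto
  show "approximable (\<lambda>x. G x * g x)"
  proof (rule approximable_limit[of "\<lambda>n x. F n x * g x"])
    show "approximable (\<lambda>x. F n x * g x)" for n using assms(1) g by (simp add: multiplier_def)
    show "sql2 (\<lambda>x. G x * g x)"
      by (rule sql2_bounded[OF approximable_sql2[OF g], of _ C]) (auto intro: bd GC)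
    show "(\<lambda>n. nsq (\<lambda>x. F n x * g x - G x * g x)) \<longlonglongrightarrow> 0"
      by (rule nsq_tendsto_dominated[OF _ _ approximable_sql2[OF g], of _ _ C])
        (auto intro!: tendsto_mult assms(2) bd assms(3))
  qed
qed

lemma multiplier_by_pol:
  fixes F :: "'n::finite space \<Rightarrow> complex"
  assumes m: "F \<in> borel_measurable borel" and b: "\<And>x. norm (F x) \<le> C"
    and p: "\<And>d p. pol d p \<Longrightarrow> approximable (\<lambda>x. F x * p x)"
  shows "multiplier F"
  unfolding multiplier_def
proof (intro conjI allI impI)
  fix g :: "'n space \<Rightarrow> complex" assume g: "approximable g"
  note [measurable] = m sql2_meas[OF approximable_sql2[OF g]]
  have bd: "norm (F x * y) \<le> C * norm y" for x y
    unfolding norm_mult by (intro mult_right_mono b) auto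
  have s: "sql2 (\<lambda>x. F x * h x)" if "sql2 h" for h
    using sql2_meas[OF that] by (intro sql2_bounded[OF that, of _ C] bd) measurable
  show "approximable (\<lambda>x. F x * g x)"
  proof (rule approximable_closed[OF s[OF approximable_sql2[OF g]]])
    fix e :: real assume e: "e > 0"
    have c: "C\<^sup>2 + 1 > 0" by (simp add: add_nonneg_pos)
    then obtain d q where q: "pol d q" "nsq (\<lambda>x. g x - q x) < e / (C\<^sup>2 + 1)"
      using g e unfolding approximable_def by (meson divide_pos_pos)
    note sd = sql2_diff[OF approximable_sql2[OF g] pol_sql2[OF q(1)]]
    have "nsq (\<lambda>x. F x * (g x - q x)) \<le> C\<^sup>2 * nsq (\<lambda>x. g x - q x)"
      by (intro nsq_mono sd s bd)
    also have "\<dots> \<le> (C\<^sup>2 + 1) * nsq (\<lambda>x. g x - q x)" by (intro mult_right_mono) auto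
    also have "\<dots> < e" using q(2) c by (simp add: pos_less_divide_eq mult.commute)
    finally show "\<exists>h. approximable h \<and> nsq (\<lambda>x. F x * g x - h x) < e"
      using p[OF q(1)] by (intro exI[of _ "\<lambda>x. F x * q x"]) (simp add: right_diff_distrib)
  qed
qed (use m b in auto)

definition shifted_sin :: "real \<Rightarrow> 'n::finite \<Rightarrow> 4 \<Rightarrow> real \<Rightarrow> 'n space \<Rightarrow> real" where
  "shifted_sin t l j a x = sin (t * (x $ l $ j - a))"

text \<open>The partial sums of the sine series times a polynomial are polynomials, and they are dominated by
$e^{|t(x_j - a)|}$, which is square integrable for the weight.\<close>

lemma multiplier_shifted_sin: "multiplier (\<lambda>x. complex_of_real (shifted_sin t l j a x))"
proof (rule multiplier_by_pol[of _ 1])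
  have [measurable]: "(\<lambda>x::'a space. x $ l $ j) \<in> borel_measurable borel"
    by (intro borel_measurable_continuous_onI continuous_intros)
  show [measurable]: "(\<lambda>x. complex_of_real (shifted_sin t l j a x)) \<in> borel_measurable borel"
    unfolding shifted_sin_def by measurable
  show "norm (complex_of_real (shifted_sin t l j a x)) \<le> 1" for x by (simp add: shifted_sin_def)
  fix d p assume p: "pol d (p :: 'a space \<Rightarrow> complex)"
  note [measurable] = pol_measurable[OF p]
  let ?y = "\<lambda>x::'a space. t * (x $ l $ j - a)"
  let ?S = "\<lambda>N y. (\<Sum>n<N. sin_coeff n * y ^ n)"
  let ?h = "\<lambda>x. complex_of_real (exp \<bar>?y x\<bar>) * p x"
  have y: "pol (d + 2) (\<lambda>x. complex_of_real (?y x) * q x)" if "pol (d+1) q" for q d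
  proof -
    have "pol (Suc (Suc d)) (\<lambda>x. complex_of_real t * (complex_of_real (x $ l $ j) * q x) + (- complex_of_real (t * a)) * q x)"
      using that by (intro pol_add pol_scale pol_coord pol_Suc[of "Suc d"]) auto
    then show ?thesis by (simp add: algebra_simps)
  qed
  have pw: "pol (d + 1 + n) (\<lambda>x. complex_of_real (?y x ^ n) * p x)" for n
  proof (induction n)
    case 0 then show ?case using pol_Suc[OF p] by simp
  next
    case (Suc n)
    have "pol (d + n + 1) (\<lambda>x. complex_of_real (?y x ^ n) * p x)" using Suc by simp
    from y[OF this] show ?case by (simp add: mult_ac)
  qed
  have S: "pol (d + 1 + N) (\<lambda>x. complex_of_real (?S N (?y x)) * p x)" for N
  proof -
    have "pol (d + 1 + N) (\<lambda>x. \<Sum>n<N. complex_of_real (sin_coeff n) * (complex_of_real (?y x ^ n) * p x))"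
      by (intro pol_sum pol_scale pol_mono[OF pw]) auto
    then show ?thesis by (simp add: sum_distrib_right mult.assoc)
  qed
  have bd: "\<bar>?S N y\<bar> \<le> exp \<bar>y\<bar>" for N y
  proof -
    have "\<bar>?S N y\<bar> \<le> (\<Sum>n<N. \<bar>y\<bar> ^ n / fact n)"
      by (rule order_trans[OF sum_abs sum_mono]) (auto simp: sin_coeff_def abs_mult power_abs divide_simps)
    also have "\<dots> \<le> (\<Sum>n. \<bar>y\<bar> ^ n / fact n)"
      using summable_exp[of "\<bar>y\<bar>"] by (intro sum_le_suminf) (auto simp: field_simps)
    also have "\<dots> = exp \<bar>y\<bar>" by (simp add: exp_def divide_inverse mult.commute)
    finally show ?thesis .
  qed
  have "exptype (\<lambda>x. complex_of_real (exp \<bar>?y x\<bar>))"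
  proof (rule exptypeI)
    fix x :: "'a space"
    have "\<bar>x $ l $ j\<bar> \<le> norm x"
      by (rule order_trans[OF component_le_norm_cart Finite_Cartesian_Product.norm_nth_le])
    then have "\<bar>x $ l $ j - a\<bar> \<le> norm x + \<bar>a\<bar>" by linarith
    then have "\<bar>?y x\<bar> \<le> \<bar>t\<bar> * (norm x + \<bar>a\<bar>)" unfolding abs_mult by (intro mult_left_mono) auto
    then have "exp \<bar>?y x\<bar> \<le> exp (\<bar>t\<bar> * \<bar>a\<bar> + \<bar>t\<bar> * norm x)" by (simp add: algebra_simps)
    then show "norm (complex_of_real (exp \<bar>?y x\<bar>)) \<le> exp (\<bar>t\<bar> * \<bar>a\<bar>) * exp (\<bar>t\<bar> * norm x)"
      by (simp add: exp_add)
  qed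
  then have h: "sql2 ?h" by (intro sql2_exptype exptype_mult pol_exptype[OF p]) measurable
  have lim: "(\<lambda>N. ?S N y) \<longlonglongrightarrow> sin y" for y :: real
    using sin_converges[of y] by (simp add: sums_def)
  have s1: "\<bar>shifted_sin t l j a x\<bar> \<le> exp \<bar>?y x\<bar>" for x
    unfolding shifted_sin_def by (rule Lim_bounded[OF tendsto_rabs[OF lim]]) (use bd in auto)
  have bd': "norm (complex_of_real r * z) \<le> 1 * norm (complex_of_real (exp \<bar>y\<bar>) * z)"
    if "\<bar>r\<bar> \<le> exp \<bar>y\<bar>" for r y z
    using that by (simp add: norm_mult mult_right_mono)
  show "approximable (\<lambda>x. complex_of_real (shifted_sin t l j a x) * p x)"
  proof (rule approximable_limit[of "\<lambda>N x. complex_of_real (?S N (?y x)) * p x"])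
    show "approximable (\<lambda>x. complex_of_real (?S N (?y x)) * p x)" for N by (rule approximable_pol[OF S])
    show "sql2 (\<lambda>x. complex_of_real (shifted_sin t l j a x) * p x)"
      by (rule sql2_bounded[OF h _ bd'[OF s1]]) measurable
    show "(\<lambda>N. nsq (\<lambda>x. complex_of_real (?S N (?y x)) * p x - complex_of_real (shifted_sin t l j a x) * p x)) \<longlonglongrightarrow> 0"
      unfolding shifted_sin_def
    proof (rule nsq_tendsto_dominated[OF _ _ h _ bd'[OF bd]])
      show "(\<lambda>x. complex_of_real (?S N (?y x)) * p x) \<in> borel_measurable borel" for N
        by (rule pol_measurable[OF S])
      show "(\<lambda>N. complex_of_real (?S N (?y x)) * p x) \<longlonglongrightarrow> complex_of_real (sin (?y x)) * p x" for x
        by (intro tendsto_mult tendsto_of_real lim tendsto_const)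
    qed measurable
  qed
qed

lemma multiplier_poly_fun:
  assumes "real_polynomial_function r" "multiplier (\<lambda>x. complex_of_real (s x))"
  shows "multiplier (\<lambda>x. complex_of_real (r (s x)))"
  using assms(1)
proof (induction rule: real_polynomial_function.induct)
  case (linear f)
  then have "f y = y * f 1" for y
    using bounded_linear.linear[OF linear] linear_cmul[of f y 1] by simp
  then have "(\<lambda>x. complex_of_real (f (s x))) = (\<lambda>x. complex_of_real (s x) * complex_of_real (f 1))"
    by (metis of_real_mult)
  then show ?case using multiplier_mult[OF assms(2) multiplier_const] by simp
qed (auto intro: multiplier_const multiplier_add multiplier_mult)

lemma sin_ge_half:
  fixes z :: real
  assumes "0 \<le> z" "z \<le> 1"
  shows "z / 2 \<le> sin z"
proof -
  have "\<bar>sin z - z\<bar> \<le> \<bar>z\<bar> ^ 3 / 6"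
    using Maclaurin_sin_bound[of z 3] by (simp add: lessThan_nat_numeral sin_coeff_def fact_numeral)
  moreover have "z ^ 3 \<le> z ^ 1" using assms by (intro power_decreasing) auto
  moreover have "\<bar>z\<bar> = z" using assms by simp
  ultimately show ?thesis using assms abs_ge_minus_self[of "sin z - z"] by simp
qed

text \<open>With $s_m = \sin((x_j - a)/m)$ the product $m^2 s_m$ tends to $+\infty$ if $x_j > a$, and it is eventually
nonpositive otherwise. Truncation to $[0,1]$ therefore yields the indicator in the limit, and by the Weierstrass theorem the
truncation may be replaced by a polynomial in $s_m$ with error $1/m$.\<close>

lemma multiplier_halfspace:
  "multiplier (\<lambda>x::'n::finite space. complex_of_real (indicator {x. a < x $ l $ j} x))"
proof -
  let ?psi = "\<lambda>m y. min 1 (max 0 ((real (Suc m))\<^sup>2 * y))"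
  have "\<exists>r. real_polynomial_function r \<and> (\<forall>y\<in>{-1..1}. \<bar>?psi m y - r y\<bar> < 1 / real (Suc m))" for m
  proof -
    have "continuous_on {-1..1::real} (?psi m)" by (intro continuous_intros)
    then obtain g where "polynomial_function g" "\<forall>x\<in>{-1..1}. norm (?psi m x - g x) < 1 / real (Suc m)"
      using Stone_Weierstrass_polynomial_function[of "{-1..1::real}" "?psi m" "1 / real (Suc m)"] by auto
    then show ?thesis by (auto simp: real_polynomial_function_eq)
  qed
  then obtain r where r: "\<And>m. real_polynomial_function (r m)"
    "\<And>m y. y \<in> {-1..1} \<Longrightarrow> \<bar>?psi m y - r m y\<bar> < 1 / real (Suc m)" by metis
  let ?s = "\<lambda>m. shifted_sin (1 / real (Suc m)) l j a :: 'n space \<Rightarrow> real"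
  have s1: "?s m x \<in> {-1..1}" for m x by (simp add: shifted_sin_def)
  show ?thesis
  proof (rule multiplier_limit[of "\<lambda>m x. complex_of_real (r m (?s m x))" _ 2])
    show "multiplier (\<lambda>x. complex_of_real (r m (?s m x)))" for m
      by (rule multiplier_poly_fun[OF r(1) multiplier_shifted_sin])
    fix x
    show "norm (complex_of_real (r m (?s m x))) \<le> 2" for m
    proof -
      have "1 / real (Suc m) \<le> 1" by simp
      moreover have "\<bar>?psi m (?s m x)\<bar> \<le> 1" by simp
      ultimately show ?thesis using r(2)[OF s1[of m x], of m] unfolding norm_of_real by linarith
    qed
    have "(\<lambda>m. ?psi m (?s m x)) \<longlonglongrightarrow> indicator {x. a < x $ l $ j} x"
    proof (cases "a < x $ l $ j")
      case True
      define y where "y = x $ l $ j - a"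
      have y: "y > 0" using True by (simp add: y_def)
      have "filterlim (\<lambda>m. real (Suc m)) at_top sequentially"
        by (rule filterlim_compose[OF filterlim_real_sequentially filterlim_Suc])
      have "eventually (\<lambda>m. real m \<ge> max y (2 / y)) sequentially"
        using filterlim_real_sequentially unfolding filterlim_at_top by blast
      then have "eventually (\<lambda>m. ?psi m (?s m x) = 1) sequentially"
      proof eventually_elim
        case (elim m)
        let ?m = "real (Suc m)"
        have z: "0 < y / ?m" "y / ?m \<le> 1" using y elim by (auto simp: field_simps)
        have "y / ?m / 2 \<le> sin (y / ?m)" using z by (intro sin_ge_half) auto
        then have "?m\<^sup>2 * (y / ?m / 2) \<le> ?m\<^sup>2 * sin (y / ?m)" by (intro mult_left_mono) auto
        moreover have "?m\<^sup>2 * (y / ?m / 2) = ?m * y / 2" by (simp add: power2_eq_square field_simps del: of_nat_Suc)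
        moreover have "1 \<le> ?m * y / 2" using elim y by (simp add: field_simps)
        ultimately have "1 \<le> ?m\<^sup>2 * sin (y / ?m)" by linarith
        then have "1 \<le> ?m\<^sup>2 * ?s m x" by (simp add: shifted_sin_def y_def)
        then show ?case by simp
      qed
      then show ?thesis using True by (simp add: tendsto_eventually)
    next
      case False
      define y where "y = a - x $ l $ j"
      have y: "y \<ge> 0" using False by (simp add: y_def)
      have "eventually (\<lambda>m. real m \<ge> y) sequentially"
        using filterlim_real_sequentially unfolding filterlim_at_top by blast
      then have "eventually (\<lambda>m. ?psi m (?s m x) = 0) sequentially"
      proof eventually_elim
        case (elim m)
        let ?m = "real (Suc m)"
        have "0 \<le> y / ?m" "y / ?m \<le> 1" using y elim by (auto simp: field_simps)
        moreover from this have "y / ?m \<le> pi" using pi_gt3 by linarith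
        ultimately have "0 \<le> sin (y / ?m)" by (intro sin_ge_zero) auto
        moreover have "?s m x = - sin (y / ?m)"
        proof -
          have "1 / ?m * (x $ l $ j - a) = - (y / ?m)" by (simp add: y_def minus_divide_left)
          then show ?thesis unfolding shifted_sin_def by (simp only: sin_minus)
        qed
        ultimately have "?m\<^sup>2 * ?s m x \<le> 0" by (simp add: mult_nonneg_nonpos)
        then show ?case by simp
      qed
      then show ?thesis using False by (simp add: tendsto_eventually)
    qed
    moreover have "(\<lambda>m. r m (?s m x) - ?psi m (?s m x)) \<longlonglongrightarrow> 0"
    proof (rule Lim_null_comparison)
      show "eventually (\<lambda>m. norm (r m (?s m x) - ?psi m (?s m x)) \<le> 1 / real (Suc m)) sequentially"
        using r(2)[OF s1] by (intro always_eventually allI) (metis abs_minus_commute less_imp_le real_norm_def)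
      show "(\<lambda>m. 1 / real (Suc m)) \<longlonglongrightarrow> 0" by (rule LIMSEQ_Suc[OF lim_1_over_n])
    qed
    ultimately have "(\<lambda>m. r m (?s m x)) \<longlonglongrightarrow> indicator {x. a < x $ l $ j} x"
      by (rule Lim_transform)
    then show "(\<lambda>m. complex_of_real (r m (?s m x))) \<longlonglongrightarrow> complex_of_real (indicator {x. a < x $ l $ j} x)"
      by (rule tendsto_of_real)
  qed
qed

text \<open>Half-spaces generate the Borel sets.\<close>

lemma multiplier_borel:
  fixes A :: "'n::finite space set"
  assumes "A \<in> sets borel"
  shows "multiplier (\<lambda>x. complex_of_real (indicator A x))"
proof -
  let ?G = "(\<lambda>(a, i). {x::'n space. a < x \<bullet> i}) ` (UNIV \<times> Basis)"
  have "A \<in> sigma_sets UNIV ?G"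
    using assms by (subst (asm) borel_eq_halfspace_greater) simp
  then show ?thesis
  proof (induction rule: sigma_sets.induct)
    case (Basic A)
    then obtain a i where A: "A = {x. a < x \<bullet> i}" "i \<in> Basis" by auto
    then obtain l j where "i = ax l j" by (auto simp: Basis_vec_def)
    then show ?case using A multiplier_halfspace[of a l j] by (simp add: inner_ax)
  next
    case Empty
    then show ?case using multiplier_const[of 0] by simp
  next
    case (Compl A)
    have "(\<lambda>x. complex_of_real (indicator (UNIV - A) x)) = (\<lambda>x. 1 + (- 1) * complex_of_real (indicator A x))"
      by (auto simp: indicator_def)
    then show ?case using Compl by (simp only:) (intro multiplier_add multiplier_mult multiplier_const)
  next
    case (Union A)
    have fin: "multiplier (\<lambda>x. complex_of_real (indicator (\<Union>i<n. A i) x))" for n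
    proof (induction n)
      case 0 then show ?case using multiplier_const[of 0] by simp
    next
      case (Suc n)
      have "(\<lambda>x. complex_of_real (indicator (\<Union>i<Suc n. A i) x)) =
        (\<lambda>x. complex_of_real (indicator (\<Union>i<n. A i) x) + (complex_of_real (indicator (A n) x)
          + (- 1) * (complex_of_real (indicator (\<Union>i<n. A i) x) * complex_of_real (indicator (A n) x))))"
        by (auto simp: indicator_def less_Suc_eq fun_eq_iff)
      then show ?case using Suc Union.IH by (simp only:) (intro multiplier_add multiplier_mult multiplier_const)
    qed
    show ?case
    proof (rule multiplier_limit[where F = "\<lambda>n x. complex_of_real (indicator (\<Union>i<n. A i) x)" and C = 1])
      show "multiplier (\<lambda>x. complex_of_real (indicator (\<Union>i<n. A i) x))" for n by (rule fin)
      fix x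
      show "(\<lambda>n. complex_of_real (indicator (\<Union>i<n. A i) x)) \<longlonglongrightarrow> complex_of_real (indicator (\<Union>i. A i) x)"
        by (intro tendsto_of_real LIMSEQ_indicator_UN)
      show "norm (complex_of_real (indicator (\<Union>i<n. A i) x)) \<le> 1" for n
        by (simp add: indicator_def)
    qed
  qed
qed

text \<open>The constant $1$ is a polynomial, so indicators of Borel sets, simple functions and
finally all square integrable functions lie in the closure.\<close>

theorem pol_dense:
  fixes f :: "'n::finite space \<Rightarrow> complex"
  assumes f: "sql2 f" shows "approximable f"
proof -
  obtain F where F: "\<And>i. simple_function borel (F i)" "\<And>x. (\<lambda>i. F i x) \<longlonglongrightarrow> f x"
    "\<And>i x. norm (F i x) \<le> 2 * norm (f x)"
    using borel_measurable_implies_sequence_metric[OF sql2_meas[OF f], of 0] by auto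
  have one: "approximable (\<lambda>x::'n space. 1)" using approximable_pol[OF pol_const] .
  have simple: "approximable (F i)" for i
  proof -
    have fin: "finite (range (F i))" and meas: "F i -` {y} \<in> sets borel" for y
      using F(1)[of i] simple_functionD[OF F(1)[of i]] by auto
    have "approximable (\<lambda>x. complex_of_real (indicator (F i -` {y}) x) * 1)" for y
      using multiplier_borel[OF meas] one unfolding multiplier_def by blast
    then have "approximable (\<lambda>x. \<Sum>y\<in>range (F i). y * (complex_of_real (indicator (F i -` {y}) x) * 1))"
      by (intro approximable_sum approximable_scale)
    also have "(\<lambda>x. \<Sum>y\<in>range (F i). y * (complex_of_real (indicator (F i -` {y}) x) * 1)) = F i"
    proof
      fix x
      have "(\<Sum>y\<in>range (F i). y * (complex_of_real (indicator (F i -` {y}) x) * 1))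
          = (\<Sum>y\<in>range (F i). if F i x = y then y else 0)"
        by (intro sum.cong) (auto simp: indicator_def)
      then show "(\<Sum>y\<in>range (F i). y * (complex_of_real (indicator (F i -` {y}) x) * 1)) = F i x"
        using fin by simp
    qed
    finally show ?thesis .
  qed
  show ?thesis
    by (rule approximable_limit[OF simple f nsq_tendsto_dominated[OF _ sql2_meas[OF f] f F(2,3)]])
      (rule borel_measurable_simple_function[OF F(1)])
qed

section \<open>Completeness\<close>

text \<open>The weight is integrable, so Cauchy sequences in the weighted space are Cauchy in the mean
and have subsequences that converge almost everywhere.\<close>

lemma integral_norm_gw_le:
  fixes f :: "'a::euclidean_space \<Rightarrow> complex"
  assumes "sql2 f" "t > 0"
  shows "integrable lborel (\<lambda>x. norm (f x) * gw x)"
    "2 * (LINT x|lborel. norm (f x) * gw x) \<le> t * nsq f + nsq (\<lambda>x::'a::euclidean_space. 1) / t"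
proof -
  have one: "sql2 (\<lambda>x::'a. 1)" by (intro sql2_exptype exptype_const) auto
  show int: "integrable lborel (\<lambda>x. norm (f x) * gw x)"
    using sql2_integrable_mult[OF assms(1) one] by simp
  have a: "sql2 (\<lambda>x. complex_of_real (norm (f x)))"
    by (rule sql2_bounded[OF assms(1), of _ 1]) (use sql2_meas[OF assms(1)] in auto)
  have "sip (\<lambda>x. complex_of_real (norm (f x))) (\<lambda>x. 1) = complex_of_real (LINT x|lborel. norm (f x) * gw x)"
    unfolding sip_def by (simp flip: of_real_mult)
  moreover have "0 \<le> (LINT x|lborel. norm (f x) * gw x)" by simp
  moreover have "nsq (\<lambda>x. complex_of_real (norm (f x))) = nsq f" by (simp add: nsq_def)
  ultimately show "2 * (LINT x|lborel. norm (f x) * gw x) \<le> t * nsq f + nsq (\<lambda>x::'a. 1) / t"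
    using norm_sip_le[OF a one assms(2)] by simp
qed

lemma sql2_fatou:
  fixes f :: "nat \<Rightarrow> 'a::euclidean_space \<Rightarrow> complex"
  assumes f: "\<And>n. sql2 (f n)" and g [measurable]: "g \<in> borel_measurable borel"
    and lim: "AE x in lborel. (\<lambda>n. f n x) \<longlonglongrightarrow> g x" and bound: "\<And>n. n \<ge> N \<Longrightarrow> nsq (f n) \<le> c"
  shows "sql2 g" "nsq g \<le> c"
proof -
  note [measurable] = sql2_meas[OF f]
  have c: "c \<ge> 0" using bound[of N] nsq_nonneg[of "f N"] by linarith
  have eq: "(\<integral>\<^sup>+x. ennreal ((norm (f n x))\<^sup>2 * gw x) \<partial>lborel) = ennreal (nsq (f n))" for n
    unfolding nsq_def using f[of n] by (intro nn_integral_eq_integral) (auto simp: sql2_def)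
  have "(\<integral>\<^sup>+x. ennreal ((norm (g x))\<^sup>2 * gw x) \<partial>lborel)
      = (\<integral>\<^sup>+x. liminf (\<lambda>n. ennreal ((norm (f n x))\<^sup>2 * gw x)) \<partial>lborel)"
  proof (rule nn_integral_cong_AE)
    show "AE x in lborel. ennreal ((norm (g x))\<^sup>2 * gw x) = liminf (\<lambda>n. ennreal ((norm (f n x))\<^sup>2 * gw x))"
      using lim
    proof eventually_elim
      case (elim x)
      have "(\<lambda>n. ennreal ((norm (f n x))\<^sup>2 * gw x)) \<longlonglongrightarrow> ennreal ((norm (g x))\<^sup>2 * gw x)"
        by (intro tendsto_ennrealI tendsto_intros elim)
      then show ?case by (rule lim_imp_Liminf[OF _ , symmetric, rotated]) simp
    qed
  qed
  also have "\<dots> \<le> liminf (\<lambda>n. \<integral>\<^sup>+x. ennreal ((norm (f n x))\<^sup>2 * gw x) \<partial>lborel)"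
    by (rule nn_integral_liminf) measurable
  also have "\<dots> \<le> ennreal c"
    unfolding eq
  proof -
    have "eventually (\<lambda>n. ennreal (nsq (f n)) \<le> ennreal c) sequentially"
      using eventually_ge_at_top[of N] by eventually_elim (intro ennreal_leI bound)
    then have "liminf (\<lambda>n. ennreal (nsq (f n))) \<le> liminf (\<lambda>n. ennreal c)" by (rule Liminf_mono)
    then show "liminf (\<lambda>n. ennreal (nsq (f n))) \<le> ennreal c" by (simp add: Liminf_const)
  qed
  finally have le: "(\<integral>\<^sup>+x. ennreal ((norm (g x))\<^sup>2 * gw x) \<partial>lborel) \<le> ennreal c" .
  then have "(\<integral>\<^sup>+x. ennreal ((norm (g x))\<^sup>2 * gw x) \<partial>lborel) < \<infinity>"
    using ennreal_less_top[of c] by (auto simp: le_less_trans)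
  then have int: "integrable lborel (\<lambda>x. (norm (g x))\<^sup>2 * gw x)"
    by (intro integrableI_nonneg) auto
  then show "sql2 g" by (simp add: sql2_def)
  have "ennreal (nsq g) = (\<integral>\<^sup>+x. ennreal ((norm (g x))\<^sup>2 * gw x) \<partial>lborel)"
    unfolding nsq_def using int by (intro nn_integral_eq_integral[symmetric]) auto
  then have "ennreal (nsq g) \<le> ennreal c" using le by simp
  then show "nsq g \<le> c" using c by (simp add: ennreal_le_iff)
qed

text \<open>The limit is taken pointwise along a subsequence that converges almost everywhere; Fatou's lemma bounds its distance
to the members of the sequence.\<close>

lemma sql2_complete:
  fixes f :: "nat \<Rightarrow> 'a::euclidean_space \<Rightarrow> complex"
  assumes f: "\<And>n. sql2 (f n)"
    and cauchy: "\<And>e. e > 0 \<Longrightarrow> \<exists>N. \<forall>m\<ge>N. \<forall>n\<ge>N. nsq (\<lambda>x. f m x - f n x) < e"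
  obtains g where "sql2 g" "(\<lambda>n. nsq (\<lambda>x. f n x - g x)) \<longlonglongrightarrow> 0"
proof -
  note [measurable] = sql2_meas[OF f]
  let ?s = "\<lambda>n x. f n x * complex_of_real (gw x)"
  have int: "integrable lborel (?s n)" for n
    using integral_norm_gw_le(1)[OF f, of 1 n] by (subst integrable_norm_iff[symmetric]) (auto simp: norm_mult)
  define K where "K = nsq (\<lambda>x::'a. 1)"
  have K: "K \<ge> 0" by (simp add: K_def)
  obtain r where r: "strict_mono r" and rc: "AE x in lborel. Cauchy (\<lambda>n. ?s (r n) x)"
  proof (rule cauchy_L1_AE_cauchy_subseq[of lborel ?s, OF int])
    fix e :: real assume e: "e > 0"
    define t where "t = (K + 1) / e"
    have t: "t > 0" using e K by (simp add: t_def)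
    then obtain N where N: "\<forall>m\<ge>N. \<forall>n\<ge>N. nsq (\<lambda>x. f m x - f n x) < e / t" using cauchy[of "e / t"] e by auto
    have "LINT x|lborel. norm (?s i x - ?s j x) < e" if "i \<ge> N" "j \<ge> N" for i j
    proof -
      have "2 * (LINT x|lborel. norm (f i x - f j x) * gw x) \<le> t * nsq (\<lambda>x. f i x - f j x) + K / t"
        unfolding K_def by (intro integral_norm_gw_le sql2_diff f t)
      also have "t * nsq (\<lambda>x. f i x - f j x) < e" using N that t by (simp add: pos_less_divide_eq mult.commute)
      also have "K / t \<le> e" using e K by (simp add: t_def field_simps)
      finally show ?thesis by (simp add: left_diff_distrib[symmetric] norm_mult)
    qed
    then show "\<exists>N. \<forall>i\<ge>N. \<forall>j\<ge>N. LINT x|lborel. norm (?s i x - ?s j x) < e" by blast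
  qed auto
  define g where "g x = lim (\<lambda>n. f (r n) x)" for x
  have g [measurable]: "g \<in> borel_measurable borel"
    unfolding g_def by (rule borel_measurable_lim_metric) measurable
  have lim: "AE x in lborel. (\<lambda>n. f (r n) x) \<longlonglongrightarrow> g x"
    using rc
  proof eventually_elim
    case (elim x)
    then have "convergent (\<lambda>n. ?s (r n) x)" by (simp add: Cauchy_convergent)
    then have "convergent (\<lambda>n. ?s (r n) x * complex_of_real (inverse (gw x)))"
      by (rule convergent_mult[OF _ convergent_const])
    also have "(\<lambda>n. ?s (r n) x * complex_of_real (inverse (gw x))) = (\<lambda>n. f (r n) x)"
      by (simp add: mult.assoc flip: of_real_mult)
    finally have "convergent (\<lambda>n. f (r n) x)" .
    then show ?case unfolding g_def by (simp add: convergent_LIMSEQ_iff)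
  qed
  have key: "\<exists>N. \<forall>m\<ge>N. sql2 (\<lambda>x. f m x - g x) \<and> nsq (\<lambda>x. f m x - g x) \<le> e" if "e > 0" for e
  proof -
    obtain N where N: "\<forall>m\<ge>N. \<forall>n\<ge>N. nsq (\<lambda>x. f m x - f n x) < e" using cauchy \<open>e > 0\<close> by blast
    have "sql2 (\<lambda>x. f m x - g x) \<and> nsq (\<lambda>x. f m x - g x) \<le> e" if "m \<ge> N" for m
    proof -
      have a: "AE x in lborel. (\<lambda>n. f m x - f (r n) x) \<longlonglongrightarrow> f m x - g x"
        using lim by eventually_elim (intro tendsto_intros)
      have b: "nsq (\<lambda>x. f m x - f (r n) x) \<le> e" if "n \<ge> N" for n
        using N \<open>m \<ge> N\<close> order_trans[OF that seq_suble[OF r]] by (meson less_imp_le)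
      show ?thesis
        using sql2_fatou[where f = "\<lambda>n x. f m x - f (r n) x", OF sql2_diff[OF f f] _ a b] by auto
    qed
    then show ?thesis by blast
  qed
  show ?thesis
  proof (rule that[of g])
    obtain N where "sql2 (\<lambda>x. f N x - g x)" using key[of 1] by auto
    from sql2_diff[OF f[of N] this] show "sql2 g" by simp
    show "(\<lambda>n. nsq (\<lambda>x. f n x - g x)) \<longlonglongrightarrow> 0"
    proof (rule LIMSEQ_I)
      fix e :: real assume "e > 0"
      then obtain N where "\<forall>m\<ge>N. nsq (\<lambda>x. f m x - g x) \<le> e / 2" using key[of "e / 2"] by auto
      then show "\<exists>N. \<forall>n\<ge>N. norm (nsq (\<lambda>x. f n x - g x) - 0) < e"
        using \<open>e > 0\<close> by (intro exI[of _ N]) fastforce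
    qed
  qed
qed

section \<open>Tuple-valued functions\<close>

abbreviation ph :: "'n::finite space \<Rightarrow> real" where
  "ph \<equiv> \<lambda>x. (norm x)\<^sup>2"

lemma exp_ph: "exp (- 2 * (norm x)\<^sup>2) = gw x" by (simp add: gw_def)

lemma L2_iff: "f \<in> L2 ph V \<longleftrightarrow> (\<forall>x. f x \<in> V) \<and> (\<forall>i. sql2 (\<lambda>x. f x i))"
  unfolding L2_def sql2_def exp_ph by auto

definition tnsq :: "'i set \<Rightarrow> ('n::finite space \<Rightarrow> 'i \<Rightarrow> complex) \<Rightarrow> real" where
  "tnsq I f = (\<Sum>i\<in>I. nsq (\<lambda>x. f x i))"

lemma tnsq_nonneg [simp]: "tnsq I f \<ge> 0" unfolding tnsq_def by (intro sum_nonneg) auto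

lemma tnsq_commute: "tnsq I (\<lambda>x i. f x i - g x i) = tnsq I (\<lambda>x i. g x i - f x i)"
  unfolding tnsq_def by (intro sum.cong refl nsq_uminus_commute)

lemma ip_cnj: "ip \<phi> I g f = cnj (ip \<phi> I f g)"
proof -
  have "cnj (ip \<phi> I f g) = (LINT x|lborel. cnj ((\<Sum>i\<in>I. f x i * cnj (g x i)) * complex_of_real (exp (- 2 * \<phi> x))))"
    unfolding ip_def by (simp del: complex_cnj_mult)
  then show ?thesis by (simp add: ip_def mult.commute)
qed

text \<open>What the three spaces of tuples have in common: finitely many entries, subject to linear conditions that pass
to pointwise limits.\<close>

locale tuples =
  fixes V :: "('i \<Rightarrow> complex) set" and I :: "'i set"
  assumes finI: "finite I"
    and supp: "v \<in> V \<Longrightarrow> i \<notin> I \<Longrightarrow> v i = 0"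
    and zero: "(\<lambda>i. 0) \<in> V"
    and add: "u \<in> V \<Longrightarrow> v \<in> V \<Longrightarrow> (\<lambda>i. u i + v i) \<in> V"
    and scale: "v \<in> V \<Longrightarrow> (\<lambda>i. c * v i) \<in> V"
    and closed: "(\<And>n. w n \<in> V) \<Longrightarrow> (\<And>i. (\<lambda>n. w n i) \<longlonglongrightarrow> v i) \<Longrightarrow> v \<in> V"
begin

lemma L2_sql2: "f \<in> L2 ph V \<Longrightarrow> sql2 (\<lambda>x. f x i)"
  by (simp add: L2_iff)

lemma L2_add: "f \<in> L2 ph V \<Longrightarrow> g \<in> L2 ph V \<Longrightarrow> (\<lambda>x i. f x i + g x i) \<in> L2 ph V"
  by (auto simp: L2_iff intro: add sql2_add)

lemma L2_scale: "f \<in> L2 ph V \<Longrightarrow> (\<lambda>x i. c * f x i) \<in> L2 ph V"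
  by (auto simp: L2_iff intro: scale sql2_scale)

lemma L2_diff: "f \<in> L2 ph V \<Longrightarrow> g \<in> L2 ph V \<Longrightarrow> (\<lambda>x i. f x i - g x i) \<in> L2 ph V"
  using L2_add[OF _ L2_scale[of g "-1"]] by simp

lemma ip_eq:
  assumes "f \<in> L2 ph V" "g \<in> L2 ph V"
  shows "ip ph I f g = (\<Sum>i\<in>I. sip (\<lambda>x. f x i) (\<lambda>x. g x i))"
  unfolding ip_def exp_ph sip_def sum_distrib_right
  by (intro Bochner_Integration.integral_sum sql2_integrable L2_sql2 assms)

lemma ip_self: "f \<in> L2 ph V \<Longrightarrow> ip ph I f f = complex_of_real (tnsq I f)"
  by (simp add: ip_eq sip_self tnsq_def)

lemma nrm_eq: "f \<in> L2 ph V \<Longrightarrow> nrm ph I f = sqrt (tnsq I f)"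
  by (simp add: nrm_def ip_self)

lemma ip_add_left: "f \<in> L2 ph V \<Longrightarrow> g \<in> L2 ph V \<Longrightarrow> h \<in> L2 ph V \<Longrightarrow>
    ip ph I (\<lambda>x i. f x i + g x i) h = ip ph I f h + ip ph I g h"
  by (simp add: ip_eq L2_add sip_add_left L2_sql2 sum.distrib)

lemma ip_diff_left: "f \<in> L2 ph V \<Longrightarrow> g \<in> L2 ph V \<Longrightarrow> h \<in> L2 ph V \<Longrightarrow>
    ip ph I (\<lambda>x i. f x i - g x i) h = ip ph I f h - ip ph I g h"
  by (simp add: ip_eq L2_diff sip_diff_left L2_sql2 sum_subtractf)

lemma ip_diff_right: "f \<in> L2 ph V \<Longrightarrow> g \<in> L2 ph V \<Longrightarrow> h \<in> L2 ph V \<Longrightarrow>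
    ip ph I h (\<lambda>x i. f x i - g x i) = ip ph I h f - ip ph I h g"
  by (simp add: ip_eq L2_diff sip_diff_right L2_sql2 sum_subtractf)

lemma ip_add_right: "f \<in> L2 ph V \<Longrightarrow> g \<in> L2 ph V \<Longrightarrow> h \<in> L2 ph V \<Longrightarrow>
    ip ph I h (\<lambda>x i. f x i + g x i) = ip ph I h f + ip ph I h g"
  by (simp add: ip_eq L2_add sip_add_right L2_sql2 sum.distrib)

lemma norm_ip_le:
  assumes "f \<in> L2 ph V" "g \<in> L2 ph V" "t > 0"
  shows "2 * norm (ip ph I f g) \<le> t * tnsq I f + tnsq I g / t"
proof -
  have "2 * norm (ip ph I f g) \<le> (\<Sum>i\<in>I. 2 * norm (sip (\<lambda>x. f x i) (\<lambda>x. g x i)))"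
    using assms by (simp add: ip_eq sum_distrib_left[symmetric] norm_sum)
  also have "\<dots> \<le> (\<Sum>i\<in>I. t * nsq (\<lambda>x. f x i) + nsq (\<lambda>x. g x i) / t)"
    by (intro sum_mono norm_sip_le L2_sql2 assms)
  also have "\<dots> = t * tnsq I f + tnsq I g / t"
    by (simp add: tnsq_def sum.distrib sum_distrib_left sum_divide_distrib)
  finally show ?thesis .
qed

lemma tnsq_add_le:
  assumes "f \<in> L2 ph V" "g \<in> L2 ph V"
  shows "tnsq I (\<lambda>x i. f x i + g x i) \<le> 2 * tnsq I f + 2 * tnsq I g"
  unfolding tnsq_def sum_distrib_left sum.distrib[symmetric]
  by (intro sum_mono nsq_add_le L2_sql2 assms)

lemma tnsq_triangle:
  assumes "f \<in> L2 ph V" "g \<in> L2 ph V" "h \<in> L2 ph V"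
  shows "tnsq I (\<lambda>x i. f x i - h x i) \<le> 2 * tnsq I (\<lambda>x i. f x i - g x i) + 2 * tnsq I (\<lambda>x i. g x i - h x i)"
  using tnsq_add_le[OF L2_diff[OF assms(1,2)] L2_diff[OF assms(2,3)]] by simp

lemma tnsq_component:
  assumes "\<And>n. F n \<in> L2 ph V" "G \<in> L2 ph V" "(\<lambda>n. tnsq I (\<lambda>x i. F n x i - G x i)) \<longlonglongrightarrow> 0"
  shows "(\<lambda>n. nsq (\<lambda>x. F n x i - G x i)) \<longlonglongrightarrow> 0"
proof (cases "i \<in> I")
  case True
  have "nsq (\<lambda>x. F n x i - G x i) \<le> tnsq I (\<lambda>x i. F n x i - G x i)" for n
    unfolding tnsq_def by (rule member_le_sum[OF True]) (auto intro: finI)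
  then show ?thesis by (intro Lim_null_comparison[OF _ assms(3)] always_eventually) auto
next
  case False
  then have "F n x i = 0" "G x i = 0" for n x
    using assms supp by (auto simp: L2_iff)
  then show ?thesis by (simp add: nsq_def)
qed

lemma tendsto_ip_left:
  assumes "\<And>n. F n \<in> L2 ph V" "G \<in> L2 ph V" "H \<in> L2 ph V" "(\<lambda>n. tnsq I (\<lambda>x i. F n x i - G x i)) \<longlonglongrightarrow> 0"
  shows "(\<lambda>n. ip ph I (F n) H) \<longlonglongrightarrow> ip ph I G H"
  using assms by (simp add: ip_eq) (intro tendsto_sum tendsto_sip_left tnsq_component L2_sql2)

lemma tendsto_ip_right:
  assumes "\<And>n. F n \<in> L2 ph V" "G \<in> L2 ph V" "H \<in> L2 ph V" "(\<lambda>n. tnsq I (\<lambda>x i. F n x i - G x i)) \<longlonglongrightarrow> 0"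
  shows "(\<lambda>n. ip ph I H (F n)) \<longlonglongrightarrow> ip ph I H G"
  unfolding ip_cnj[of _ _ H] by (intro tendsto_cnj tendsto_ip_left assms)

lemma tnsq_0_AE:
  assumes "f \<in> L2 ph V" "tnsq I f = 0"
  shows "AE x in lborel. \<forall>i. f x i = 0"
proof -
  have "nsq (\<lambda>x. f x i) = 0" if "i \<in> I" for i
    using assms(2) finI that unfolding tnsq_def by (subst (asm) sum_nonneg_eq_0_iff) auto
  then have "AE x in lborel. f x i = 0" if "i \<in> I" for i
    using nsq_eq_0_iff[OF L2_sql2[OF assms(1)]] that by blast
  then have "AE x in lborel. \<forall>i\<in>I. f x i = 0"
    using finI by (simp add: AE_finite_all)
  then show ?thesis
  proof eventually_elim
    case (elim x)
    have "f x \<in> V" using assms(1) by (simp add: L2_iff)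
    then have "f x i = 0" if "i \<notin> I" for i using that by (rule supp)
    then show ?case using elim by blast
  qed
qed

text \<open>The entries converge separately. The linear conditions hold at each point where some common subsequence
converges in all entries; on the remaining null set the limit is replaced by zero, because the representatives have to satisfy the
conditions everywhere.\<close>

lemma complete:
  assumes F: "\<And>n. F n \<in> L2 ph V"
    and cauchy: "\<And>e. e > 0 \<Longrightarrow> \<exists>N. \<forall>m\<ge>N. \<forall>n\<ge>N. tnsq I (\<lambda>x i. F m x i - F n x i) < e"
  obtains G where "G \<in> L2 ph V" "(\<lambda>n. tnsq I (\<lambda>x i. F n x i - G x i)) \<longlonglongrightarrow> 0"
proof -
  have ex: "\<exists>g. sql2 g \<and> (\<lambda>n. nsq (\<lambda>x. F n x i - g x)) \<longlonglongrightarrow> 0" if i: "i \<in> I" for i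
  proof -
    have le: "nsq (\<lambda>x. F m x i - F n x i) \<le> tnsq I (\<lambda>x i. F m x i - F n x i)" for m n
      unfolding tnsq_def by (rule member_le_sum[OF i]) (auto intro: finI)
    obtain g where "sql2 g" "(\<lambda>n. nsq (\<lambda>x. F n x i - g x)) \<longlonglongrightarrow> 0"
    proof (rule sql2_complete[of "\<lambda>n x. F n x i"])
      show "sql2 (\<lambda>x. F n x i)" for n by (rule L2_sql2[OF F])
      fix e :: real assume e: "e > 0"
      show "\<exists>N. \<forall>m\<ge>N. \<forall>n\<ge>N. nsq (\<lambda>x. F m x i - F n x i) < e"
      proof -
        obtain N where N: "\<forall>m\<ge>N. \<forall>n\<ge>N. tnsq I (\<lambda>x i. F m x i - F n x i) < e" using cauchy[OF e] by blast
        have "nsq (\<lambda>x. F m x i - F n x i) < e" if "m \<ge> N" "n \<ge> N" for m n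
          using le[of m n] N that by (meson le_less_trans)
        then show ?thesis by blast
      qed
    qed auto
    then show ?thesis by blast
  qed
  define g where "g i = (SOME g. sql2 g \<and> (\<lambda>n. nsq (\<lambda>x. F n x i - g x)) \<longlonglongrightarrow> 0)" for i
  have "sql2 (g i) \<and> (\<lambda>n. nsq (\<lambda>x. F n x i - g i x)) \<longlonglongrightarrow> 0" if "i \<in> I" for i
    unfolding g_def by (rule someI_ex[OF ex[OF that]])
  then have g: "\<And>i. i \<in> I \<Longrightarrow> sql2 (g i)" "\<And>i. i \<in> I \<Longrightarrow> (\<lambda>n. nsq (\<lambda>x. F n x i - g i x)) \<longlonglongrightarrow> 0"
    by auto
  define u where "u n x = (\<Sum>i\<in>I. (norm (F n x i - g i x))\<^sup>2 * gw x)" for n x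
  have sd: "sql2 (\<lambda>x. F n x i - g i x)" if "i \<in> I" for n i
    by (intro sql2_diff L2_sql2[OF F] g that)
  have iu: "integrable lborel (u n)" for n
    unfolding u_def using sd by (intro Bochner_Integration.integrable_sum) (auto simp: sql2_def)
  have "(LINT x|lborel. norm (u n x)) = (\<Sum>i\<in>I. nsq (\<lambda>x. F n x i - g i x))" for n
  proof -
    have "norm (u n x) = u n x" for x unfolding u_def by (simp add: sum_nonneg)
    then show ?thesis
      unfolding nsq_def u_def using sd by (subst Bochner_Integration.integral_sum[symmetric]) (auto simp: sql2_def u_def)
  qed
  moreover have "(\<lambda>n. \<Sum>i\<in>I. nsq (\<lambda>x. F n x i - g i x)) \<longlonglongrightarrow> (\<Sum>i\<in>I. 0)"
    by (intro tendsto_sum g)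
  ultimately have "(\<lambda>n. LINT x|lborel. norm (u n x)) \<longlonglongrightarrow> 0" by simp
  from tendsto_L1_AE_subseq[OF iu this]
  obtain r where r: "strict_mono r" "AE x in lborel. (\<lambda>n. u (r n) x) \<longlonglongrightarrow> 0" by auto
  define G0 where "G0 x i = (if i \<in> I then g i x else 0)" for x i
  have "AE x in lborel. G0 x \<in> V"
    using r(2)
  proof eventually_elim
    case (elim x)
    show ?case
    proof (rule closed)
      show "F (r n) x \<in> V" for n using F by (simp add: L2_iff)
      fix i
      show "(\<lambda>n. F (r n) x i) \<longlonglongrightarrow> G0 x i"
      proof (cases "i \<in> I")
        case True
        have le: "(norm (F (r n) x i - g i x))\<^sup>2 * gw x \<le> u (r n) x" for n
          unfolding u_def by (rule member_le_sum[OF True]) (auto intro: finI)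
        have "(\<lambda>n. (norm (F (r n) x i - g i x))\<^sup>2 * gw x) \<longlonglongrightarrow> 0"
          by (rule Lim_null_comparison[OF _ elim]) (use le in \<open>auto intro!: always_eventually\<close>)
        then have "(\<lambda>n. (norm (F (r n) x i - g i x))\<^sup>2 * gw x * inverse (gw x)) \<longlonglongrightarrow> 0 * inverse (gw x)"
          by (intro tendsto_intros)
        then have "(\<lambda>n. (norm (F (r n) x i - g i x))\<^sup>2) \<longlonglongrightarrow> 0" by (simp add: mult.assoc)
        then have "(\<lambda>n. sqrt ((norm (F (r n) x i - g i x))\<^sup>2)) \<longlonglongrightarrow> sqrt 0" by (rule tendsto_real_sqrt)
        then have "(\<lambda>n. F (r n) x i - g i x) \<longlonglongrightarrow> 0" by (simp add: tendsto_norm_zero_iff)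
        then show ?thesis using True by (simp add: G0_def Lim_null[of _ "g i x"])
      next
        case False
        then have "F (r n) x i = 0" for n using F supp by (auto simp: L2_iff)
        then show ?thesis using False by (simp add: G0_def)
      qed
    qed
  qed
  then obtain N where N: "{x. G0 x \<notin> V} \<subseteq> N" "emeasure lborel N = 0" "N \<in> sets lborel"
    by (auto elim!: AE_E)
  define G where "G x i = (if x \<in> N then 0 else G0 x i)" for x i
  have AEN: "AE x in lborel. x \<notin> N" using N by (intro AE_not_in) (auto simp: null_sets_def)
  have meas: "(\<lambda>x. G x i) \<in> borel_measurable borel" for i
  proof (cases "i \<in> I")
    case True
    note [measurable] = sql2_meas[OF g(1)[OF True]] N(3)
    show ?thesis unfolding G_def G0_def using True by measurable
  qed (simp add: G_def G0_def cong: if_cong)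
  have diff: "nsq (\<lambda>x. F n x i - G x i) = nsq (\<lambda>x. F n x i - g i x)" if "i \<in> I" for n i
    unfolding nsq_def
  proof (rule integral_cong_AE)
    note [measurable] = meas sql2_meas[OF L2_sql2[OF F]] sql2_meas[OF g(1)[OF that]]
    show "AE x in lborel. (norm (F n x i - G x i))\<^sup>2 * gw x = (norm (F n x i - g i x))\<^sup>2 * gw x"
      using AEN by eventually_elim (simp add: G_def G0_def that)
  qed (use meas sql2_meas[OF L2_sql2[OF F]] sql2_meas[OF g(1)[OF that]] in measurable)
  show ?thesis
  proof (rule that[of G])
    have "sql2 (\<lambda>x. G x i)" for i
    proof (cases "i \<in> I")
      case True
      show ?thesis
        by (rule sql2_bounded[OF g(1)[OF True] meas, of _ 1]) (auto simp: G_def G0_def)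
    qed (simp add: G_def G0_def cong: if_cong)
    moreover have "G x \<in> V" for x
    proof (cases "x \<in> N")
      case True then show ?thesis using zero by (simp add: G_def[abs_def])
    next
      case False
      then have "G0 x \<in> V" using N(1) by blast
      moreover have "G x = G0 x" using False by (auto simp: G_def)
      ultimately show ?thesis by simp
    qed
    ultimately show "G \<in> L2 ph V" by (simp add: L2_iff)
    have "(\<lambda>n. \<Sum>i\<in>I. nsq (\<lambda>x. F n x i - G x i)) \<longlonglongrightarrow> (\<Sum>i\<in>I. 0)"
      by (intro tendsto_sum) (simp add: diff g)
    then show "(\<lambda>n. tnsq I (\<lambda>x i. F n x i - G x i)) \<longlonglongrightarrow> 0" by (simp add: tnsq_def)
  qed
qed

end

section \<open>The three tuple spaces\<close>

lemma finite_lists_2: "finite {s :: 2 list. length s = m}"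
  using finite_lists_length_eq[of "UNIV :: 2 set" m] by simp

lemma V0I: "(\<And>s. length s \<noteq> k \<Longrightarrow> v s = 0) \<Longrightarrow> (\<And>s t. mset s = mset t \<Longrightarrow> v s = v t) \<Longrightarrow> v \<in> V0 k"
  unfolding V0_def I0_def by blast

lemma V0_supp: "v \<in> V0 k \<Longrightarrow> length s \<noteq> k \<Longrightarrow> v s = 0"
  unfolding V0_def I0_def by blast

lemma V0_sym: "v \<in> V0 k \<Longrightarrow> mset s = mset t \<Longrightarrow> v s = v t"
  unfolding V0_def by blast

lemma I1_iff: "(s, A) \<in> I1 k \<longleftrightarrow> length s = k - 1"
  by (simp add: I1_def)

lemma I2_iff: "(A, B, s) \<in> I2 k \<longleftrightarrow> length s = k - 2"
  by (simp add: I2_def)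

lemma V1I:
  assumes "\<And>s A. length s \<noteq> k - 1 \<Longrightarrow> v (s, A) = 0" "\<And>s t A. mset s = mset t \<Longrightarrow> v (s, A) = v (t, A)"
  shows "v \<in> V1 k"
proof -
  have "\<forall>i. i \<notin> I1 k \<longrightarrow> v i = 0" using assms(1) by (force simp: I1_iff)
  then show ?thesis using assms(2) unfolding V1_def by blast
qed

lemma V1_supp: "v \<in> V1 k \<Longrightarrow> length s \<noteq> k - 1 \<Longrightarrow> v (s, A) = 0"
  unfolding V1_def using I1_iff by blast

lemma V1_sym: "v \<in> V1 k \<Longrightarrow> mset s = mset t \<Longrightarrow> v (s, A) = v (t, A)"
  unfolding V1_def by blast

lemma V2I:
  assumes "\<And>A B s. length s \<noteq> k - 2 \<Longrightarrow> v (A, B, s) = 0"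
    "\<And>A B s t. mset s = mset t \<Longrightarrow> v (A, B, s) = v (A, B, t)"
    "\<And>A B s. v (A, B, s) = - v (B, A, s)"
  shows "v \<in> V2 k"
proof -
  have "\<forall>i. i \<notin> I2 k \<longrightarrow> v i = 0" using assms(1) by (force simp: I2_iff)
  then show ?thesis using assms(2,3) unfolding V2_def by blast
qed

lemma V2_supp: "v \<in> V2 k \<Longrightarrow> length s \<noteq> k - 2 \<Longrightarrow> v (A, B, s) = 0"
  unfolding V2_def using I2_iff by blast

lemma V2_sym: "v \<in> V2 k \<Longrightarrow> mset s = mset t \<Longrightarrow> v (A, B, s) = v (A, B, t)"
  unfolding V2_def by blast

lemma V2_anti: "v \<in> V2 k \<Longrightarrow> v (A, B, s) = - v (B, A, s)"
  unfolding V2_def by blast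

lemma limit_eq:
  fixes a b :: complex
  assumes "w \<longlonglongrightarrow> a" "w' \<longlonglongrightarrow> b" "\<And>n. w n = w' n"
  shows "a = b"
proof -
  have "w = w'" by (rule ext) (rule assms(3))
  then show ?thesis using LIMSEQ_unique[OF assms(1)] assms(2) by simp
qed

lemma tuples_V0: "tuples (V0 k) (I0 k)"
proof (rule tuples.intro)
  show "finite (I0 k)" by (simp add: I0_def finite_lists_2)
  show "v i = 0" if "v \<in> V0 k" "i \<notin> I0 k" for v i using that unfolding V0_def by blast
  show "(\<lambda>i. 0) \<in> V0 k" by (rule V0I) auto
  show "(\<lambda>i. u i + v i) \<in> V0 k" if "u \<in> V0 k" "v \<in> V0 k" for u v
  proof (rule V0I)
    show "u s + v s = 0" if "length s \<noteq> k" for s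
      using V0_supp[OF \<open>u \<in> V0 k\<close> that] V0_supp[OF \<open>v \<in> V0 k\<close> that] by simp
    show "u s + v s = u t + v t" if "mset s = mset t" for s t
      using V0_sym[OF \<open>u \<in> V0 k\<close> that] V0_sym[OF \<open>v \<in> V0 k\<close> that] by simp
  qed
  show "(\<lambda>i. c * v i) \<in> V0 k" if "v \<in> V0 k" for v c
  proof (rule V0I)
    show "c * v s = 0" if "length s \<noteq> k" for s using V0_supp[OF \<open>v \<in> V0 k\<close> that] by simp
    show "c * v s = c * v t" if "mset s = mset t" for s t using V0_sym[OF \<open>v \<in> V0 k\<close> that] by simp
  qed
  fix w :: "nat \<Rightarrow> _" and v assume w: "\<And>n. w n \<in> V0 k" and l: "\<And>i. (\<lambda>n. w n i) \<longlonglongrightarrow> v i"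
  show "v \<in> V0 k"
  proof (rule V0I)
    show "v s = 0" if "length s \<noteq> k" for s
      by (rule limit_eq[OF l tendsto_const]) (rule V0_supp[OF w that])
    show "v s = v t" if "mset s = mset t" for s t
      by (rule limit_eq[OF l l]) (rule V0_sym[OF w that])
  qed
qed

lemma tuples_V1: "tuples (V1 k :: ('n::finite idx1 \<Rightarrow> complex) set) (I1 k)"
proof (rule tuples.intro)
  have "(I1 k :: 'n idx1 set) = {s. length s = k - 1} \<times> UNIV" by (auto simp: I1_def)
  then show "finite (I1 k :: 'n idx1 set)" using finite_lists_2[of "k - 1"] by simp
  show "v i = 0" if "v \<in> V1 k" "i \<notin> I1 k" for v and i :: "'n idx1" using that unfolding V1_def by blast
  show "(\<lambda>i. 0) \<in> V1 k" by (rule V1I) auto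
  show "(\<lambda>i. u i + v i) \<in> V1 k" if "u \<in> V1 k" "v \<in> V1 k" for u v :: "'n idx1 \<Rightarrow> complex"
  proof (rule V1I)
    show "u (s, A) + v (s, A) = 0" if "length s \<noteq> k - 1" for s A
      using V1_supp[OF \<open>u \<in> V1 k\<close> that] V1_supp[OF \<open>v \<in> V1 k\<close> that] by simp
    show "u (s, A) + v (s, A) = u (t, A) + v (t, A)" if "mset s = mset t" for s t A
      using V1_sym[OF \<open>u \<in> V1 k\<close> that] V1_sym[OF \<open>v \<in> V1 k\<close> that] by simp
  qed
  show "(\<lambda>i. c * v i) \<in> V1 k" if "v \<in> V1 k" for v :: "'n idx1 \<Rightarrow> complex" and c
  proof (rule V1I)
    show "c * v (s, A) = 0" if "length s \<noteq> k - 1" for s A using V1_supp[OF \<open>v \<in> V1 k\<close> that] by simp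
    show "c * v (s, A) = c * v (t, A)" if "mset s = mset t" for s t A using V1_sym[OF \<open>v \<in> V1 k\<close> that] by simp
  qed
  fix w :: "nat \<Rightarrow> 'n idx1 \<Rightarrow> complex" and v assume w: "\<And>n. w n \<in> V1 k" and l: "\<And>i. (\<lambda>n. w n i) \<longlonglongrightarrow> v i"
  show "v \<in> V1 k"
  proof (rule V1I)
    show "v (s, A) = 0" if "length s \<noteq> k - 1" for s A
      by (rule limit_eq[OF l tendsto_const]) (rule V1_supp[OF w that])
    show "v (s, A) = v (t, A)" if "mset s = mset t" for s t A
      by (rule limit_eq[OF l l]) (rule V1_sym[OF w that])
  qed
qed

lemma tuples_V2: "tuples (V2 k :: ('n::finite idx2 \<Rightarrow> complex) set) (I2 k)"
proof (rule tuples.intro)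
  have "(I2 k :: 'n idx2 set) = UNIV \<times> UNIV \<times> {s. length s = k - 2}" by (auto simp: I2_def)
  then show "finite (I2 k :: 'n idx2 set)" using finite_lists_2[of "k - 2"] by simp
  show "v i = 0" if "v \<in> V2 k" "i \<notin> I2 k" for v and i :: "'n idx2" using that unfolding V2_def by blast
  show "(\<lambda>i. 0) \<in> V2 k" by (rule V2I) auto
  show "(\<lambda>i. u i + v i) \<in> V2 k" if "u \<in> V2 k" "v \<in> V2 k" for u v :: "'n idx2 \<Rightarrow> complex"
  proof (rule V2I)
    show "u (A, B, s) + v (A, B, s) = 0" if "length s \<noteq> k - 2" for A B s
      using V2_supp[OF \<open>u \<in> V2 k\<close> that] V2_supp[OF \<open>v \<in> V2 k\<close> that] by simp
    show "u (A, B, s) + v (A, B, s) = u (A, B, t) + v (A, B, t)" if "mset s = mset t" for A B s t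
      using V2_sym[OF \<open>u \<in> V2 k\<close> that] V2_sym[OF \<open>v \<in> V2 k\<close> that] by simp
    show "u (A, B, s) + v (A, B, s) = - (u (B, A, s) + v (B, A, s))" for A B s
      using V2_anti[OF that(1), of A B s] V2_anti[OF that(2), of A B s] by simp
  qed
  show "(\<lambda>i. c * v i) \<in> V2 k" if "v \<in> V2 k" for v :: "'n idx2 \<Rightarrow> complex" and c
  proof (rule V2I)
    show "c * v (A, B, s) = 0" if "length s \<noteq> k - 2" for A B s
      using V2_supp[OF \<open>v \<in> V2 k\<close> that] by simp
    show "c * v (A, B, s) = c * v (A, B, t)" if "mset s = mset t" for A B s t
      using V2_sym[OF \<open>v \<in> V2 k\<close> that] by simp
    show "c * v (A, B, s) = - (c * v (B, A, s))" for A B s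
      using V2_anti[OF that, of A B s] by simp
  qed
  fix w :: "nat \<Rightarrow> 'n idx2 \<Rightarrow> complex" and v assume w: "\<And>n. w n \<in> V2 k" and l: "\<And>i. (\<lambda>n. w n i) \<longlonglongrightarrow> v i"
  show "v \<in> V2 k"
  proof (rule V2I)
    show "v (A, B, s) = 0" if "length s \<noteq> k - 2" for s A B
      by (rule limit_eq[OF l tendsto_const]) (rule V2_supp[OF w that])
    show "v (A, B, s) = v (A, B, t)" if "mset s = mset t" for s t A B
      by (rule limit_eq[OF l l]) (rule V2_sym[OF w that])
    show "v (A, B, s) = - v (B, A, s)" for s A B
      by (rule limit_eq[OF l tendsto_minus[OF l]]) (rule V2_anti[OF w])
  qed
qed

interpretation V0: tuples "V0 k" "I0 k" for k by (rule tuples_V0)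
interpretation V1: tuples "V1 k" "I1 k" for k by (rule tuples_V1)
interpretation V2: tuples "V2 k" "I2 k" for k by (rule tuples_V2)

\<comment> \<open>An unprimed index is a pair, but is treated as an atomic object below.\<close>
declare split_paired_All [simp del] split_paired_Ex [simp del]

section \<open>Sums over symmetric tuples\<close>

lemma sum_lists_Suc: "(\<Sum>t | length t = Suc m. f t) = (\<Sum>a\<in>(UNIV::2 set). \<Sum>s | length s = m. f (a # s))"
proof -
  have "{t :: 2 list. length t = Suc m} = (\<lambda>(a, s). a # s) ` (UNIV \<times> {s. length s = m})"
    by (auto simp: image_iff length_Suc_conv)
  then have "(\<Sum>t | length t = Suc m. f t) = (\<Sum>p\<in>UNIV \<times> {s. length s = m}. f (fst p # snd p))"
    by (simp add: sum.reindex inj_on_def case_prod_beta)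
  then show ?thesis by (simp add: sum.cartesian_product case_prod_beta)
qed

text \<open>Symmetrisation over the positions of a symmetric tuple: each of the $m$ positions can be moved to the front, so
the sum over the entries of a tuple is $m$ times the contribution of its first entry. This carries every computation with adjoints.\<close>

lemma sum_count:
  fixes Q :: "2 \<Rightarrow> 2 list \<Rightarrow> complex"
  assumes "\<And>a s t. mset s = mset t \<Longrightarrow> Q a s = Q a t"
  shows "(\<Sum>t | length t = m. \<Sum>a\<in>UNIV. of_nat (count (mset t) a) * Q a t)
    = of_nat m * (\<Sum>a\<in>UNIV. \<Sum>s | length s = m - 1. Q a (a # s))"
  using assms
proof (induction m arbitrary: Q)
  case (Suc m)
  have IH: "(\<Sum>s | length s = m. \<Sum>a\<in>UNIV. of_nat (count (mset s) a) * Q a (b # s))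
      = of_nat m * (\<Sum>a\<in>UNIV. \<Sum>s | length s = m - 1. Q a (b # a # s))" for b
    by (rule Suc.IH) (rule Suc.prems, simp)
  have "(\<Sum>t | length t = Suc m. \<Sum>a\<in>UNIV. of_nat (count (mset t) a) * Q a t)
      = (\<Sum>b\<in>UNIV. \<Sum>s | length s = m. \<Sum>a\<in>UNIV. (if a = b then Q a (b # s) else 0) + of_nat (count (mset s) a) * Q a (b # s))"
    unfolding sum_lists_Suc by (intro sum.cong refl) (simp add: distrib_right)
  also have "\<dots> = (\<Sum>b\<in>UNIV. \<Sum>s | length s = m. Q b (b # s))
      + (\<Sum>b\<in>UNIV. of_nat m * (\<Sum>a\<in>UNIV. \<Sum>s | length s = m - 1. Q a (b # a # s)))"
    by (simp add: sum.distrib IH)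
  also have "(\<Sum>b\<in>UNIV. of_nat m * (\<Sum>a\<in>UNIV. \<Sum>s | length s = m - 1. Q a (b # a # s)))
      = of_nat m * (\<Sum>a\<in>UNIV. \<Sum>s | length s = m. Q a (a # s))"
  proof (cases m)
    case (Suc m')
    have "(\<Sum>b\<in>UNIV. \<Sum>a\<in>UNIV. \<Sum>s | length s = m'. Q a (b # a # s))
        = (\<Sum>a\<in>UNIV. \<Sum>b\<in>UNIV. \<Sum>s | length s = m'. Q a (a # b # s))"
      by (subst sum.swap) (intro sum.cong refl Suc.prems, simp)
    then show ?thesis unfolding Suc by (simp add: sum_lists_Suc sum_distrib_left[symmetric])
  qed simp
  finally show ?case by (simp add: algebra_simps)
next
  case 0
  show ?case by simp
qed

lemma sum_I1:
  fixes f :: "'n::finite idx1 \<Rightarrow> 'b::comm_monoid_add"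
  shows "(\<Sum>i\<in>I1 k. f i) = (\<Sum>A\<in>UNIV. \<Sum>s | length s = k - 1. f (s, A))"
proof -
  have "(I1 k :: 'n idx1 set) = {s. length s = k - 1} \<times> UNIV" by (auto simp: I1_def)
  from this have "(\<Sum>i\<in>I1 k. f i) = (\<Sum>s | length s = k - 1. \<Sum>A\<in>UNIV. f (s, A))"
    by (simp only: sum.cartesian_product')
  also have "\<dots> = (\<Sum>A\<in>UNIV. \<Sum>s | length s = k - 1. f (s, A))" by (rule sum.swap)
  finally show ?thesis .
qed

lemma sum_I2:
  fixes f :: "'n::finite idx2 \<Rightarrow> 'b::comm_monoid_add"
  shows "(\<Sum>i\<in>I2 k. f i) = (\<Sum>A\<in>UNIV. \<Sum>B\<in>UNIV. \<Sum>s | length s = k - 2. f (A, B, s))"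
proof -
  have "(I2 k :: 'n idx2 set) = UNIV \<times> UNIV \<times> {s. length s = k - 2}" by (auto simp: I2_def)
  then show ?thesis by (simp only: sum.cartesian_product')
qed

lemma pol_If: "(c \<Longrightarrow> pol d f) \<Longrightarrow> pol d (\<lambda>x. if c then f x else 0)"
  by (cases c) (auto intro: pol_zero)

section \<open>The operators on polynomial tuples\<close>

text \<open>Polynomial functions of degree less than $d$ with values in a space of tuples.\<close>

definition pV :: "('i \<Rightarrow> complex) set \<Rightarrow> nat \<Rightarrow> ('n::finite space \<Rightarrow> 'i \<Rightarrow> complex) \<Rightarrow> bool" where
  "pV V d F \<longleftrightarrow> (\<forall>x. F x \<in> V) \<and> (\<forall>i. pol d (\<lambda>x. F x i))"

lemma pV_pol: "pV V d F \<Longrightarrow> pol d (\<lambda>x. F x i)" by (simp add: pV_def)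
lemma pV_V: "pV V d F \<Longrightarrow> F x \<in> V" by (simp add: pV_def)

lemma pV_L2: "pV V d F \<Longrightarrow> F \<in> L2 ph V"
  by (auto simp: pV_def L2_iff intro: pol_sql2)

text \<open>The functions \<open>pD0\<close> and \<open>pD1\<close> are the classical versions of $\mathscr D_0$ and $\mathscr D_1$, while
\<open>pA0\<close> and \<open>pA1\<close> are the formulas for $\mathscr D_0^*$ and $\mathscr D_1^*$ that formal integration
by parts gives.\<close>

definition pD0 :: "nat \<Rightarrow> ('n::finite space \<Rightarrow> idx0 \<Rightarrow> complex) \<Rightarrow> 'n space \<Rightarrow> 'n idx1 \<Rightarrow> complex" where
  "pD0 k F x i = (case i of (s, A) \<Rightarrow>
     if length s = k - 1 then \<Sum>a\<in>UNIV. Z_up A a (\<lambda>y. F y (a # s)) x else 0)"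

definition pD1 :: "nat \<Rightarrow> ('n::finite space \<Rightarrow> 'n idx1 \<Rightarrow> complex) \<Rightarrow> 'n space \<Rightarrow> 'n idx2 \<Rightarrow> complex" where
  "pD1 k H x i = (case i of (A, B, s) \<Rightarrow>
     if length s = k - 2 then \<Sum>a\<in>UNIV. Z_up A a (\<lambda>y. H y (a # s, B)) x - Z_up B a (\<lambda>y. H y (a # s, A)) x else 0)"

text \<open>The adjoint of an operator that contracts the first primed index, averaged over the $k$ positions in
which that index may stand. Positions with equal indices contribute equally, so the average is written with multiplicities, which
makes its symmetry manifest.\<close>

definition pA0 :: "nat \<Rightarrow> ('n::finite space \<Rightarrow> 'n idx1 \<Rightarrow> complex) \<Rightarrow> 'n space \<Rightarrow> idx0 \<Rightarrow> complex" where
  "pA0 k G x t =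
     (if length t = k then \<Sum>a\<in>UNIV. (of_nat (count (mset t) a) / of_nat k) *
        (\<Sum>A\<in>UNIV. Z_adj A a (\<lambda>y. G y (remove1 a t, A)) x) else 0)"

text \<open>The factor $2$ comes from the two terms of $\mathscr D_1$, which contribute equally to a pairing with an
antisymmetric tuple.\<close>

definition pA1 :: "nat \<Rightarrow> ('n::finite space \<Rightarrow> 'n idx2 \<Rightarrow> complex) \<Rightarrow> 'n space \<Rightarrow> 'n idx1 \<Rightarrow> complex" where
  "pA1 k w x i = (case i of (t, B) \<Rightarrow>
     if length t = k - 1 then \<Sum>a\<in>UNIV. (2 * of_nat (count (mset t) a) / of_nat (k - 1)) *
        (\<Sum>A\<in>UNIV. Z_adj A a (\<lambda>y. w y (A, B, remove1 a t)) x) else 0)"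

lemma mset_remove1_cong: "mset s = mset t \<Longrightarrow> mset (remove1 a s) = mset (remove1 a t)"
  by simp

lemma pV_D0:
  assumes F: "pV (V0 k) (Suc d) F" shows "pV (V1 k) d (pD0 k F)"
  unfolding pV_def
proof (intro conjI allI)
  fix x show "pD0 k F x \<in> V1 k"
  proof (rule V1I)
    show "pD0 k F x (s, A) = 0" if "length s \<noteq> k - 1" for s A using that by (simp add: pD0_def)
    show "pD0 k F x (s, A) = pD0 k F x (t, A)" if "mset s = mset t" for s t A
    proof -
      have "F y (a # s) = F y (a # t)" for y a by (rule V0_sym[OF pV_V[OF F]]) (simp add: that)
      then show ?thesis using mset_eq_length[OF that] by (simp add: pD0_def)
    qed
  qed
  fix i show "pol d (\<lambda>x. pD0 k F x i)"
    by (cases i) (simp add: pD0_def, intro pol_If pol_sum pol_Z' pV_pol[OF F])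
qed

lemma pV_D1:
  assumes H: "pV (V1 k) (Suc d) H" shows "pV (V2 k) d (pD1 k H)"
  unfolding pV_def
proof (intro conjI allI)
  fix x show "pD1 k H x \<in> V2 k"
  proof (rule V2I)
    show "pD1 k H x (A, B, s) = 0" if "length s \<noteq> k - 2" for s A B using that by (simp add: pD1_def)
    show "pD1 k H x (A, B, s) = pD1 k H x (A, B, t)" if "mset s = mset t" for s t A B
    proof -
      have "H y (a # s, A) = H y (a # t, A)" for y a A by (rule V1_sym[OF pV_V[OF H]]) (simp add: that)
      then show ?thesis using mset_eq_length[OF that] by (simp add: pD1_def)
    qed
    show "pD1 k H x (A, B, s) = - pD1 k H x (B, A, s)" for A B s
      by (simp add: pD1_def sum_negf[symmetric])
  qed
  fix i show "pol d (\<lambda>x. pD1 k H x i)"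
    by (cases i rule: prod_cases3) (simp add: pD1_def, intro pol_If pol_sum pol_diff pol_Z' pV_pol[OF H])
qed

lemma pV_A0:
  assumes G: "pV (V1 k) d G" shows "pV (V0 k) (Suc d) (pA0 k G)"
  unfolding pV_def
proof (intro conjI allI)
  fix x show "pA0 k G x \<in> V0 k"
  proof (rule V0I)
    show "pA0 k G x s = 0" if "length s \<noteq> k" for s using that by (simp add: pA0_def)
    show "pA0 k G x s = pA0 k G x t" if "mset s = mset t" for s t
    proof -
      have "G y (remove1 a s, A) = G y (remove1 a t, A)" for y a A
        by (rule V1_sym[OF pV_V[OF G] mset_remove1_cong[OF that]])
      then show ?thesis using mset_eq_length[OF that] that by (simp add: pA0_def)
    qed
  qed
  fix t show "pol (Suc d) (\<lambda>x. pA0 k G x t)"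
    unfolding pA0_def by (intro pol_If pol_sum pol_scale pol_Z_adj pV_pol[OF G])
qed

lemma pV_A1:
  assumes w: "pV (V2 k) d w" shows "pV (V1 k) (Suc d) (pA1 k w)"
  unfolding pV_def
proof (intro conjI allI)
  fix x show "pA1 k w x \<in> V1 k"
  proof (rule V1I)
    show "pA1 k w x (s, B) = 0" if "length s \<noteq> k - 1" for s B using that by (simp add: pA1_def)
    show "pA1 k w x (s, B) = pA1 k w x (t, B)" if "mset s = mset t" for s t B
    proof -
      have "w y (A, B, remove1 a s) = w y (A, B, remove1 a t)" for y a A
        by (rule V2_sym[OF pV_V[OF w] mset_remove1_cong[OF that]])
      then show ?thesis using mset_eq_length[OF that] that by (simp add: pA1_def)
    qed
  qed
  fix i show "pol (Suc d) (\<lambda>x. pA1 k w x i)"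
    by (cases i) (simp only: pA1_def prod.case, intro pol_If pol_sum pol_scale pol_Z_adj pV_pol[OF w])
qed

section \<open>Polynomial tuples in the graphs of the operators\<close>

lemma D0_iff: "(f, g) \<in> D0 ph k \<longleftrightarrow> f \<in> L2 ph (V0 k) \<and> g \<in> L2 ph (V1 k) \<and>
   (\<forall>s A \<eta>. length s = k - 1 \<longrightarrow> test_fun \<eta> \<longrightarrow>
      (\<Sum>a\<in>UNIV. (- 1) * (LINT x|lborel. f x (a # s) * Z_up A a \<eta> x)) = (LINT x|lborel. g x (s, A) * \<eta> x))"
  unfolding D0_def Z_distr_def distr_of_def I1_def by auto

lemma D1_iff: "(h, g) \<in> D1 ph k \<longleftrightarrow> h \<in> L2 ph (V1 k) \<and> g \<in> L2 ph (V2 k) \<and>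
   (\<forall>A B s \<eta>. length s = k - 2 \<longrightarrow> test_fun \<eta> \<longrightarrow>
      (\<Sum>a\<in>UNIV. (LINT x|lborel. h x (a # s, A) * Z_up B a \<eta> x) - (LINT x|lborel. h x (a # s, B) * Z_up A a \<eta> x))
        = (LINT x|lborel. g x (A, B, s) * \<eta> x))"
  unfolding D1_def Z_distr_def distr_of_def I2_def by auto

lemma test_integrable:
  assumes t: "test_fun \<eta>" and p: "pol d p" shows "integrable lborel (\<lambda>x. p x * \<eta> x)"
proof -
  obtain R where R: "R > 0" "\<And>x. norm x > R \<Longrightarrow> \<eta> x = 0" by (metis test_fun_supp[OF t])
  show ?thesis
    by (rule continuous_supp_integrable[OF continuous_on_mult[OF pol_continuous[OF p] test_fun_continuous(1)[OF t]], of R])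
      (simp add: R(2))
qed

lemma pD0_in_D0:
  assumes F: "pV (V0 k) (Suc d) F" shows "(F, pD0 k F) \<in> D0 ph k"
  unfolding D0_iff
proof (intro conjI allI impI pV_L2[OF F] pV_L2[OF pV_D0[OF F]])
  fix s A and \<eta> :: "'a space \<Rightarrow> complex" assume s: "length (s :: 2 list) = k - 1" and t: "test_fun \<eta>"
  have "(\<Sum>a\<in>UNIV. (- 1) * (LINT x|lborel. F x (a # s) * Z_up A a \<eta> x))
      = (\<Sum>a\<in>UNIV. LINT x|lborel. Z_up A a (\<lambda>x. F x (a # s)) x * \<eta> x)"
    by (simp add: pol_test_Z[OF pV_pol[OF F] t])
  also have "\<dots> = (LINT x|lborel. (\<Sum>a\<in>UNIV. Z_up A a (\<lambda>x. F x (a # s)) x * \<eta> x))"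
    by (subst Bochner_Integration.integral_sum) (auto intro: test_integrable[OF t] pol_Z pV_pol[OF F])
  finally show "(\<Sum>a\<in>UNIV. (- 1) * (LINT x|lborel. F x (a # s) * Z_up A a \<eta> x)) = (LINT x|lborel. pD0 k F x (s, A) * \<eta> x)"
    by (simp add: pD0_def s sum_distrib_right)
qed

lemma pD1_in_D1:
  assumes H: "pV (V1 k) (Suc d) H" shows "(H, pD1 k H) \<in> D1 ph k"
  unfolding D1_iff
proof (intro conjI allI impI pV_L2[OF H] pV_L2[OF pV_D1[OF H]])
  fix s A B and \<eta> :: "'a space \<Rightarrow> complex" assume s: "length (s :: 2 list) = k - 2" and t: "test_fun \<eta>"
  have int: "integrable lborel (\<lambda>x. Z_up C a (\<lambda>x. H x (a # s, B)) x * \<eta> x)" for a C B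
    by (rule test_integrable[OF t pol_Z[OF pV_pol[OF H]]])
  have "(\<Sum>a\<in>UNIV. (LINT x|lborel. H x (a # s, A) * Z_up B a \<eta> x) - (LINT x|lborel. H x (a # s, B) * Z_up A a \<eta> x))
      = (\<Sum>a\<in>UNIV. (LINT x|lborel. Z_up A a (\<lambda>x. H x (a # s, B)) x * \<eta> x) - (LINT x|lborel. Z_up B a (\<lambda>x. H x (a # s, A)) x * \<eta> x))"
    by (simp add: pol_test_Z[OF pV_pol[OF H] t])
  also have "\<dots> = (LINT x|lborel. (\<Sum>a\<in>UNIV. Z_up A a (\<lambda>x. H x (a # s, B)) x * \<eta> x - Z_up B a (\<lambda>x. H x (a # s, A)) x * \<eta> x))"
    by (subst Bochner_Integration.integral_sum) (auto intro!: int Bochner_Integration.integrable_diff simp: Bochner_Integration.integral_diff int)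
  finally show "(\<Sum>a\<in>UNIV. (LINT x|lborel. H x (a # s, A) * Z_up B a \<eta> x) - (LINT x|lborel. H x (a # s, B) * Z_up A a \<eta> x))
      = (LINT x|lborel. pD1 k H x (A, B, s) * \<eta> x)"
    by (simp add: pD1_def s sum_distrib_right left_diff_distrib)
qed

lemma D0_test_pol:
  assumes "(f, g) \<in> D0 ph k" "length s = k - 1" "pol d p"
  shows "sip (\<lambda>x. g x (s, A)) p = (\<Sum>a\<in>UNIV. sip (\<lambda>x. f x (a # s)) (Z_adj A a p))"
proof -
  have "(\<Sum>a\<in>UNIV. (- 1) * sip (\<lambda>x. f x (a # s)) (Z_adj A a p)) = - sip (\<lambda>x. g x (s, A)) p"
    by (rule test_identity_extends[OF _ _ _ assms(3)])
      (use assms(1,2) in \<open>auto simp: D0_iff L2_iff\<close>)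
  then show ?thesis by (simp add: sum_negf)
qed

lemma D1_test_pol:
  assumes "(h, g) \<in> D1 ph k" "length s = k - 2" "pol d p"
  shows "sip (\<lambda>x. g x (A, B, s)) p = (\<Sum>a\<in>UNIV. sip (\<lambda>x. h x (a # s, B)) (Z_adj A a p) - sip (\<lambda>x. h x (a # s, A)) (Z_adj B a p))"
proof -
  let ?f = "\<lambda>(a, b) x. h x (a # s, if b then B else A)" and ?c = "\<lambda>(a::2, b). if b then - 1 else 1 :: complex"
  let ?A = "\<lambda>(a::2, b). if b then A else B"
  have split: "(\<Sum>r\<in>UNIV. G r) = (\<Sum>a\<in>UNIV. G (a, False) + G (a, True))" for G :: "2 \<times> bool \<Rightarrow> complex"
    by (simp add: UNIV_Times_UNIV[symmetric] sum.cartesian_product' UNIV_bool del: UNIV_Times_UNIV)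
  have "(\<Sum>r\<in>UNIV. ?c r * sip (?f r) (Z_adj (?A r) (fst r) p)) = - sip (\<lambda>x. g x (A, B, s)) p"
  proof (rule test_identity_extends[OF _ _ _ assms(3)])
    show "sql2 (?f r)" for r using assms(1) by (cases r) (auto simp: D1_iff L2_iff)
    show "sql2 (\<lambda>x. g x (A, B, s))" using assms(1) by (auto simp: D1_iff L2_iff)
    fix \<eta> :: "'a space \<Rightarrow> complex" assume "test_fun \<eta>"
    then show "(\<Sum>r\<in>UNIV. ?c r * (LINT x|lborel. ?f r x * Z_up (?A r) (fst r) \<eta> x)) = (LINT x|lborel. g x (A, B, s) * \<eta> x)"
      using assms(1,2) unfolding split by (simp add: D1_iff)
  qed
  then have "- sip (\<lambda>x. g x (A, B, s)) p = - (\<Sum>a\<in>UNIV. sip (\<lambda>x. h x (a # s, B)) (Z_adj A a p) - sip (\<lambda>x. h x (a # s, A)) (Z_adj B a p))"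
    unfolding split by (simp add: sum_negf[symmetric])
  then show ?thesis by (simp only: neg_equal_iff_equal)
qed

text \<open>Every pairing with a polynomial tuple reduces to its entries, where the distributional equation can be tested. The
symmetrisation in the adjoint is removed by \<open>sum_count\<close>.\<close>

lemma pA0_in_adj:
  fixes G :: "'n::finite space \<Rightarrow> 'n idx1 \<Rightarrow> complex"
  assumes G: "pV (V1 k) d G" and k: "k \<ge> 1" shows "(G, pA0 k G) \<in> D0_adj ph k"
  unfolding D0_adj_def
proof (clarify, intro conjI pV_L2[OF G] pV_L2[OF pV_A0[OF G]] ballI, clarify)
  fix f and Df :: "'n space \<Rightarrow> 'n idx1 \<Rightarrow> complex" assume D: "(f, Df) \<in> D0 ph k"
  then have f: "f \<in> L2 ph (V0 k)" and Df: "Df \<in> L2 ph (V1 k)" by (auto simp: D0_iff)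
  have sW: "sql2 (Z_adj A a (\<lambda>y. G y i))" for A a i by (rule pol_sql2[OF pol_Z_adj[OF pV_pol[OF G]]])
  define Q where "Q a t = (\<Sum>A\<in>UNIV. sip (\<lambda>x. f x t) (Z_adj A a (\<lambda>y. G y (remove1 a t, A))))" for a t
  have Q: "Q a s = Q a t" if "mset s = mset t" for a s t
  proof -
    have "f x s = f x t" for x using f by (intro V0_sym[OF _ that]) (auto simp: L2_iff)
    moreover have "G y (remove1 a s, A) = G y (remove1 a t, A)" for y A
      by (rule V1_sym[OF pV_V[OF G] mset_remove1_cong[OF that]])
    ultimately show ?thesis by (simp add: Q_def)
  qed
  have "ip ph (I0 k) f (pA0 k G) = (\<Sum>t | length t = k. sip (\<lambda>x. f x t) (\<lambda>x. pA0 k G x t))"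
    by (subst V0.ip_eq[OF f pV_L2[OF pV_A0[OF G]]]) (simp add: I0_def)
  also have "\<dots> = (\<Sum>t | length t = k. \<Sum>a\<in>UNIV. of_nat (count (mset t) a) / of_nat k * Q a t)"
  proof (intro sum.cong refl)
    fix t :: "2 list" assume "t \<in> {t. length t = k}"
    then have t: "length t = k" by simp
    have "sip (\<lambda>x. f x t) (\<lambda>x. pA0 k G x t) = (\<Sum>a\<in>UNIV. sip (\<lambda>x. f x t)
        (\<lambda>x. of_nat (count (mset t) a) / of_nat k * (\<Sum>A\<in>UNIV. Z_adj A a (\<lambda>y. G y (remove1 a t, A)) x)))"
      unfolding pA0_def if_P[OF t]
      by (intro sip_sum_right sql2_sum sql2_scale sW V0.L2_sql2[OF f])
    also have "\<dots> = (\<Sum>a\<in>UNIV. of_nat (count (mset t) a) / of_nat k * Q a t)"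
      unfolding sip_scale_right Q_def
      by (subst sip_sum_right) (auto intro!: sW V0.L2_sql2[OF f])
    finally show "sip (\<lambda>x. f x t) (\<lambda>x. pA0 k G x t) = (\<Sum>a\<in>UNIV. of_nat (count (mset t) a) / of_nat k * Q a t)" .
  qed
  also have "\<dots> = (\<Sum>t | length t = k. \<Sum>a\<in>UNIV. of_nat (count (mset t) a) * Q a t) / of_nat k"
    by (simp add: sum_divide_distrib)
  also have "\<dots> = (\<Sum>a\<in>UNIV. \<Sum>s | length s = k - 1. Q a (a # s))"
    using k by (simp add: sum_count[OF Q])
  also have "\<dots> = (\<Sum>A\<in>UNIV. \<Sum>s | length s = k - 1. \<Sum>a\<in>UNIV. sip (\<lambda>x. f x (a # s)) (Z_adj A a (\<lambda>y. G y (s, A))))"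
  proof -
    have "(\<Sum>a\<in>UNIV. \<Sum>s | length s = k - 1. Q a (a # s))
      = (\<Sum>s | length s = k - 1. \<Sum>a\<in>UNIV. \<Sum>A\<in>UNIV. sip (\<lambda>x. f x (a # s)) (Z_adj A a (\<lambda>y. G y (s, A))))"
      unfolding Q_def by (subst sum.swap) simp
    also have "\<dots> = (\<Sum>s | length s = k - 1. \<Sum>A\<in>UNIV. \<Sum>a\<in>UNIV. sip (\<lambda>x. f x (a # s)) (Z_adj A a (\<lambda>y. G y (s, A))))"
      by (intro sum.cong refl sum.swap)
    finally show ?thesis by (subst (2) sum.swap)
  qed
  also have "\<dots> = ip ph (I1 k) Df G"
    unfolding V1.ip_eq[OF Df pV_L2[OF G]] sum_I1
    by (intro sum.cong refl D0_test_pol[OF D _ pV_pol[OF G], symmetric]) auto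
  finally show "ip ph (I1 k) Df G = ip ph (I0 k) f (pA0 k G)" by simp
qed

lemma pA1_in_adj:
  fixes w :: "'n::finite space \<Rightarrow> 'n idx2 \<Rightarrow> complex"
  assumes w: "pV (V2 k) d w" and k: "k \<ge> 2" shows "(w, pA1 k w) \<in> D1_adj ph k"
  unfolding D1_adj_def
proof (clarify, intro conjI pV_L2[OF w] pV_L2[OF pV_A1[OF w]] ballI, clarify)
  fix h and Dh :: "'n space \<Rightarrow> 'n idx2 \<Rightarrow> complex" assume D: "(h, Dh) \<in> D1 ph k"
  then have h: "h \<in> L2 ph (V1 k)" and Dh: "Dh \<in> L2 ph (V2 k)" by (auto simp: D1_iff)
  have sW: "sql2 (Z_adj A a (\<lambda>y. w y i))" for A a i by (rule pol_sql2[OF pol_Z_adj[OF pV_pol[OF w]]])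
  have hV: "h x \<in> V1 k" for x using h by (simp add: L2_iff)
  define R where "R A B s a = sip (\<lambda>x. h x (a # s, B)) (Z_adj A a (\<lambda>y. w y (A, B, s)))" for A B s a
  define Q where "Q B a t = (\<Sum>A\<in>UNIV. sip (\<lambda>x. h x (t, B)) (Z_adj A a (\<lambda>y. w y (A, B, remove1 a t))))" for B a t
  have Q: "Q B a s = Q B a t" if "mset s = mset t" for B a s t
  proof -
    have "h x (s, B) = h x (t, B)" for x by (rule V1_sym[OF hV that])
    moreover have "w y (A, B, remove1 a s) = w y (A, B, remove1 a t)" for y A
      by (rule V2_sym[OF pV_V[OF w] mset_remove1_cong[OF that]])
    ultimately show ?thesis by (simp add: Q_def)
  qed
  have "ip ph (I1 k) h (pA1 k w) = (\<Sum>B\<in>UNIV. \<Sum>t | length t = k - 1. sip (\<lambda>x. h x (t, B)) (\<lambda>x. pA1 k w x (t, B)))"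
    by (subst V1.ip_eq[OF h pV_L2[OF pV_A1[OF w]]]) (rule sum_I1)
  also have "\<dots> = (\<Sum>B\<in>UNIV. \<Sum>t | length t = k - 1. \<Sum>a\<in>UNIV. 2 * of_nat (count (mset t) a) / of_nat (k - 1) * Q B a t)"
  proof (intro sum.cong refl)
    fix t :: "2 list" and B assume "t \<in> {t. length t = k - 1}"
    then have t: "length t = k - 1" by simp
    have "sip (\<lambda>x. h x (t, B)) (\<lambda>x. pA1 k w x (t, B)) = (\<Sum>a\<in>UNIV. sip (\<lambda>x. h x (t, B))
        (\<lambda>x. 2 * of_nat (count (mset t) a) / of_nat (k - 1) * (\<Sum>A\<in>UNIV. Z_adj A a (\<lambda>y. w y (A, B, remove1 a t)) x)))"
      unfolding pA1_def prod.case if_P[OF t]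
      by (intro sip_sum_right sql2_sum sql2_scale sW V1.L2_sql2[OF h])
    also have "\<dots> = (\<Sum>a\<in>UNIV. 2 * of_nat (count (mset t) a) / of_nat (k - 1) * Q B a t)"
      unfolding sip_scale_right Q_def
      by (subst sip_sum_right) (auto intro!: sW V1.L2_sql2[OF h])
    finally show "sip (\<lambda>x. h x (t, B)) (\<lambda>x. pA1 k w x (t, B))
        = (\<Sum>a\<in>UNIV. 2 * of_nat (count (mset t) a) / of_nat (k - 1) * Q B a t)" .
  qed
  also have "\<dots> = (\<Sum>B\<in>UNIV. 2 / of_nat (k - 1) * (\<Sum>t | length t = k - 1. \<Sum>a\<in>UNIV. of_nat (count (mset t) a) * Q B a t))"
    by (simp add: sum_distrib_left mult.assoc)
  also have "\<dots> = (\<Sum>B\<in>UNIV. 2 * (\<Sum>a\<in>UNIV. \<Sum>s | length s = k - 2. Q B a (a # s)))"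
  proof (intro sum.cong refl)
    fix B
    have "(\<Sum>t | length t = k - 1. \<Sum>a\<in>UNIV. of_nat (count (mset t) a) * Q B a t)
        = of_nat (k - 1) * (\<Sum>a\<in>UNIV. \<Sum>s | length s = k - 1 - 1. Q B a (a # s))"
      by (rule sum_count[OF Q])
    moreover have "(of_nat (k - 1) :: complex) \<noteq> 0" using k by (simp del: of_nat_diff)
    ultimately show "2 / of_nat (k - 1) * (\<Sum>t | length t = k - 1. \<Sum>a\<in>UNIV. of_nat (count (mset t) a) * Q B a t)
        = 2 * (\<Sum>a\<in>UNIV. \<Sum>s | length s = k - 2. Q B a (a # s))"
      by (simp add: numeral_2_eq_2 del: of_nat_diff)
  qed
  also have "\<dots> = 2 * (\<Sum>B\<in>UNIV. \<Sum>a\<in>UNIV. \<Sum>s | length s = k - 2. \<Sum>A\<in>UNIV. R A B s a)"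
    by (simp add: sum_distrib_left Q_def R_def)
  also have "(\<Sum>B\<in>UNIV. \<Sum>a\<in>UNIV. \<Sum>s | length s = k - 2. \<Sum>A\<in>UNIV. R A B s a)
     = (\<Sum>A\<in>UNIV. \<Sum>B\<in>UNIV. \<Sum>s | length s = k - 2. \<Sum>a\<in>UNIV. R A B s a)"
  proof -
    have "(\<Sum>a\<in>UNIV. \<Sum>s | length s = k - 2. \<Sum>A\<in>UNIV. R A B s a)
        = (\<Sum>A\<in>UNIV. \<Sum>s | length s = k - 2. \<Sum>a\<in>UNIV. R A B s a)" for B
    proof -
      have "(\<Sum>a\<in>UNIV. \<Sum>s | length s = k - 2. \<Sum>A\<in>UNIV. R A B s a)
        = (\<Sum>a\<in>UNIV. \<Sum>A\<in>UNIV. \<Sum>s | length s = k - 2. R A B s a)"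
        by (intro sum.cong refl sum.swap)
      also have "\<dots> = (\<Sum>A\<in>UNIV. \<Sum>a\<in>UNIV. \<Sum>s | length s = k - 2. R A B s a)" by (rule sum.swap)
      also have "\<dots> = (\<Sum>A\<in>UNIV. \<Sum>s | length s = k - 2. \<Sum>a\<in>UNIV. R A B s a)"
        by (intro sum.cong refl sum.swap)
      finally show ?thesis .
    qed
    then show ?thesis by (simp only:) (rule sum.swap)
  qed
  finally have 1: "ip ph (I1 k) h (pA1 k w) = 2 * (\<Sum>A\<in>UNIV. \<Sum>B\<in>UNIV. \<Sum>s | length s = k - 2. \<Sum>a\<in>UNIV. R A B s a)" .
  have "ip ph (I2 k) Dh w = (\<Sum>A\<in>UNIV. \<Sum>B\<in>UNIV. \<Sum>s | length s = k - 2. sip (\<lambda>x. Dh x (A, B, s)) (\<lambda>x. w x (A, B, s)))"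
    by (subst V2.ip_eq[OF Dh pV_L2[OF w]]) (rule sum_I2)
  also have "\<dots> = (\<Sum>A\<in>UNIV. \<Sum>B\<in>UNIV. \<Sum>s | length s = k - 2. (\<Sum>a\<in>UNIV. R A B s a) + (\<Sum>a\<in>UNIV. R B A s a))"
  proof (intro sum.cong refl)
    fix A B and s :: "2 list" assume "s \<in> {s. length s = k - 2}"
    then have s: "length s = k - 2" by simp
    have "sip (\<lambda>x. h x (a # s, A)) (Z_adj B a (\<lambda>x. w x (A, B, s))) = - R B A s a" for a
    proof -
      have "(\<lambda>x. w x (A, B, s)) = (\<lambda>x. (- 1) * w x (B, A, s))"
        using V2_anti[OF pV_V[OF w], of _ A B s] by simp
      then have "Z_adj B a (\<lambda>x. w x (A, B, s)) = (\<lambda>x. (- 1) * Z_adj B a (\<lambda>x. w x (B, A, s)) x)"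
        by (simp only:) (rule ext, rule Z_adj_scale[OF pV_pol[OF w]])
      then show ?thesis by (simp only: sip_scale_right R_def) simp
    qed
    then show "sip (\<lambda>x. Dh x (A, B, s)) (\<lambda>x. w x (A, B, s)) = (\<Sum>a\<in>UNIV. R A B s a) + (\<Sum>a\<in>UNIV. R B A s a)"
      unfolding D1_test_pol[OF D s pV_pol[OF w]] R_def by (simp add: sum.distrib[symmetric])
  qed
  also have "\<dots> = 2 * (\<Sum>A\<in>UNIV. \<Sum>B\<in>UNIV. \<Sum>s | length s = k - 2. \<Sum>a\<in>UNIV. R A B s a)"
  proof -
    have "(\<Sum>A\<in>UNIV. \<Sum>B\<in>UNIV. \<Sum>s | length s = k - 2. \<Sum>a\<in>UNIV. R B A s a)
       = (\<Sum>A\<in>UNIV. \<Sum>B\<in>UNIV. \<Sum>s | length s = k - 2. \<Sum>a\<in>UNIV. R A B s a)" by (rule sum.swap)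
    then show ?thesis by (simp add: sum.distrib)
  qed
  finally show "ip ph (I2 k) Dh w = ip ph (I1 k) h (pA1 k w)" using 1 by simp
qed

section \<open>The basic estimate\<close>

text \<open>The fields commute, and the two primed indices that are contracted are symmetric.\<close>

lemma pD1_pD0:
  fixes v :: "'n::finite space \<Rightarrow> idx0 \<Rightarrow> complex"
  assumes v: "pV (V0 k) (Suc d) v" and k: "k \<ge> 2"
  shows "pD1 k (pD0 k v) = (\<lambda>x i. 0)"
proof (intro ext)
  fix x and i :: "'n idx2"
  obtain A B s where i: "i = (A, B, s)" by (cases i rule: prod_cases3)
  show "pD1 k (pD0 k v) x i = 0"
  proof (cases "length s = k - 2")
    case True
    then have l: "length (a # s) = k - 1" for a using k by simp
    have e: "(\<lambda>y. pD0 k v y (a # s, C)) = (\<lambda>y. \<Sum>b\<in>UNIV. Z_up C b (\<lambda>z. v z (b # a # s)) y)" for a C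
      using l[of a] by (simp add: pD0_def)
    have z: "Z_up A a (\<lambda>y. pD0 k v y (a # s, B)) x = (\<Sum>b\<in>UNIV. Z_up A a (Z_up B b (\<lambda>z. v z (b # a # s))) x)" for A B a
      unfolding e by (rule Z_sum) (rule pol_Z'[OF pV_pol[OF v]])
    have "(\<Sum>a\<in>UNIV. Z_up B a (\<lambda>y. pD0 k v y (a # s, A)) x)
        = (\<Sum>b\<in>UNIV. \<Sum>a\<in>UNIV. Z_up B b (Z_up A a (\<lambda>z. v z (a # b # s))) x)"
      by (simp add: z)
    also have "\<dots> = (\<Sum>b\<in>UNIV. \<Sum>a\<in>UNIV. Z_up A a (Z_up B b (\<lambda>z. v z (b # a # s))) x)"
    proof (intro sum.cong refl)
      fix a b :: 2
      have "(\<lambda>z. v z (a # b # s)) = (\<lambda>z. v z (b # a # s))"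
        by (intro ext V0_sym[OF pV_V[OF v]]) simp
      then show "Z_up B b (Z_up A a (\<lambda>z. v z (a # b # s))) x = Z_up A a (Z_up B b (\<lambda>z. v z (b # a # s))) x"
        by (simp add: Z_commute[OF pV_pol[OF v], of B b A a])
    qed
    also have "\<dots> = (\<Sum>a\<in>UNIV. Z_up A a (\<lambda>y. pD0 k v y (a # s, B)) x)"
      unfolding z by (rule sum.swap)
    finally show ?thesis by (simp add: i pD1_def True sum_subtractf)
  qed (simp add: i pD1_def)
qed

text \<open>Annihilation operators are traded for creation operators at the cost of the commutator.\<close>

lemma sip_Z_Z:
  assumes p: "pol d p" and q: "pol e q"
  shows "sip (Z_up A a p) (Z_up B b q) = sip (Z_adj B b p) (Z_adj A a q) - (if A = B \<and> a = b then 8 * sip p q else 0)"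
proof -
  have "sip (Z_up A a p) (Z_up B b q) = sip p (Z_adj A a (Z_up B b q))"
    by (rule sip_Z_adj[OF p pol_Z[OF q]])
  also have "Z_adj A a (Z_up B b q) = (\<lambda>x. Z_up B b (Z_adj A a q) x - (if A = B \<and> a = b then 8 else 0) * q x)"
    by (rule ext) (auto simp: Z_adj_commutator[OF q])
  also have "sip p \<dots> = sip p (Z_up B b (Z_adj A a q)) - (if A = B \<and> a = b then 8 * sip p q else 0)"
    by (subst sip_diff_right[OF pol_sql2[OF pol_Z[OF pol_Z_adj[OF q]]] sql2_scale[OF pol_sql2[OF q]] pol_sql2[OF p]])
      (auto simp: sip_scale_right)
  also have "sip p (Z_up B b (Z_adj A a q)) = cnj (sip (Z_up B b (Z_adj A a q)) p)" by (rule sip_cnj)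
  also have "\<dots> = cnj (sip (Z_adj A a q) (Z_adj B b p))" by (subst sip_Z_adj[OF pol_Z_adj[OF q] p]) (rule refl)
  also have "\<dots> = sip (Z_adj B b p) (Z_adj A a q)" by (rule sip_cnj[symmetric])
  finally show ?thesis .
qed

text \<open>Write $G_{a,t} = \sum_B (Z_B^{a})^* h_{t,B}$ and $S = \sum \langle G_{b,as}, G_{a,bs}\rangle$. Expanding
the antisymmetrisation and commuting gives
$\|\mathscr D_1 h\|^2 = 2\|\sum_{a} Z_A^{a} h_{as,B}\|^2 - 2S + 16\|h\|^2$,
and since $\mathscr D_0^* h$ is the symmetrisation of $G$, $k\,\|\mathscr D_0^* h\|^2 = \|G\|^2 + (k-1)S$. So
$S$ is at most $\frac{k}{k-1}\|\mathscr D_0^*h\|^2 \le 2\|\mathscr D_0^*h\|^2$.\<close>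

theorem basic_estimate:
  fixes H :: "'n::finite space \<Rightarrow> 'n idx1 \<Rightarrow> complex"
  assumes H: "pV (V1 k) (Suc d) H" and k: "k \<ge> 2"
  shows "16 * tnsq (I1 k) H \<le> tnsq (I2 k) (pD1 k H) + 4 * tnsq (I0 k) (pA0 k H)"
proof -
  define L where "L = {s :: 2 list. length s = k - 2}"
  define h where "h t B = (\<lambda>x. H x (t, B))" for t B
  define G where "G a t = (\<lambda>x. \<Sum>B\<in>UNIV. Z_adj B a (h t B) x)" for a t
  define X where "X A B s = (\<lambda>x. \<Sum>a\<in>UNIV. Z_up A a (h (a # s) B) x)" for A B s
  define S where "S = (\<Sum>a\<in>UNIV. \<Sum>b\<in>UNIV. \<Sum>s\<in>L. sip (G b (a # s)) (G a (b # s)))"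
  define N where "N = (\<Sum>A\<in>UNIV. \<Sum>B\<in>UNIV. \<Sum>s\<in>L. nsq (X A B s))"
  define M where "M = (\<Sum>a\<in>UNIV. \<Sum>t | length t = k - 1. nsq (G a t))"
  have polh: "pol (Suc d) (h t B)" for t B unfolding h_def by (rule pV_pol[OF H])
  have pZ: "pol d (Z_up A a (h t B))" for A a t B by (rule pol_Z'[OF polh])
  have pW: "pol (Suc (Suc d)) (Z_adj A a (h t B))" for A a t B by (rule pol_Z_adj[OF polh])
  have pG: "pol (Suc (Suc d)) (G a t)" for a t unfolding G_def by (intro pol_sum pW)
  have pX: "pol d (X A B s)" for A B s unfolding X_def by (intro pol_sum pZ)
  note sqs = pol_sql2[OF polh] pol_sql2[OF pZ] pol_sql2[OF pW] pol_sql2[OF pG] pol_sql2[OF pX]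
  have hsym: "h s B = h t B" if "mset s = mset t" for s t B
    unfolding h_def by (intro ext V1_sym[OF pV_V[OF H] that])
  have Gsym: "G a s = G a t" if "mset s = mset t" for a s t
    unfolding G_def hsym[OF that] by (rule refl)
  have k1: "k - 1 = Suc (k - 2)" using k by simp
  have tnH: "complex_of_real (tnsq (I1 k) H) = (\<Sum>A\<in>UNIV. \<Sum>a\<in>UNIV. \<Sum>s\<in>L. sip (h (a # s) A) (h (a # s) A))"
    unfolding tnsq_def sum_I1 h_def L_def k1 sum_lists_Suc by (simp add: sip_self)
  \<comment> \<open>Expansion of the antisymmetrisation in the definition of the second operator.\<close>
  have one: "complex_of_real (tnsq (I2 k) (pD1 k H)) = 2 * complex_of_real N
      - 2 * (\<Sum>A\<in>UNIV. \<Sum>B\<in>UNIV. \<Sum>s\<in>L. sip (X A B s) (X B A s))"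
  proof -
    have "complex_of_real (nsq (\<lambda>x. pD1 k H x (A, B, s))) =
        (sip (X A B s) (X A B s) + sip (X B A s) (X B A s)) - (sip (X A B s) (X B A s) + sip (X B A s) (X A B s))"
      if "s \<in> L" for A B s
    proof -
      have "(\<lambda>x. pD1 k H x (A, B, s)) = (\<lambda>x. X A B s x - X B A s x)"
        using that by (simp add: pD1_def X_def h_def L_def sum_subtractf)
      then show ?thesis
        unfolding sip_self[symmetric]
        by (simp add: sip_diff_left sip_diff_right sql2_diff sqs)
    qed
    then have "complex_of_real (tnsq (I2 k) (pD1 k H)) =
        (\<Sum>A\<in>UNIV. \<Sum>B\<in>UNIV. \<Sum>s\<in>L. (sip (X A B s) (X A B s) + sip (X B A s) (X B A s))
            - (sip (X A B s) (X B A s) + sip (X B A s) (X A B s)))"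
      unfolding tnsq_def sum_I2 L_def[symmetric] of_real_sum by (intro sum.cong refl) auto
    also have "\<dots> = (\<Sum>A\<in>UNIV. \<Sum>B\<in>UNIV. \<Sum>s\<in>L. sip (X A B s) (X A B s))
        + (\<Sum>A\<in>UNIV. \<Sum>B\<in>UNIV. \<Sum>s\<in>L. sip (X B A s) (X B A s))
        - ((\<Sum>A\<in>UNIV. \<Sum>B\<in>UNIV. \<Sum>s\<in>L. sip (X A B s) (X B A s))
          + (\<Sum>A\<in>UNIV. \<Sum>B\<in>UNIV. \<Sum>s\<in>L. sip (X B A s) (X A B s)))"
      by (simp only: sum.distrib sum_subtractf)
    also have "(\<Sum>A\<in>UNIV. \<Sum>B\<in>UNIV. \<Sum>s\<in>L. sip (X B A s) (X B A s))
        = (\<Sum>A\<in>UNIV. \<Sum>B\<in>UNIV. \<Sum>s\<in>L. sip (X A B s) (X A B s))" by (rule sum.swap)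
    also have "(\<Sum>A\<in>UNIV. \<Sum>B\<in>UNIV. \<Sum>s\<in>L. sip (X B A s) (X A B s))
        = (\<Sum>A\<in>UNIV. \<Sum>B\<in>UNIV. \<Sum>s\<in>L. sip (X A B s) (X B A s))" by (rule sum.swap)
    finally show ?thesis by (simp add: N_def sip_self)
  qed
  \<comment> \<open>The mixed terms, with annihilation operators replaced by creation operators.\<close>
  have two: "(\<Sum>A\<in>UNIV. \<Sum>B\<in>UNIV. \<Sum>s\<in>L. sip (X A B s) (X B A s)) = S - 8 * complex_of_real (tnsq (I1 k) H)"
  proof -
    have X: "sip (X A B s) (X B A s) = (\<Sum>a\<in>UNIV. \<Sum>b\<in>UNIV. sip (Z_adj B b (h (a # s) B)) (Z_adj A a (h (b # s) A))
        - (if A = B \<and> a = b then 8 * sip (h (a # s) B) (h (b # s) A) else 0))" for A B s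
    proof -
      have "sip (X A B s) (X B A s) = (\<Sum>a\<in>UNIV. sip (Z_up A a (h (a # s) B)) (X B A s))"
        unfolding X_def[of A B s] by (intro sip_sum_left sqs)
      also have "\<dots> = (\<Sum>a\<in>UNIV. \<Sum>b\<in>UNIV. sip (Z_up A a (h (a # s) B)) (Z_up B b (h (b # s) A)))"
        unfolding X_def[of B A s] by (intro sum.cong refl sip_sum_right sqs)
      finally show ?thesis by (simp add: sip_Z_Z[OF polh polh])
    qed
    have "(\<Sum>A\<in>UNIV. \<Sum>B\<in>UNIV. \<Sum>s\<in>L. sip (X A B s) (X B A s)) =
        (\<Sum>A\<in>UNIV. \<Sum>B\<in>UNIV. \<Sum>s\<in>L. \<Sum>a\<in>UNIV. \<Sum>b\<in>UNIV. sip (Z_adj B b (h (a # s) B)) (Z_adj A a (h (b # s) A)))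
      - (\<Sum>A\<in>UNIV. \<Sum>B\<in>UNIV. \<Sum>s\<in>L. \<Sum>a\<in>UNIV. \<Sum>b\<in>UNIV. if A = B \<and> a = b then 8 * sip (h (a # s) B) (h (b # s) A) else 0)"
      unfolding X by (simp only: sum_subtractf)
    also have "(\<Sum>A\<in>UNIV. \<Sum>B\<in>UNIV. \<Sum>s\<in>L. \<Sum>a\<in>UNIV. \<Sum>b\<in>UNIV. if A = B \<and> a = b then 8 * sip (h (a # s) B) (h (b # s) A) else 0)
        = 8 * complex_of_real (tnsq (I1 k) H)"
    proof -
      have "(\<Sum>B\<in>UNIV. \<Sum>s\<in>L. \<Sum>a\<in>UNIV. \<Sum>b\<in>UNIV. if A = B \<and> a = b then 8 * sip (h (a # s) B) (h (b # s) A) else 0)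
          = (\<Sum>a\<in>UNIV. \<Sum>s\<in>L. 8 * sip (h (a # s) A) (h (a # s) A))" for A
      proof -
        have "(\<Sum>B\<in>UNIV. \<Sum>s\<in>L. \<Sum>a\<in>UNIV. \<Sum>b\<in>UNIV. if A = B \<and> a = b then 8 * sip (h (a # s) B) (h (b # s) A) else 0)
          = (\<Sum>B\<in>UNIV. if A = B then \<Sum>s\<in>L. \<Sum>a\<in>UNIV. 8 * sip (h (a # s) B) (h (a # s) A) else 0)"
          by (intro sum.cong refl) auto
        also have "\<dots> = (\<Sum>s\<in>L. \<Sum>a\<in>UNIV. 8 * sip (h (a # s) A) (h (a # s) A))" by simp
        also have "\<dots> = (\<Sum>a\<in>UNIV. \<Sum>s\<in>L. 8 * sip (h (a # s) A) (h (a # s) A))" by (rule sum.swap)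
        finally show ?thesis .
      qed
      then show ?thesis unfolding tnH by (simp add: sum_distrib_left)
    qed
    also have "(\<Sum>A\<in>UNIV. \<Sum>B\<in>UNIV. \<Sum>s\<in>L. \<Sum>a\<in>UNIV. \<Sum>b\<in>UNIV. sip (Z_adj B b (h (a # s) B)) (Z_adj A a (h (b # s) A))) = S"
    proof -
      let ?Y = "\<lambda>A B s a b. sip (Z_adj B b (h (a # s) B)) (Z_adj A a (h (b # s) A))"
      have G: "sip (G b (a # s)) (G a (b # s)) = (\<Sum>A\<in>UNIV. \<Sum>B\<in>UNIV. ?Y A B s a b)" for a b s
      proof -
        have "sip (G b (a # s)) (G a (b # s)) = (\<Sum>B\<in>UNIV. sip (Z_adj B b (h (a # s) B)) (G a (b # s)))"
          unfolding G_def[of b] by (intro sip_sum_left sqs)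
        also have "\<dots> = (\<Sum>B\<in>UNIV. \<Sum>A\<in>UNIV. ?Y A B s a b)"
          unfolding G_def by (intro sum.cong refl sip_sum_right sqs)
        also have "\<dots> = (\<Sum>A\<in>UNIV. \<Sum>B\<in>UNIV. ?Y A B s a b)" by (rule sum.swap)
        finally show ?thesis .
      qed
      have "(\<Sum>A\<in>UNIV. \<Sum>B\<in>UNIV. \<Sum>s\<in>L. \<Sum>a\<in>UNIV. \<Sum>b\<in>UNIV. ?Y A B s a b)
          = (\<Sum>P\<in>UNIV \<times> UNIV. \<Sum>Q\<in>L \<times> UNIV \<times> UNIV. ?Y (fst P) (snd P) (fst Q) (fst (snd Q)) (snd (snd Q)))"
        by (simp add: sum.cartesian_product' del: UNIV_Times_UNIV)
      also have "\<dots> = (\<Sum>Q\<in>L \<times> UNIV \<times> UNIV. \<Sum>P\<in>UNIV \<times> UNIV. ?Y (fst P) (snd P) (fst Q) (fst (snd Q)) (snd (snd Q)))"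
        by (rule sum.swap)
      also have "\<dots> = (\<Sum>s\<in>L. \<Sum>a\<in>UNIV. \<Sum>b\<in>UNIV. sip (G b (a # s)) (G a (b # s)))"
        unfolding G by (simp add: sum.cartesian_product' del: UNIV_Times_UNIV)
      also have "\<dots> = (\<Sum>a\<in>UNIV. \<Sum>s\<in>L. \<Sum>b\<in>UNIV. sip (G b (a # s)) (G a (b # s)))" by (rule sum.swap)
      also have "\<dots> = S" unfolding S_def by (intro sum.cong refl sum.swap)
      finally show ?thesis .
    qed
    finally show ?thesis .
  qed
  \<comment> \<open>The norm of a symmetrisation: one factor is symmetrised already, so the other one need not be.\<close>
  have three: "of_nat k * complex_of_real (tnsq (I0 k) (pA0 k H)) = complex_of_real M + of_nat (k - 1) * S"
  proof -
    define T where "T t = (\<lambda>x. pA0 k H x t)" for t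
    have pT: "pol (Suc (Suc d)) (T t)" for t unfolding T_def by (rule pV_pol[OF pV_A0[OF H]])
    have Tsym: "T s = T t" if "mset s = mset t" for s t
      unfolding T_def by (intro ext V0_sym[OF pV_V[OF pV_A0[OF H]] that])
    have Tdef: "T t = (\<lambda>x. \<Sum>a\<in>UNIV. of_nat (count (mset t) a) / of_nat k * G a (remove1 a t) x)"
      if "length t = k" for t
      unfolding T_def G_def h_def using that by (simp add: pA0_def)
    have k0: "(of_nat k :: complex) \<noteq> 0" using k by simp
    have Tcons: "T (b # s) = (\<lambda>x. 1 / of_nat k * (G b s x + (\<Sum>c\<in>UNIV. of_nat (count (mset s) c) * G c (b # remove1 c s) x)))"
      if "length s = k - 1" for b s
    proof
      fix x
      have lk: "length (b # s) = k" using that k by simp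
      have "of_nat (count (mset (b # s)) c) / of_nat k * G c (remove1 c (b # s)) x =
          1 / of_nat k * ((if c = b then G b s x else 0) + of_nat (count (mset s) c) * G c (b # remove1 c s) x)" for c
      proof (cases "c = b")
        case False then show ?thesis by simp
      next
        case True
        show ?thesis
        proof (cases "c \<in> set s")
          case True
          then have "G c (b # remove1 c s) = G c s" using \<open>c = b\<close> by (intro Gsym) simp
          then show ?thesis using \<open>c = b\<close> k0 by (simp add: field_simps)
        next
          case False
          then have cnt: "count (mset s) b = 0" using \<open>c = b\<close> by (simp add: count_mset_0_iff)
          show ?thesis unfolding \<open>c = b\<close> by (simp add: cnt)
        qed
      qed
      then have "T (b # s) x = (\<Sum>c\<in>UNIV. 1 / of_nat k * ((if c = b then G b s x else 0) + of_nat (count (mset s) c) * G c (b # remove1 c s) x))"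
        unfolding Tdef[OF lk] by (intro sum.cong refl) simp
      then show "T (b # s) x = 1 / of_nat k * (G b s x + (\<Sum>c\<in>UNIV. of_nat (count (mset s) c) * G c (b # remove1 c s) x))"
        by (simp only: sum_distrib_left[symmetric] sum.distrib) simp
    qed
    have "complex_of_real (tnsq (I0 k) (pA0 k H)) = (\<Sum>t | length t = k. sip (T t) (T t))"
      by (simp add: tnsq_def I0_def T_def sip_self)
    also have "\<dots> = (\<Sum>t | length t = k. \<Sum>a\<in>UNIV. of_nat (count (mset t) a) * (1 / of_nat k * sip (G a (remove1 a t)) (T t)))"
    proof (intro sum.cong refl)
      fix t :: "2 list" assume "t \<in> {t. length t = k}"
      then have t: "length t = k" by simp
      have "sip (T t) (T t) = sip (\<lambda>x. \<Sum>a\<in>UNIV. of_nat (count (mset t) a) / of_nat k * G a (remove1 a t) x) (T t)"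
        by (subst Tdef[OF t]) (rule refl)
      also have "\<dots> = (\<Sum>a\<in>UNIV. of_nat (count (mset t) a) / of_nat k * sip (G a (remove1 a t)) (T t))"
        unfolding sip_scale_left[symmetric] by (intro sip_sum_left sql2_scale sqs pol_sql2[OF pT])
      finally show "sip (T t) (T t) = (\<Sum>a\<in>UNIV. of_nat (count (mset t) a) * (1 / of_nat k * sip (G a (remove1 a t)) (T t)))"
        by simp
    qed
    also have "\<dots> = of_nat k * (\<Sum>a\<in>UNIV. \<Sum>s | length s = k - 1. 1 / of_nat k * sip (G a (remove1 a (a # s))) (T (a # s)))"
    proof (rule sum_count)
      fix a and s t :: "2 list" assume st: "mset s = mset t"
      show "1 / of_nat k * sip (G a (remove1 a s)) (T s) = 1 / of_nat k * sip (G a (remove1 a t)) (T t)"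
        using Tsym[OF st] Gsym[OF mset_remove1_cong[OF st]] by simp
    qed
    also have "\<dots> = (\<Sum>a\<in>UNIV. \<Sum>s | length s = k - 1. sip (G a s) (T (a # s)))"
      using k0 by (simp add: sum_distrib_left)
    also have "\<dots> = (\<Sum>a\<in>UNIV. \<Sum>s | length s = k - 1. 1 / of_nat k * (sip (G a s) (G a s)
        + (\<Sum>c\<in>UNIV. of_nat (count (mset s) c) * sip (G a s) (G c (a # remove1 c s)))))"
    proof (intro sum.cong refl)
      fix a and s :: "2 list" assume "s \<in> {s. length s = k - 1}"
      then have s: "length s = k - 1" by simp
      have "sip (G a s) (T (a # s)) = cnj (1 / of_nat k) * sip (G a s)
          (\<lambda>x. G a s x + (\<Sum>c\<in>UNIV. of_nat (count (mset s) c) * G c (a # remove1 c s) x))"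
        unfolding Tcons[OF s] by (rule sip_scale_right)
      also have "sip (G a s) (\<lambda>x. G a s x + (\<Sum>c\<in>UNIV. of_nat (count (mset s) c) * G c (a # remove1 c s) x))
          = sip (G a s) (G a s) + sip (G a s) (\<lambda>x. \<Sum>c\<in>UNIV. of_nat (count (mset s) c) * G c (a # remove1 c s) x)"
        by (intro sip_add_right sql2_sum sql2_scale sqs)
      also have "sip (G a s) (\<lambda>x. \<Sum>c\<in>UNIV. of_nat (count (mset s) c) * G c (a # remove1 c s) x)
          = (\<Sum>c\<in>UNIV. sip (G a s) (\<lambda>x. of_nat (count (mset s) c) * G c (a # remove1 c s) x))"
        by (intro sip_sum_right sql2_scale sqs)
      finally show "sip (G a s) (T (a # s)) = 1 / of_nat k * (sip (G a s) (G a s)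
        + (\<Sum>c\<in>UNIV. of_nat (count (mset s) c) * sip (G a s) (G c (a # remove1 c s))))"
        by (simp add: sip_scale_right)
    qed
    finally have "of_nat k * complex_of_real (tnsq (I0 k) (pA0 k H)) =
        (\<Sum>a\<in>UNIV. \<Sum>s | length s = k - 1. sip (G a s) (G a s)
        + (\<Sum>c\<in>UNIV. of_nat (count (mset s) c) * sip (G a s) (G c (a # remove1 c s))))"
      using k0 by (simp add: sum_distrib_left)
    also have "\<dots> = complex_of_real M + (\<Sum>a\<in>UNIV. \<Sum>s | length s = k - 1.
        \<Sum>c\<in>UNIV. of_nat (count (mset s) c) * sip (G a s) (G c (a # remove1 c s)))"
      by (simp add: sum.distrib M_def sip_self)
    also have "(\<Sum>a\<in>UNIV. \<Sum>s | length s = k - 1.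
        \<Sum>c\<in>UNIV. of_nat (count (mset s) c) * sip (G a s) (G c (a # remove1 c s)))
      = (\<Sum>a\<in>UNIV. of_nat (k - 1) * (\<Sum>c\<in>UNIV. \<Sum>s\<in>L. sip (G a (c # s)) (G c (a # s))))"
    proof (intro sum.cong refl)
      fix a
      have "(\<Sum>s | length s = k - 1. \<Sum>c\<in>UNIV. of_nat (count (mset s) c) * sip (G a s) (G c (a # remove1 c s)))
        = of_nat (k - 1) * (\<Sum>c\<in>UNIV. \<Sum>s | length s = k - 1 - 1. sip (G a (c # s)) (G c (a # remove1 c (c # s))))"
      proof (rule sum_count)
        fix c and s t :: "2 list" assume st: "mset s = mset t"
        have "mset (a # remove1 c s) = mset (a # remove1 c t)" using st by simp
        from Gsym[OF st] Gsym[OF this]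
        show "sip (G a s) (G c (a # remove1 c s)) = sip (G a t) (G c (a # remove1 c t))" by simp
      qed
      moreover have "k - 1 - 1 = k - 2" by simp
      ultimately show "(\<Sum>s | length s = k - 1. \<Sum>c\<in>UNIV. of_nat (count (mset s) c) * sip (G a s) (G c (a # remove1 c s)))
        = of_nat (k - 1) * (\<Sum>c\<in>UNIV. \<Sum>s\<in>L. sip (G a (c # s)) (G c (a # s)))"
        by (simp only: remove1.simps simp_thms if_True L_def)
    qed
    also have "\<dots> = of_nat (k - 1) * S"
      unfolding S_def sum_distrib_left[symmetric] by (subst sum.swap) (rule refl)
    finally show ?thesis .
  qed
  have k1r: "real (k - 1) = real k - 1" using k by simp
  have N0: "N \<ge> 0" and M0: "M \<ge> 0" unfolding N_def M_def by (intro sum_nonneg nsq_nonneg)+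
  have r1: "tnsq (I2 k) (pD1 k H) = 2 * N - 2 * (Re S - 8 * tnsq (I1 k) H)"
    using arg_cong[OF one[unfolded two], of Re] by simp
  have r2: "real k * tnsq (I0 k) (pA0 k H) = M + (real k - 1) * Re S"
  proof -
    have "Re (complex_of_real (real k) * complex_of_real (tnsq (I0 k) (pA0 k H)))
        = Re (complex_of_real M + complex_of_real (real (k - 1)) * S)"
      unfolding of_real_of_nat_eq three ..
    then show ?thesis unfolding k1r by simp
  qed
  have "(real k - 1) * Re S \<le> real k * tnsq (I0 k) (pA0 k H)" using r2 M0 by linarith
  also have "\<dots> \<le> (real k - 1) * (2 * tnsq (I0 k) (pA0 k H))"
  proof -
    have "real k \<le> (real k - 1) * 2" using k by simp
    from mult_right_mono[OF this tnsq_nonneg[of "I0 k" "pA0 k H"]] show ?thesis by (simp only: mult.assoc)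
  qed
  finally have "Re S \<le> 2 * tnsq (I0 k) (pA0 k H)" using k by (simp add: mult_le_cancel_left)
  then have "0 \<le> 2 * N - 2 * Re S + 4 * tnsq (I0 k) (pA0 k H)" using N0 by simp
  then show ?thesis unfolding r1 by (simp add: algebra_simps)
qed

lemma adj_pol_D0:
  assumes v: "pV (V0 k) (Suc d) v" and G: "pV (V1 k) e G" and k: "k \<ge> 1"
  shows "ip ph (I1 k) (pD0 k v) G = ip ph (I0 k) v (pA0 k G)"
  using pA0_in_adj[OF G k] pD0_in_D0[OF v] unfolding D0_adj_def by blast

lemma adj_pol_D1:
  assumes h: "pV (V1 k) (Suc d) h" and w: "pV (V2 k) e w" and k: "k \<ge> 2"
  shows "ip ph (I2 k) (pD1 k h) w = ip ph (I1 k) h (pA1 k w)"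
  using pA1_in_adj[OF w k] pD1_in_D1[OF h] unfolding D1_adj_def by blast

lemma ip_pD0_pA1:
  assumes v: "pV (V0 k) (Suc (Suc d)) v" and w: "pV (V2 k) e w" and k: "k \<ge> 2"
  shows "ip ph (I1 k) (pD0 k v) (pA1 k w) = 0"
proof -
  have "ip ph (I1 k) (pD0 k v) (pA1 k w) = ip ph (I2 k) (pD1 k (pD0 k v)) w"
    by (rule adj_pol_D1[OF pV_D0[OF v] w k, symmetric])
  then show ?thesis by (simp add: pD1_pD0[OF v k] ip_def)
qed

section \<open>The Box equation for polynomial tuples\<close>

text \<open>An injective linear map of a finite-dimensional space to itself is onto. The space is a
subspace of an infinite-dimensional one and the map need only be linear there, because derivatives are linear only on differentiable functions.\<close>

lemma (in vector_space) inj_endo_surj: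
  assumes W: "subspace W" "W \<subseteq> span T" "finite T"
    and maps: "\<And>x. x \<in> W \<Longrightarrow> f x \<in> W"
    and add: "\<And>x y. x \<in> W \<Longrightarrow> y \<in> W \<Longrightarrow> f (x + y) = f x + f y"
    and hom: "\<And>c x. x \<in> W \<Longrightarrow> f (scale c x) = scale c (f x)"
    and ker: "\<And>x. x \<in> W \<Longrightarrow> f x = 0 \<Longrightarrow> x = 0"
  shows "f ` W = W"
proof
  obtain B where B: "B \<subseteq> W" "independent B" "W \<subseteq> span B"
    by (rule maximal_independent_subset)
  have fB: "finite B"
    using independent_span_bound[OF \<open>finite T\<close> B(2)] B(1) W(2) by blast
  have f0: "f 0 = 0"
    using hom[of 0 0] subspace_0[OF W(1)] by simp
  have fsum: "f (\<Sum>b\<in>S. scale (u b) b) = (\<Sum>b\<in>S. scale (u b) (f b))" if "finite S" "S \<subseteq> W" for S u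
    using that
  proof (induction S rule: finite_induct)
    case (insert b S)
    have "(\<Sum>b\<in>S. scale (u b) b) \<in> W" using insert W(1) by (intro subspace_sum subspace_scale) auto
    then show ?case using insert add[of "scale (u b) b"] hom subspace_scale[OF W(1)] by simp
  qed (simp add: f0)
  have inj: "inj_on f W"
  proof
    fix x y assume xy: "x \<in> W" "y \<in> W" "f x = f y"
    have y': "scale (- 1) y \<in> W" using xy W(1) by (intro subspace_scale)
    have "f (x + scale (- 1) y) = 0" using xy y' by (simp only: add hom) simp
    then have "x + scale (- 1) y = 0" using ker subspace_add[OF W(1) xy(1) y'] by blast
    then show "x = y" by simp
  qed
  have injB: "inj_on f B" using inj B(1) by (rule inj_on_subset)
  have ind: "independent (f ` B)"
  proof
    assume "dependent (f ` B)"
    then obtain u where u: "\<exists>v\<in>f ` B. u v \<noteq> 0" "(\<Sum>v\<in>f ` B. scale (u v) v) = 0"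
      using fB by (auto simp: dependent_finite)
    have "f (\<Sum>b\<in>B. scale (u (f b)) b) = 0"
      using u(2) by (simp add: fsum[OF fB B(1)] sum.reindex[OF injB])
    moreover have "(\<Sum>b\<in>B. scale (u (f b)) b) \<in> W" using B(1) W(1) by (intro subspace_sum subspace_scale) auto
    ultimately have "(\<Sum>b\<in>B. scale (u (f b)) b) = 0" using ker by blast
    moreover obtain b where "b \<in> B" "u (f b) \<noteq> 0" using u(1) by blast
    ultimately have "dependent B" using fB by (auto simp: dependent_finite)
    then show False using B(2) by contradiction
  qed
  show "f ` W \<subseteq> W" using maps by blast
  show "W \<subseteq> f ` W"
  proof
    fix y assume y: "y \<in> W"
    have "y \<in> span (f ` B)"
    proof (rule ccontr)
      assume n: "y \<notin> span (f ` B)"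
      then have "independent (insert y (f ` B))" using ind by (simp add: independent_insert)
      moreover have "insert y (f ` B) \<subseteq> span B" using y B maps by blast
      ultimately have "card (insert y (f ` B)) \<le> card B" using independent_span_bound[OF fB] by blast
      moreover have "y \<notin> f ` B" using n span_base by blast
      ultimately show False using fB card_image[OF injB] by simp
    qed
    then obtain u where "y = (\<Sum>v\<in>f ` B. scale (u v) v)" using fB by (auto simp: span_finite)
    then have "y = f (\<Sum>b\<in>B. scale (u (f b)) b)" by (simp add: fsum[OF fB B(1)] sum.reindex[OF injB])
    moreover have "(\<Sum>b\<in>B. scale (u (f b)) b) \<in> W" using B(1) W(1) by (intro subspace_sum subspace_scale) auto
    ultimately show "y \<in> f ` W" by blast
  qed
qed

text \<open>Together with the pointwise addition of functions this makes all tuple-valued functions a complex vector space,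
so that dimension arguments apply to polynomial tuples.\<close>

definition fscale :: "complex \<Rightarrow> ('a \<Rightarrow> 'i \<Rightarrow> complex) \<Rightarrow> 'a \<Rightarrow> 'i \<Rightarrow> complex" where
  "fscale c F = (\<lambda>x i. c * F x i)"

interpretation fs: vector_space "fscale :: complex \<Rightarrow> ('a \<Rightarrow> 'i \<Rightarrow> complex) \<Rightarrow> _"
  by standard (auto simp: fscale_def fun_eq_iff algebra_simps)

lemma fun_sum_apply: "(\<Sum>i\<in>I. f i) x = (\<Sum>i\<in>I. (f i x :: 'b::comm_monoid_add))"
  by (induction I rule: infinite_finite_induct) (auto simp: zero_fun_def)

definition unit_tuple :: "'i \<Rightarrow> ('a \<Rightarrow> complex) \<Rightarrow> 'a \<Rightarrow> 'i \<Rightarrow> complex" where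
  "unit_tuple i p = (\<lambda>x j. if j = i then p x else 0)"

definition mul_coord :: "'n::finite \<Rightarrow> 4 \<Rightarrow> ('n space \<Rightarrow> 'i \<Rightarrow> complex) \<Rightarrow> 'n space \<Rightarrow> 'i \<Rightarrow> complex" where
  "mul_coord l j F = (\<lambda>x i. complex_of_real (x $ l $ j) * F x i)"

text \<open>Monomials placed in one entry; a finite generating set for the polynomial tuples.\<close>

fun gens :: "'i set \<Rightarrow> nat \<Rightarrow> ('n::finite space \<Rightarrow> 'i \<Rightarrow> complex) set" where
  "gens I 0 = {}"
| "gens I (Suc d) = (\<lambda>i. unit_tuple i (\<lambda>x. 1)) ` I \<union> (\<Union>l. \<Union>j. mul_coord l j ` gens I d)"

lemma finite_gens: "finite I \<Longrightarrow> finite (gens I d)"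
  by (induction d) auto

lemma unit_tuple_span: "pol d p \<Longrightarrow> i \<in> I \<Longrightarrow> unit_tuple i p \<in> fs.span (gens I d)"
proof (induction rule: pol.induct)
  case (pol_zero d)
  have "unit_tuple i (\<lambda>x. 0) = (0 :: 'a space \<Rightarrow> 'b \<Rightarrow> complex)" by (auto simp: unit_tuple_def fun_eq_iff)
  then show ?case by (simp only: fs.span_zero)
next
  case (pol_const d c)
  have "unit_tuple i (\<lambda>x. c) = fscale c (unit_tuple i (\<lambda>x::'a space. 1))"
    by (auto simp: unit_tuple_def fscale_def fun_eq_iff)
  moreover have "unit_tuple i (\<lambda>x::'a space. 1) \<in> fs.span (gens I (Suc d))"
    using pol_const by (intro fs.span_base) auto
  ultimately show ?case by (simp only: fs.span_scale)
next
  case (pol_add d f g)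
  have "unit_tuple i (\<lambda>x. f x + g x) = unit_tuple i f + unit_tuple i g"
    by (auto simp: unit_tuple_def fun_eq_iff)
  then show ?case using pol_add by (simp only: fs.span_add)
next
  case (pol_coord d f l j)
  have "mul_coord l j F \<in> fs.span (gens I (Suc d))" if "F \<in> fs.span (gens I d)" for F
    using that
  proof (rule fs.span_induct)
    show "fs.subspace {F. mul_coord l j F \<in> fs.span (gens I (Suc d))}"
    proof (rule fs.subspaceI)
      have "mul_coord l j 0 = (0 :: 'a space \<Rightarrow> 'b \<Rightarrow> complex)" by (auto simp: mul_coord_def fun_eq_iff)
      then show "0 \<in> {F. mul_coord l j F \<in> fs.span (gens I (Suc d))}" by (simp only: mem_Collect_eq fs.span_zero)
    next
      fix F G :: "'a space \<Rightarrow> 'b \<Rightarrow> complex"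
      assume "F \<in> {F. mul_coord l j F \<in> fs.span (gens I (Suc d))}" "G \<in> {F. mul_coord l j F \<in> fs.span (gens I (Suc d))}"
      moreover have "mul_coord l j (F + G) = mul_coord l j F + mul_coord l j G"
        by (auto simp: mul_coord_def fun_eq_iff algebra_simps)
      ultimately show "F + G \<in> {F. mul_coord l j F \<in> fs.span (gens I (Suc d))}" by (simp only: mem_Collect_eq fs.span_add)
    next
      fix c and F :: "'a space \<Rightarrow> 'b \<Rightarrow> complex"
      assume "F \<in> {F. mul_coord l j F \<in> fs.span (gens I (Suc d))}"
      moreover have "mul_coord l j (fscale c F) = fscale c (mul_coord l j F)"
        by (auto simp: mul_coord_def fscale_def fun_eq_iff)
      ultimately show "fscale c F \<in> {F. mul_coord l j F \<in> fs.span (gens I (Suc d))}" by (simp only: mem_Collect_eq fs.span_scale)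
    qed
    show "mul_coord l j F \<in> fs.span (gens I (Suc d))" if "F \<in> gens I d" for F
      using that by (intro fs.span_base) auto
  qed
  moreover have "unit_tuple i (\<lambda>x. complex_of_real (x $ l $ j) * f x) = mul_coord l j (unit_tuple i f)"
    by (auto simp: unit_tuple_def mul_coord_def fun_eq_iff)
  ultimately show ?case using pol_coord by (simp only:)
qed

context tuples
begin

lemma pV_lin: "pV V d F \<Longrightarrow> pV V d G \<Longrightarrow> pV V d (\<lambda>x i. F x i + c * G x i)"
  by (simp add: pV_def add scale pol_add pol_scale)

lemma pV_0: "pV V d (\<lambda>x i. 0)"
  by (simp add: pV_def zero pol_zero)

lemma pV_span:
  assumes "pV V d F" shows "F \<in> fs.span (gens I d)"
proof -
  have "F = (\<Sum>i\<in>I. unit_tuple i (\<lambda>x. F x i))"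
  proof (intro ext)
    fix x j
    have "(\<Sum>i\<in>I. unit_tuple i (\<lambda>x. F x i)) x j = (\<Sum>i\<in>I. if j = i then F x i else 0)"
      by (simp add: fun_sum_apply unit_tuple_def)
    also have "\<dots> = F x j" using finI supp[OF pV_V[OF assms]] by simp
    finally show "F x j = (\<Sum>i\<in>I. unit_tuple i (\<lambda>x. F x i)) x j" by simp
  qed
  moreover have "(\<Sum>i\<in>I. unit_tuple i (\<lambda>x. F x i)) \<in> fs.span (gens I d)"
    by (intro fs.span_sum unit_tuple_span pV_pol[OF assms])
  ultimately show ?thesis by simp
qed

text \<open>A continuous function that vanishes almost everywhere vanishes.\<close>

lemma pV_eq_0:
  assumes F: "pV V d (F :: 'n::finite space \<Rightarrow> _)" and 0: "tnsq I F = 0"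
  shows "F = (\<lambda>x i. 0)"
proof (intro ext)
  fix x i
  have ae: "AE x in lborel. F x i = 0"
    using tnsq_0_AE[OF pV_L2[OF F] 0] by eventually_elim blast
  define S where "S = {x. F x i \<noteq> 0}"
  have "open S" unfolding S_def
    using pol_continuous[OF pV_pol[OF F]] by (intro open_Collect_neq) (auto intro: continuous_on_const)
  then have "S \<in> sets lborel" by simp
  then have "S \<in> null_sets lborel" using ae unfolding S_def by (simp add: AE_iff_null)
  then have "negligible S" by (simp add: negligible_iff_null_sets null_sets_completionI)
  then have "S = {}" using open_not_negligible \<open>open S\<close> by blast
  then show "F x i = 0" by (auto simp: S_def)
qed

end

lemma Z_lin: "pol d f \<Longrightarrow> pol d g \<Longrightarrow> Z_up A a (\<lambda>x. f x + c * g x) x = Z_up A a f x + c * Z_up A a g x"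
  by (simp add: Z_add[OF _ pol_scale] Z_scale)

lemma Z_adj_lin: "pol d f \<Longrightarrow> pol d g \<Longrightarrow> Z_adj A a (\<lambda>x. f x + c * g x) x = Z_adj A a f x + c * Z_adj A a g x"
  by (simp add: Z_adj_add[OF _ pol_scale] Z_adj_scale)

lemma pD0_lin:
  assumes "pV (V0 k) d F" "pV (V0 k) d G"
  shows "pD0 k (\<lambda>x i. F x i + c * G x i) = (\<lambda>x i. pD0 k F x i + c * pD0 k G x i)"
  unfolding pD0_def
  by (intro ext) (auto simp: Z_lin[OF pV_pol[OF assms(1)] pV_pol[OF assms(2)]] sum.distrib sum_distrib_left split: prod.splits)

lemma pD1_lin:
  assumes "pV (V1 k) d F" "pV (V1 k) d G"
  shows "pD1 k (\<lambda>x i. F x i + c * G x i) = (\<lambda>x i. pD1 k F x i + c * pD1 k G x i)"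
  unfolding pD1_def
  by (intro ext) (auto simp: Z_lin[OF pV_pol[OF assms(1)] pV_pol[OF assms(2)]] sum.distrib sum_subtractf
      sum_distrib_left algebra_simps split: prod.splits)

lemma pA0_lin:
  assumes "pV (V1 k) d F" "pV (V1 k) d G"
  shows "pA0 k (\<lambda>x i. F x i + c * G x i) = (\<lambda>x i. pA0 k F x i + c * pA0 k G x i)"
  unfolding pA0_def
  by (intro ext) (auto simp: Z_adj_lin[OF pV_pol[OF assms(1)] pV_pol[OF assms(2)]] sum.distrib
      sum_distrib_left distrib_left mult_ac)

lemma pA1_lin:
  assumes "pV (V2 k) d F" "pV (V2 k) d G"
  shows "pA1 k (\<lambda>x i. F x i + c * G x i) = (\<lambda>x i. pA1 k F x i + c * pA1 k G x i)"
  unfolding pA1_def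
  by (intro ext) (auto simp: Z_adj_lin[OF pV_pol[OF assms(1)] pV_pol[OF assms(2)]] sum.distrib
      sum_distrib_left distrib_left mult_ac split: prod.splits)

definition pBox :: "nat \<Rightarrow> ('n::finite space \<Rightarrow> 'n idx1 \<Rightarrow> complex) \<Rightarrow> 'n space \<Rightarrow> 'n idx1 \<Rightarrow> complex" where
  "pBox k H = (\<lambda>x i. pD0 k (pA0 k H) x i + pA1 k (pD1 k H) x i)"

lemma pV_Box:
  assumes H: "pV (V1 k) (Suc d) H" shows "pV (V1 k) (Suc d) (pBox k H)"
  using V1.pV_lin[OF pV_D0[OF pV_A0[OF H]] pV_A1[OF pV_D1[OF H]], of 1] by (simp add: pBox_def)

lemma pBox_lin:
  assumes F: "pV (V1 k) (Suc d) F" and G: "pV (V1 k) (Suc d) G"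
  shows "pBox k (\<lambda>x i. F x i + c * G x i) = (\<lambda>x i. pBox k F x i + c * pBox k G x i)"
  unfolding pBox_def pA0_lin[OF F G] pD1_lin[OF F G]
    pD0_lin[OF pV_A0[OF F] pV_A0[OF G]] pA1_lin[OF pV_D1[OF F] pV_D1[OF G]]
  by (simp add: algebra_simps)

text \<open>The first three bounds combine the estimate with
$\langle \Box H, H\rangle = \|\mathscr D_0^*H\|^2 + \|\mathscr D_1 H\|^2$; the last two hold because the two parts of $\Box H$
are orthogonal.\<close>

lemma pBox_bounds:
  fixes H :: "'n::finite space \<Rightarrow> 'n idx1 \<Rightarrow> complex"
  assumes H: "pV (V1 k) (Suc d) H" and k: "k \<ge> 2"
  defines "N \<equiv> tnsq (I1 k) (pBox k H)"
  shows "tnsq (I1 k) H \<le> N" "tnsq (I0 k) (pA0 k H) \<le> N" "tnsq (I2 k) (pD1 k H) \<le> N"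
    "tnsq (I1 k) (pD0 k (pA0 k H)) \<le> N" "tnsq (I1 k) (pA1 k (pD1 k H)) \<le> N"
proof -
  note A = pV_A0[OF H] and D = pV_D1[OF H]
  note DA = pV_D0[OF A] and AD = pV_A1[OF D]
  note lA = pV_L2[OF A] and lD = pV_L2[OF D] and lDA = pV_L2[OF DA] and lAD = pV_L2[OF AD]
  have lB: "pBox k H \<in> L2 ph (V1 k)" by (rule pV_L2[OF pV_Box[OF H]])
  have k1: "k \<ge> 1" using k by simp
  have "ip ph (I1 k) (pBox k H) H = ip ph (I1 k) (pD0 k (pA0 k H)) H + ip ph (I1 k) (pA1 k (pD1 k H)) H"
    unfolding pBox_def by (rule V1.ip_add_left[OF lDA lAD pV_L2[OF H]])
  also have "ip ph (I1 k) (pD0 k (pA0 k H)) H = ip ph (I0 k) (pA0 k H) (pA0 k H)"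
    by (rule adj_pol_D0[OF A H k1])
  also have "ip ph (I1 k) (pA1 k (pD1 k H)) H = cnj (ip ph (I1 k) H (pA1 k (pD1 k H)))" by (rule ip_cnj)
  also have "ip ph (I1 k) H (pA1 k (pD1 k H)) = ip ph (I2 k) (pD1 k H) (pD1 k H)"
    by (rule adj_pol_D1[OF H D k, symmetric])
  finally have e: "ip ph (I1 k) (pBox k H) H = complex_of_real (tnsq (I0 k) (pA0 k H) + tnsq (I2 k) (pD1 k H))"
    by (simp add: V0.ip_self[OF lA] V2.ip_self[OF lD])
  have "norm (ip ph (I1 k) (pBox k H) H) = tnsq (I0 k) (pA0 k H) + tnsq (I2 k) (pD1 k H)"
    unfolding e norm_of_real by simp
  then have n: "2 * (tnsq (I0 k) (pA0 k H) + tnsq (I2 k) (pD1 k H)) \<le> N + tnsq (I1 k) H"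
    using V1.norm_ip_le[OF lB pV_L2[OF H], of 1] unfolding N_def by simp
  have est: "16 * tnsq (I1 k) H \<le> tnsq (I2 k) (pD1 k H) + 4 * tnsq (I0 k) (pA0 k H)"
    by (rule basic_estimate[OF H k])
  show "tnsq (I1 k) H \<le> N" "tnsq (I0 k) (pA0 k H) \<le> N" "tnsq (I2 k) (pD1 k H) \<le> N"
  proof -
    have *: "h \<le> N \<and> a \<le> N \<and> d \<le> N"
      if "2 * (a + d) \<le> N + h" "16 * h \<le> d + 4 * a" "0 \<le> d" "0 \<le> a" "0 \<le> h" for h a d :: real
      using that by auto
    show "tnsq (I1 k) H \<le> N" "tnsq (I0 k) (pA0 k H) \<le> N" "tnsq (I2 k) (pD1 k H) \<le> N"
      using *[OF n est tnsq_nonneg tnsq_nonneg tnsq_nonneg] by blast+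
  qed
  have z: "ip ph (I1 k) (pD0 k (pA0 k H)) (pA1 k (pD1 k H)) = 0"
    by (rule ip_pD0_pA1[OF A D k])
  then have z': "ip ph (I1 k) (pA1 k (pD1 k H)) (pD0 k (pA0 k H)) = 0"
    using ip_cnj[of ph "I1 k" "pA1 k (pD1 k H)"] by simp
  have "complex_of_real N = ip ph (I1 k) (pBox k H) (pBox k H)" unfolding N_def by (rule V1.ip_self[OF lB, symmetric])
  also have "\<dots> = ip ph (I1 k) (pD0 k (pA0 k H)) (pBox k H) + ip ph (I1 k) (pA1 k (pD1 k H)) (pBox k H)"
    using V1.ip_add_left[OF lDA lAD lB] by (simp add: pBox_def)
  also have "\<dots> = complex_of_real (tnsq (I1 k) (pD0 k (pA0 k H)) + tnsq (I1 k) (pA1 k (pD1 k H)))"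
    using V1.ip_add_right[OF lDA lAD lDA] V1.ip_add_right[OF lDA lAD lAD]
    by (simp add: pBox_def z z' V1.ip_self[OF lDA] V1.ip_self[OF lAD])
  finally have "N = tnsq (I1 k) (pD0 k (pA0 k H)) + tnsq (I1 k) (pA1 k (pD1 k H))"
    unfolding of_real_eq_iff .
  then show "tnsq (I1 k) (pD0 k (pA0 k H)) \<le> N" "tnsq (I1 k) (pA1 k (pD1 k H)) \<le> N"
    using tnsq_nonneg[of "I1 k" "pD0 k (pA0 k H)"] tnsq_nonneg[of "I1 k" "pA1 k (pD1 k H)"] by linarith+
qed

theorem pBox_surj:
  fixes p :: "'n::finite space \<Rightarrow> 'n idx1 \<Rightarrow> complex"
  assumes p: "pV (V1 k) (Suc d) p" and k: "k \<ge> 2"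
  obtains H where "pV (V1 k) (Suc d) H" "pBox k H = p"
proof -
  let ?W = "{H :: 'n space \<Rightarrow> 'n idx1 \<Rightarrow> complex. pV (V1 k) (Suc d) H}"
  have lin_add: "F + G = (\<lambda>x i. F x i + 1 * G x i)" for F G :: "'n space \<Rightarrow> 'n idx1 \<Rightarrow> complex"
    by (auto simp: fun_eq_iff)
  have lin_scale: "fscale c G = (\<lambda>x i. 0 + c * G x i)" for c and G :: "'n space \<Rightarrow> 'n idx1 \<Rightarrow> complex"
    by (auto simp: fun_eq_iff fscale_def)
  have z: "(0 :: 'n space \<Rightarrow> 'n idx1 \<Rightarrow> complex) = (\<lambda>x i. 0)" by (auto simp: fun_eq_iff)
  have Box0: "pBox k (\<lambda>x i. 0) = (\<lambda>x i. 0)"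
  proof -
    have "pBox k (\<lambda>x i. 0 + (- 1) * 0) = (\<lambda>x i. pBox k (\<lambda>x i. 0) x i + (- 1) * pBox k (\<lambda>x i. 0) x i)"
      by (rule pBox_lin[OF V1.pV_0 V1.pV_0])
    then show ?thesis by simp
  qed
  have "pBox k ` ?W = ?W"
  proof (rule fs.inj_endo_surj[where T = "gens (I1 k) (Suc d)"])
    show "fs.subspace ?W"
    proof (rule fs.subspaceI)
      show "0 \<in> ?W" by (simp only: mem_Collect_eq z V1.pV_0)
      show "F + G \<in> ?W" if "F \<in> ?W" "G \<in> ?W" for F G using that V1.pV_lin[of k "Suc d" F G 1] by (simp only: mem_Collect_eq lin_add)
      show "fscale c F \<in> ?W" if "F \<in> ?W" for c F using that V1.pV_lin[OF V1.pV_0, of k "Suc d" F c] by (simp only: mem_Collect_eq lin_scale)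
    qed
    show "?W \<subseteq> fs.span (gens (I1 k) (Suc d))" using V1.pV_span by blast
    show "finite (gens (I1 k) (Suc d) :: ('n space \<Rightarrow> 'n idx1 \<Rightarrow> complex) set)" by (rule finite_gens[OF V1.finI])
    show "pBox k F \<in> ?W" if "F \<in> ?W" for F using that pV_Box by blast
    show "pBox k (F + G) = pBox k F + pBox k G" if "F \<in> ?W" "G \<in> ?W" for F G
      using pBox_lin[of k d F G 1] that by (simp only: lin_add mem_Collect_eq)
    show "pBox k (fscale c F) = fscale c (pBox k F)" if "F \<in> ?W" for c F
      using pBox_lin[OF V1.pV_0, of k d F c] that by (simp only: lin_scale mem_Collect_eq Box0)
    show "F = 0" if "F \<in> ?W" "pBox k F = 0" for F
    proof -
      have F: "pV (V1 k) (Suc d) F" using that by simp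
      have "tnsq (I1 k) (pBox k F) = 0" unfolding that(2) z by (simp add: tnsq_def nsq_def)
      then have "tnsq (I1 k) F = 0" using pBox_bounds(1)[OF F k] tnsq_nonneg[of "I1 k" F] by linarith
      then show ?thesis unfolding z by (rule V1.pV_eq_0[OF F])
    qed
  qed
  then have "p \<in> pBox k ` ?W" using p by simp
  then show ?thesis using that by blast
qed

section \<open>Density of the polynomial tuples\<close>

lemma pV_mono: "pV V d F \<Longrightarrow> d \<le> e \<Longrightarrow> pV V e F"
  by (simp add: pV_def) (meson pol_mono)

text \<open>The map $\rho$ picks a representative of the orbit of an index. Approximating only the entries at
representatives and copying them along the orbits keeps the approximation inside the space of tuples.\<close>

lemma (in tuples) pV_dense:
  fixes g :: "'n::finite space \<Rightarrow> 'i \<Rightarrow> complex"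
  assumes g: "g \<in> L2 ph V" and e: "e > 0"
    and \<rho>: "\<And>i. i \<in> I \<Longrightarrow> \<rho> i \<in> I" "\<And>v i. v \<in> V \<Longrightarrow> v (\<rho> i) = v i"
      "\<And>w. (\<lambda>i. if i \<in> I then w (\<rho> i) else 0) \<in> V"
  shows "\<exists>d p. pV V (Suc d) p \<and> tnsq I (\<lambda>x i. p x i - g x i) < e"
proof -
  define e' where "e' = e / (real (card I) + 1)"
  have e': "e' > 0" using e by (simp add: e'_def add_nonneg_pos)
  have "\<forall>i. \<exists>d p. pol d p \<and> nsq (\<lambda>x. g x i - p x) < e'"
    using pol_dense[OF L2_sql2[OF g]] e' unfolding approximable_def by blast
  then obtain d q where q: "\<And>i. pol (d i) (q i)" "\<And>i. nsq (\<lambda>x. g x i - q i x) < e'" by metis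
  define D where "D = (\<Sum>i\<in>I. d i)"
  define p where "p x i = (if i \<in> I then q (\<rho> i) x else 0)" for x i
  have "pol (Suc D) (\<lambda>x. p x i)" for i
  proof (cases "i \<in> I")
    case True
    have "d (\<rho> i) \<le> D" unfolding D_def by (rule member_le_sum[OF \<rho>(1)[OF True]]) (auto intro: finI)
    then show ?thesis using True pol_mono[OF q(1)[of "\<rho> i"], of "Suc D"] by (simp add: p_def)
  qed (simp add: p_def pol_zero)
  moreover have "p x \<in> V" for x
    using \<rho>(3)[of "\<lambda>i. q i x"] by (simp add: p_def[abs_def])
  ultimately have pV: "pV V (Suc D) p" by (simp add: pV_def)
  have "tnsq I (\<lambda>x i. p x i - g x i) \<le> (\<Sum>i\<in>I. e')"
    unfolding tnsq_def
  proof (rule sum_mono)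
    fix i assume i: "i \<in> I"
    have "g x (\<rho> i) = g x i" for x using g \<rho>(2) by (auto simp: L2_iff)
    then have "nsq (\<lambda>x. p x i - g x i) = nsq (\<lambda>x. g x (\<rho> i) - q (\<rho> i) x)"
      using i by (subst nsq_uminus_commute) (simp add: p_def)
    then show "nsq (\<lambda>x. p x i - g x i) \<le> e'" using q(2)[of "\<rho> i"] by simp
  qed
  also have "\<dots> = real (card I) * e / (real (card I) + 1)" by (simp add: e'_def)
  also have "\<dots> < e" using e by (simp add: field_simps)
  finally show ?thesis using pV by blast
qed

definition rep :: "2 list \<Rightarrow> 2 list" where
  "rep s = (SOME t. mset t = mset s)"

lemma mset_rep: "mset (rep s) = mset s"
  unfolding rep_def by (rule someI[of _ s]) (rule refl)

lemma length_rep: "length (rep s) = length s"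
  using mset_rep mset_eq_length by blast

lemma rep_cong: "mset s = mset t \<Longrightarrow> rep s = rep t"
  by (simp add: rep_def)

lemma V0_dense:
  assumes "g \<in> L2 ph (V0 k)" "e > 0"
  shows "\<exists>d p. pV (V0 k) (Suc d) p \<and> tnsq (I0 k) (\<lambda>x i. p x i - g x i) < e"
proof (rule V0.pV_dense[OF assms, of rep])
  show "rep s \<in> I0 k" if "s \<in> I0 k" for s using that by (simp add: I0_def length_rep)
  show "v (rep s) = v s" if "v \<in> V0 k" for v s by (rule V0_sym[OF that mset_rep])
  show "(\<lambda>s. if s \<in> I0 k then w (rep s) else 0) \<in> V0 k" for w
  proof (rule V0I)
    fix s t :: "2 list" assume st: "mset s = mset t"
    have "rep s = rep t" "length s = length t" by (rule rep_cong[OF st], rule mset_eq_length[OF st])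
    then show "(if s \<in> I0 k then w (rep s) else 0) = (if t \<in> I0 k then w (rep t) else 0)"
      by (simp add: I0_def)
  qed (simp add: I0_def)
qed

lemma V1_dense:
  fixes g :: "'n::finite space \<Rightarrow> 'n idx1 \<Rightarrow> complex"
  assumes "g \<in> L2 ph (V1 k)" "e > 0"
  shows "\<exists>d p. pV (V1 k) (Suc d) p \<and> tnsq (I1 k) (\<lambda>x i. p x i - g x i) < e"
proof (rule V1.pV_dense[OF assms, of "map_prod rep id"])
  show "map_prod rep id i \<in> I1 k" if "i \<in> I1 k" for i :: "'n idx1"
    using that by (cases i) (simp add: I1_iff length_rep)
  show "v (map_prod rep id i) = v i" if "v \<in> V1 k" for v and i :: "'n idx1"
    using V1_sym[OF that mset_rep] by (cases i) simp
  show "(\<lambda>i. if i \<in> I1 k then w (map_prod rep id i) else 0) \<in> V1 k" for w :: "'n idx1 \<Rightarrow> complex"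
  proof (rule V1I)
    fix s t :: "2 list" and A :: "'n uidx" assume st: "mset s = mset t"
    have "rep s = rep t" "length s = length t" by (rule rep_cong[OF st], rule mset_eq_length[OF st])
    then show "(if (s, A) \<in> I1 k then w (map_prod rep id (s, A)) else 0) = (if (t, A) \<in> I1 k then w (map_prod rep id (t, A)) else 0)"
      by (simp add: I1_iff)
  qed (simp add: I1_iff)
qed

section \<open>Closedness of the graphs\<close>

lemma D0_closed:
  assumes D: "\<And>n. (f n, g n) \<in> D0 ph k"
    and F: "F \<in> L2 ph (V0 k)" "(\<lambda>n. tnsq (I0 k) (\<lambda>x i. f n x i - F x i)) \<longlonglongrightarrow> 0"
    and G: "G \<in> L2 ph (V1 k)" "(\<lambda>n. tnsq (I1 k) (\<lambda>x i. g n x i - G x i)) \<longlonglongrightarrow> 0"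
  shows "(F, G) \<in> D0 ph k"
  unfolding D0_iff
proof (intro conjI allI impI F(1) G(1))
  have fL: "f n \<in> L2 ph (V0 k)" and gL: "g n \<in> L2 ph (V1 k)" for n using D[of n] by (auto simp: D0_iff)
  fix s A and \<eta> :: "'a space \<Rightarrow> complex" assume s: "length (s :: 2 list) = k - 1" and t: "test_fun \<eta>"
  have "(\<lambda>n. LINT x|lborel. f n x (a # s) * Z_up A a \<eta> x) \<longlonglongrightarrow> (LINT x|lborel. F x (a # s) * Z_up A a \<eta> x)" for a
  proof -
    obtain h where h: "sql2 h" "\<And>f. (LINT x|lborel. f x * Z_up A a \<eta> x) = sip f h"
      by (rule test_pairing_Z[OF t, of A a]) blast
    show ?thesis unfolding h(2)
      by (intro tendsto_sip_left h(1) V0.L2_sql2[OF fL] V0.L2_sql2[OF F(1)] V0.tnsq_component[OF fL F])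
  qed
  then have "(\<lambda>n. \<Sum>a\<in>UNIV. (- 1) * (LINT x|lborel. f n x (a # s) * Z_up A a \<eta> x))
      \<longlonglongrightarrow> (\<Sum>a\<in>UNIV. (- 1) * (LINT x|lborel. F x (a # s) * Z_up A a \<eta> x))"
    by (intro tendsto_sum tendsto_mult[OF tendsto_const])
  moreover have "(\<lambda>n. LINT x|lborel. g n x (s, A) * \<eta> x) \<longlonglongrightarrow> (LINT x|lborel. G x (s, A) * \<eta> x)"
  proof -
    obtain h where h: "sql2 h" "\<And>f. (LINT x|lborel. f x * \<eta> x) = sip f h"
      by (rule test_pairing[OF t]) blast
    show ?thesis unfolding h(2)
      by (intro tendsto_sip_left h(1) V1.L2_sql2[OF gL] V1.L2_sql2[OF G(1)] V1.tnsq_component[OF gL G])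
  qed
  moreover have "(\<Sum>a\<in>UNIV. (- 1) * (LINT x|lborel. f n x (a # s) * Z_up A a \<eta> x)) = (LINT x|lborel. g n x (s, A) * \<eta> x)" for n
    using D[of n] s t unfolding D0_iff by blast
  ultimately show "(\<Sum>a\<in>UNIV. (- 1) * (LINT x|lborel. F x (a # s) * Z_up A a \<eta> x)) = (LINT x|lborel. G x (s, A) * \<eta> x)"
    by (rule limit_eq)
qed

lemma D1_closed:
  assumes D: "\<And>n. (f n, g n) \<in> D1 ph k"
    and F: "F \<in> L2 ph (V1 k)" "(\<lambda>n. tnsq (I1 k) (\<lambda>x i. f n x i - F x i)) \<longlonglongrightarrow> 0"
    and G: "G \<in> L2 ph (V2 k)" "(\<lambda>n. tnsq (I2 k) (\<lambda>x i. g n x i - G x i)) \<longlonglongrightarrow> 0"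
  shows "(F, G) \<in> D1 ph k"
  unfolding D1_iff
proof (intro conjI allI impI F(1) G(1))
  have fL: "f n \<in> L2 ph (V1 k)" and gL: "g n \<in> L2 ph (V2 k)" for n using D[of n] by (auto simp: D1_iff)
  fix s A B and \<eta> :: "'a space \<Rightarrow> complex" assume s: "length (s :: 2 list) = k - 2" and t: "test_fun \<eta>"
  have lim: "(\<lambda>n. LINT x|lborel. f n x (a # s, C) * Z_up E a \<eta> x) \<longlonglongrightarrow> (LINT x|lborel. F x (a # s, C) * Z_up E a \<eta> x)" for a C E
  proof -
    obtain h where h: "sql2 h" "\<And>f. (LINT x|lborel. f x * Z_up E a \<eta> x) = sip f h"
      by (rule test_pairing_Z[OF t, of E a]) blast
    show ?thesis unfolding h(2)
      by (intro tendsto_sip_left h(1) V1.L2_sql2[OF fL] V1.L2_sql2[OF F(1)] V1.tnsq_component[OF fL F])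
  qed
  have "(\<lambda>n. \<Sum>a\<in>UNIV. (LINT x|lborel. f n x (a # s, A) * Z_up B a \<eta> x) - (LINT x|lborel. f n x (a # s, B) * Z_up A a \<eta> x))
      \<longlonglongrightarrow> (\<Sum>a\<in>UNIV. (LINT x|lborel. F x (a # s, A) * Z_up B a \<eta> x) - (LINT x|lborel. F x (a # s, B) * Z_up A a \<eta> x))"
    by (intro tendsto_sum tendsto_diff lim)
  moreover have "(\<lambda>n. LINT x|lborel. g n x (A, B, s) * \<eta> x) \<longlonglongrightarrow> (LINT x|lborel. G x (A, B, s) * \<eta> x)"
  proof -
    obtain h where h: "sql2 h" "\<And>f. (LINT x|lborel. f x * \<eta> x) = sip f h"
      by (rule test_pairing[OF t]) blast
    show ?thesis unfolding h(2)
      by (intro tendsto_sip_left h(1) V2.L2_sql2[OF gL] V2.L2_sql2[OF G(1)] V2.tnsq_component[OF gL G])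
  qed
  moreover have "(\<Sum>a\<in>UNIV. (LINT x|lborel. f n x (a # s, A) * Z_up B a \<eta> x) - (LINT x|lborel. f n x (a # s, B) * Z_up A a \<eta> x))
      = (LINT x|lborel. g n x (A, B, s) * \<eta> x)" for n
    using D[of n] s t unfolding D1_iff by blast
  ultimately show "(\<Sum>a\<in>UNIV. (LINT x|lborel. F x (a # s, A) * Z_up B a \<eta> x) - (LINT x|lborel. F x (a # s, B) * Z_up A a \<eta> x))
      = (LINT x|lborel. G x (A, B, s) * \<eta> x)"
    by (rule limit_eq)
qed

lemma D0_adj_iff: "(g, h) \<in> D0_adj ph k \<longleftrightarrow> g \<in> L2 ph (V1 k) \<and> h \<in> L2 ph (V0 k) \<and>
    (\<forall>f Df. (f, Df) \<in> D0 ph k \<longrightarrow> ip ph (I1 k) Df g = ip ph (I0 k) f h)"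
  unfolding D0_adj_def by blast

lemma D1_adj_iff: "(g, h) \<in> D1_adj ph k \<longleftrightarrow> g \<in> L2 ph (V2 k) \<and> h \<in> L2 ph (V1 k) \<and>
    (\<forall>f Df. (f, Df) \<in> D1 ph k \<longrightarrow> ip ph (I2 k) Df g = ip ph (I1 k) f h)"
  unfolding D1_adj_def by blast

lemma D0_adj_closed:
  fixes G :: "'n::finite space \<Rightarrow> 'n idx1 \<Rightarrow> complex"
  assumes D: "\<And>n. (g n, h n) \<in> D0_adj ph k"
    and G: "G \<in> L2 ph (V1 k)" "(\<lambda>n. tnsq (I1 k) (\<lambda>x i. g n x i - G x i)) \<longlonglongrightarrow> 0"
    and H: "H \<in> L2 ph (V0 k)" "(\<lambda>n. tnsq (I0 k) (\<lambda>x i. h n x i - H x i)) \<longlonglongrightarrow> 0"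
  shows "(G, H) \<in> D0_adj ph k"
  unfolding D0_adj_iff
proof (intro conjI allI impI G(1) H(1))
  have L: "g n \<in> L2 ph (V1 k)" "h n \<in> L2 ph (V0 k)" for n using D[of n] by (auto simp: D0_adj_iff)
  fix f and Df :: "'n space \<Rightarrow> 'n idx1 \<Rightarrow> complex" assume f: "(f, Df) \<in> D0 ph k"
  then have fL: "f \<in> L2 ph (V0 k)" "Df \<in> L2 ph (V1 k)" by (auto simp: D0_iff)
  show "ip ph (I1 k) Df G = ip ph (I0 k) f H"
  proof (rule limit_eq)
    show "(\<lambda>n. ip ph (I1 k) Df (g n)) \<longlonglongrightarrow> ip ph (I1 k) Df G" by (rule V1.tendsto_ip_right[OF L(1) G(1) fL(2) G(2)])
    show "(\<lambda>n. ip ph (I0 k) f (h n)) \<longlonglongrightarrow> ip ph (I0 k) f H" by (rule V0.tendsto_ip_right[OF L(2) H(1) fL(1) H(2)])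
    show "ip ph (I1 k) Df (g n) = ip ph (I0 k) f (h n)" for n using D[of n] f unfolding D0_adj_iff by blast
  qed
qed

lemma D1_adj_closed:
  fixes G :: "'n::finite space \<Rightarrow> 'n idx2 \<Rightarrow> complex"
  assumes D: "\<And>n. (g n, h n) \<in> D1_adj ph k"
    and G: "G \<in> L2 ph (V2 k)" "(\<lambda>n. tnsq (I2 k) (\<lambda>x i. g n x i - G x i)) \<longlonglongrightarrow> 0"
    and H: "H \<in> L2 ph (V1 k)" "(\<lambda>n. tnsq (I1 k) (\<lambda>x i. h n x i - H x i)) \<longlonglongrightarrow> 0"
  shows "(G, H) \<in> D1_adj ph k"
  unfolding D1_adj_iff
proof (intro conjI allI impI G(1) H(1))
  have L: "g n \<in> L2 ph (V2 k)" "h n \<in> L2 ph (V1 k)" for n using D[of n] by (auto simp: D1_adj_iff)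
  fix f and Df :: "'n space \<Rightarrow> 'n idx2 \<Rightarrow> complex" assume f: "(f, Df) \<in> D1 ph k"
  then have fL: "f \<in> L2 ph (V1 k)" "Df \<in> L2 ph (V2 k)" by (auto simp: D1_iff)
  show "ip ph (I2 k) Df G = ip ph (I1 k) f H"
  proof (rule limit_eq)
    show "(\<lambda>n. ip ph (I2 k) Df (g n)) \<longlonglongrightarrow> ip ph (I2 k) Df G" by (rule V2.tendsto_ip_right[OF L(1) G(1) fL(2) G(2)])
    show "(\<lambda>n. ip ph (I1 k) f (h n)) \<longlonglongrightarrow> ip ph (I1 k) f H" by (rule V1.tendsto_ip_right[OF L(2) H(1) fL(1) H(2)])
    show "ip ph (I2 k) Df (g n) = ip ph (I1 k) f (h n)" for n using D[of n] f unfolding D1_adj_iff by blast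
  qed
qed

lemma tnsq_0 [simp]: "tnsq I (\<lambda>x i. 0) = 0"
  by (simp add: tnsq_def nsq_def)

text \<open>A constant sequence converges to each representative of its class.\<close>

lemma D0_cong:
  assumes "(f, g) \<in> D0 ph k" "F \<in> L2 ph (V0 k)" "tnsq (I0 k) (\<lambda>x i. f x i - F x i) = 0"
    "G \<in> L2 ph (V1 k)" "tnsq (I1 k) (\<lambda>x i. g x i - G x i) = 0"
  shows "(F, G) \<in> D0 ph k"
  by (rule D0_closed[of "\<lambda>_. f" "\<lambda>_. g"]) (use assms in auto)

lemma D0_adj_cong:
  assumes "(g, h) \<in> D0_adj ph k" "G \<in> L2 ph (V1 k)" "tnsq (I1 k) (\<lambda>x i. g x i - G x i) = 0"
  shows "(G, h) \<in> D0_adj ph k"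
  by (rule D0_adj_closed[of "\<lambda>_. g" "\<lambda>_. h"]) (use assms in \<open>auto simp: D0_adj_iff\<close>)

lemma D0_diff:
  assumes "(f, g) \<in> D0 ph k" "(f', g') \<in> D0 ph k"
  shows "((\<lambda>x i. f x i - f' x i), (\<lambda>x i. g x i - g' x i)) \<in> D0 ph k"
  unfolding D0_iff
proof (intro conjI allI impI)
  have L: "f \<in> L2 ph (V0 k)" "g \<in> L2 ph (V1 k)" "f' \<in> L2 ph (V0 k)" "g' \<in> L2 ph (V1 k)"
    using assms by (auto simp: D0_iff)
  show "(\<lambda>x i. f x i - f' x i) \<in> L2 ph (V0 k)" "(\<lambda>x i. g x i - g' x i) \<in> L2 ph (V1 k)"
    by (intro V0.L2_diff V1.L2_diff L)+
  fix s A and \<eta> :: "'a space \<Rightarrow> complex" assume s: "length (s :: 2 list) = k - 1" and t: "test_fun \<eta>"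
  have 1: "(LINT x|lborel. (f x i - f' x i) * Z_up A a \<eta> x) = (LINT x|lborel. f x i * Z_up A a \<eta> x) - (LINT x|lborel. f' x i * Z_up A a \<eta> x)" for i a
  proof -
    obtain h where h: "sql2 h" "\<And>f. (LINT x|lborel. f x * Z_up A a \<eta> x) = sip f h"
      by (rule test_pairing_Z[OF t, of A a]) blast
    show ?thesis unfolding h(2) by (rule sip_diff_left[OF V0.L2_sql2[OF L(1)] V0.L2_sql2[OF L(3)] h(1)])
  qed
  have 2: "(LINT x|lborel. (g x i - g' x i) * \<eta> x) = (LINT x|lborel. g x i * \<eta> x) - (LINT x|lborel. g' x i * \<eta> x)" for i
  proof -
    obtain h where h: "sql2 h" "\<And>f. (LINT x|lborel. f x * \<eta> x) = sip f h"
      by (rule test_pairing[OF t]) blast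
    show ?thesis unfolding h(2) by (rule sip_diff_left[OF V1.L2_sql2[OF L(2)] V1.L2_sql2[OF L(4)] h(1)])
  qed
  have e: "(\<Sum>a\<in>UNIV. (- 1) * (LINT x|lborel. f x (a # s) * Z_up A a \<eta> x)) = (LINT x|lborel. g x (s, A) * \<eta> x)"
    "(\<Sum>a\<in>UNIV. (- 1) * (LINT x|lborel. f' x (a # s) * Z_up A a \<eta> x)) = (LINT x|lborel. g' x (s, A) * \<eta> x)"
    using assms s t unfolding D0_iff by blast+
  show "(\<Sum>a\<in>UNIV. (- 1) * (LINT x|lborel. (f x (a # s) - f' x (a # s)) * Z_up A a \<eta> x)) = (LINT x|lborel. (g x (s, A) - g' x (s, A)) * \<eta> x)"
    unfolding 1 2 e[symmetric] right_diff_distrib sum_subtractf ..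
qed

section \<open>The Box equation in the weighted space\<close>

text \<open>$\mathscr D_0^*\mathscr D_1^* = 0$ on polynomials, as it is adjoint to $\mathscr D_1\mathscr D_0 = 0$.\<close>

lemma ip_range_pA1:
  assumes D: "(f, Df) \<in> D0 ph k" and w: "pV (V2 k) d w" and k: "k \<ge> 2"
  shows "ip ph (I1 k) Df (pA1 k w) = 0"
proof -
  have k1: "k \<ge> 1" using k by simp
  let ?y = "pA0 k (pA1 k w)"
  have y: "pV (V0 k) (Suc (Suc d)) ?y" by (rule pV_A0[OF pV_A1[OF w]])
  have "complex_of_real (tnsq (I0 k) ?y) = ip ph (I0 k) ?y ?y" by (rule V0.ip_self[OF pV_L2[OF y], symmetric])
  also have "\<dots> = ip ph (I1 k) (pD0 k ?y) (pA1 k w)" by (rule adj_pol_D0[OF y pV_A1[OF w] k1, symmetric])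
  also have "\<dots> = 0" by (rule ip_pD0_pA1[OF y w k])
  finally have y0: "?y = (\<lambda>x i. 0)" by (intro V0.pV_eq_0[OF y]) simp
  have "ip ph (I1 k) Df (pA1 k w) = ip ph (I0 k) f ?y"
    using pA0_in_adj[OF pV_A1[OF w] k1] D unfolding D0_adj_iff by blast
  then show ?thesis by (simp add: y0 ip_def)
qed

text \<open>Besides the solution this records how its norm is controlled, and that the component $b$ in the range of $\mathscr D_1^*$ is
orthogonal to the range of $\mathscr D_0$, since it is a limit of such components of polynomial solutions.\<close>

theorem Box_solvable:
  fixes g :: "'n::finite space \<Rightarrow> 'n idx1 \<Rightarrow> complex"
  assumes g: "g \<in> L2 ph (V1 k)" and k: "k \<ge> 2"
  obtains u v a w b where "(u, v) \<in> D0_adj ph k" "(v, a) \<in> D0 ph k" "(u, w) \<in> D1 ph k" "(w, b) \<in> D1_adj ph k"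
    "g = (\<lambda>x i. a x i + b x i)" "tnsq (I1 k) u \<le> 4 * tnsq (I1 k) g"
    "\<And>f Df. (f, Df) \<in> D0 ph k \<Longrightarrow> ip ph (I1 k) Df b = 0"
proof -
  have k1: "k \<ge> 1" using k by simp
  have "\<forall>n. \<exists>dp. pV (V1 k) (Suc (fst dp)) (snd dp) \<and> tnsq (I1 k) (\<lambda>x i. snd dp x i - g x i) < 1 / real (Suc n)"
  proof
    fix n :: nat
    have "1 / real (Suc n) > 0" by simp
    from V1_dense[OF g this] obtain d p
      where "pV (V1 k) (Suc d) p" "tnsq (I1 k) (\<lambda>x i. p x i - g x i) < 1 / real (Suc n)" by blast
    then show "\<exists>dp. pV (V1 k) (Suc (fst dp)) (snd dp) \<and> tnsq (I1 k) (\<lambda>x i. snd dp x i - g x i) < 1 / real (Suc n)"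
      by (intro exI[of _ "(d, p)"]) simp
  qed
  from choice[OF this] obtain dp
    where dp: "\<forall>n. pV (V1 k) (Suc (fst (dp n))) (snd (dp n)) \<and> tnsq (I1 k) (\<lambda>x i. snd (dp n) x i - g x i) < 1 / real (Suc n)"
    by blast
  define d p where "d n = fst (dp n)" and "p n = snd (dp n)" for n
  have p: "pV (V1 k) (Suc (d n)) (p n)" "tnsq (I1 k) (\<lambda>x i. p n x i - g x i) < 1 / real (Suc n)" for n
    using dp unfolding d_def p_def by blast+
  have "\<forall>n. \<exists>H. pV (V1 k) (Suc (d n)) H \<and> pBox k H = p n"
  proof
    fix n show "\<exists>H. pV (V1 k) (Suc (d n)) H \<and> pBox k H = p n"
      by (rule pBox_surj[OF p(1)[of n] k]) blast
  qed
  from choice[OF this] obtain H where "\<forall>n. pV (V1 k) (Suc (d n)) (H n) \<and> pBox k (H n) = p n" by blast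
  then have H: "pV (V1 k) (Suc (d n)) (H n)" "pBox k (H n) = p n" for n by blast+
  note A = pV_A0[OF H(1)] and B = pV_D1[OF H(1)]
  note C = pV_D0[OF A] and E = pV_A1[OF B]
  have plim: "(\<lambda>n. tnsq (I1 k) (\<lambda>x i. p n x i - g x i)) \<longlonglongrightarrow> 0"
    by (rule Lim_null_comparison[OF _ LIMSEQ_Suc[OF lim_1_over_n]])
      (use p(2) in \<open>auto intro!: always_eventually simp: less_imp_le\<close>)
  have pc: "\<exists>M. \<forall>m\<ge>M. \<forall>n\<ge>M. tnsq (I1 k) (\<lambda>x i. p m x i - p n x i) < e" if "e > 0" for e
  proof -
    have "e / 4 > 0" using that by simp
    from LIMSEQ_D[OF plim this] obtain M where "\<forall>n\<ge>M. norm (tnsq (I1 k) (\<lambda>x i. p n x i - g x i) - 0) < e / 4" by blast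
    then have M: "tnsq (I1 k) (\<lambda>x i. p n x i - g x i) < e / 4" if "n \<ge> M" for n
      using that by simp
    have "tnsq (I1 k) (\<lambda>x i. p m x i - p n x i) < e" if "m \<ge> M" "n \<ge> M" for m n
      using V1.tnsq_triangle[OF pV_L2[OF p(1)[of m]] g pV_L2[OF p(1)[of n]]] M[OF that(1)] M[OF that(2)]
        tnsq_commute[of "I1 k" g "p n"] by simp
    then show ?thesis by blast
  qed
  \<comment> \<open>The difference of two solutions solves the equation for the difference of the right-hand sides, in a
    common degree.\<close>
  have bnd: "tnsq (I1 k) (\<lambda>x i. H m x i - H n x i) \<le> tnsq (I1 k) (\<lambda>x i. p m x i - p n x i)"
    "tnsq (I0 k) (\<lambda>x i. pA0 k (H m) x i - pA0 k (H n) x i) \<le> tnsq (I1 k) (\<lambda>x i. p m x i - p n x i)"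
    "tnsq (I2 k) (\<lambda>x i. pD1 k (H m) x i - pD1 k (H n) x i) \<le> tnsq (I1 k) (\<lambda>x i. p m x i - p n x i)"
    "tnsq (I1 k) (\<lambda>x i. pD0 k (pA0 k (H m)) x i - pD0 k (pA0 k (H n)) x i) \<le> tnsq (I1 k) (\<lambda>x i. p m x i - p n x i)"
    "tnsq (I1 k) (\<lambda>x i. pA1 k (pD1 k (H m)) x i - pA1 k (pD1 k (H n)) x i) \<le> tnsq (I1 k) (\<lambda>x i. p m x i - p n x i)" for m n
  proof -
    define D where "D = max (d m) (d n)"
    have Hm: "pV (V1 k) (Suc D) (H m)" and Hn: "pV (V1 k) (Suc D) (H n)"
      by (rule pV_mono[OF H(1)], simp add: D_def)+
    let ?K = "\<lambda>x i. H m x i + (- 1) * H n x i"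
    have K: "pV (V1 k) (Suc D) ?K" by (rule V1.pV_lin[OF Hm Hn])
    note l = pBox_lin[OF Hm Hn, of "- 1"] pA0_lin[OF Hm Hn, of "- 1"] pD1_lin[OF Hm Hn, of "- 1"]
      pD0_lin[OF pV_A0[OF Hm] pV_A0[OF Hn], of "- 1"] pA1_lin[OF pV_D1[OF Hm] pV_D1[OF Hn], of "- 1"]
    note bb = pBox_bounds[OF K k, unfolded l, unfolded H(2)]
    show "tnsq (I1 k) (\<lambda>x i. H m x i - H n x i) \<le> tnsq (I1 k) (\<lambda>x i. p m x i - p n x i)"
    "tnsq (I0 k) (\<lambda>x i. pA0 k (H m) x i - pA0 k (H n) x i) \<le> tnsq (I1 k) (\<lambda>x i. p m x i - p n x i)"
    "tnsq (I2 k) (\<lambda>x i. pD1 k (H m) x i - pD1 k (H n) x i) \<le> tnsq (I1 k) (\<lambda>x i. p m x i - p n x i)"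
    "tnsq (I1 k) (\<lambda>x i. pD0 k (pA0 k (H m)) x i - pD0 k (pA0 k (H n)) x i) \<le> tnsq (I1 k) (\<lambda>x i. p m x i - p n x i)"
    "tnsq (I1 k) (\<lambda>x i. pA1 k (pD1 k (H m)) x i - pA1 k (pD1 k (H n)) x i) \<le> tnsq (I1 k) (\<lambda>x i. p m x i - p n x i)"
      using bb by simp_all
  qed
  have cauchy: "\<exists>M. \<forall>m\<ge>M. \<forall>n\<ge>M. q m n < e"
    if pos: "e > 0" and le: "\<And>m n. q m n \<le> tnsq (I1 k) (\<lambda>x i. p m x i - p n x i)" for e :: real and q
  proof -
    obtain M where "\<forall>m\<ge>M. \<forall>n\<ge>M. tnsq (I1 k) (\<lambda>x i. p m x i - p n x i) < e" using pc[OF pos] by blast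
    then have "\<forall>m\<ge>M. \<forall>n\<ge>M. q m n < e" using le by (meson le_less_trans)
    then show ?thesis by blast
  qed
  obtain u where u: "u \<in> L2 ph (V1 k)" "(\<lambda>n. tnsq (I1 k) (\<lambda>x i. H n x i - u x i)) \<longlonglongrightarrow> 0"
    by (rule V1.complete[OF pV_L2[OF H(1)] cauchy[OF _ bnd(1)]]) blast+
  obtain v where v: "v \<in> L2 ph (V0 k)" "(\<lambda>n. tnsq (I0 k) (\<lambda>x i. pA0 k (H n) x i - v x i)) \<longlonglongrightarrow> 0"
    by (rule V0.complete[OF pV_L2[OF A] cauchy[OF _ bnd(2)]]) blast+
  obtain w where w: "w \<in> L2 ph (V2 k)" "(\<lambda>n. tnsq (I2 k) (\<lambda>x i. pD1 k (H n) x i - w x i)) \<longlonglongrightarrow> 0"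
    by (rule V2.complete[OF pV_L2[OF B] cauchy[OF _ bnd(3)]]) blast+
  obtain a where a: "a \<in> L2 ph (V1 k)" "(\<lambda>n. tnsq (I1 k) (\<lambda>x i. pD0 k (pA0 k (H n)) x i - a x i)) \<longlonglongrightarrow> 0"
    by (rule V1.complete[OF pV_L2[OF C] cauchy[OF _ bnd(4)]]) blast+
  obtain b where b: "b \<in> L2 ph (V1 k)" "(\<lambda>n. tnsq (I1 k) (\<lambda>x i. pA1 k (pD1 k (H n)) x i - b x i)) \<longlonglongrightarrow> 0"
    by (rule V1.complete[OF pV_L2[OF E] cauchy[OF _ bnd(5)]]) blast+
  have uv: "(u, v) \<in> D0_adj ph k" by (rule D0_adj_closed[OF pA0_in_adj[OF H(1) k1] u v])
  have va: "(v, a) \<in> D0 ph k" by (rule D0_closed[OF pD0_in_D0[OF A] v a])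
  have uw: "(u, w) \<in> D1 ph k" by (rule D1_closed[OF pD1_in_D1[OF H(1)] u w])
  have wb: "(w, b) \<in> D1_adj ph k" by (rule D1_adj_closed[OF pA1_in_adj[OF B k] w b])
  have ab: "tnsq (I1 k) (\<lambda>x i. a x i - (g x i - b x i)) = 0"
  proof -
    let ?c = "\<lambda>n x i. pD0 k (pA0 k (H n)) x i" and ?e = "\<lambda>n x i. pA1 k (pD1 k (H n)) x i"
    have le: "tnsq (I1 k) (\<lambda>x i. a x i - (g x i - b x i)) \<le> 2 * tnsq (I1 k) (\<lambda>x i. ?c n x i - a x i)
      + 2 * (2 * tnsq (I1 k) (\<lambda>x i. ?e n x i - b x i) + 2 * tnsq (I1 k) (\<lambda>x i. p n x i - g x i))" for n
    proof -
      have L1: "(\<lambda>x i. a x i - ?c n x i) \<in> L2 ph (V1 k)" by (rule V1.L2_diff[OF a(1) pV_L2[OF C]])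
      have L2: "(\<lambda>x i. b x i - ?e n x i) \<in> L2 ph (V1 k)" by (rule V1.L2_diff[OF b(1) pV_L2[OF E]])
      have L3: "(\<lambda>x i. p n x i - g x i) \<in> L2 ph (V1 k)" by (rule V1.L2_diff[OF pV_L2[OF p(1)] g])
      have "(\<lambda>x i. a x i - (g x i - b x i)) = (\<lambda>x i. (a x i - ?c n x i) + ((b x i - ?e n x i) + (p n x i - g x i)))"
        unfolding H(2)[symmetric] pBox_def by (simp add: algebra_simps)
      then show ?thesis
        using V1.tnsq_add_le[OF L1 V1.L2_add[OF L2 L3]] V1.tnsq_add_le[OF L2 L3]
          tnsq_commute[of "I1 k" a "?c n"] tnsq_commute[of "I1 k" b "?e n"] by simp
    qed
    have "(\<lambda>n. 2 * tnsq (I1 k) (\<lambda>x i. ?c n x i - a x i)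
      + 2 * (2 * tnsq (I1 k) (\<lambda>x i. ?e n x i - b x i) + 2 * tnsq (I1 k) (\<lambda>x i. p n x i - g x i))) \<longlonglongrightarrow> 2 * 0 + 2 * (2 * 0 + 2 * 0)"
      by (intro tendsto_add tendsto_mult tendsto_const a b plim)
    then have "tnsq (I1 k) (\<lambda>x i. a x i - (g x i - b x i)) \<le> 2 * 0 + 2 * (2 * 0 + 2 * 0)"
      by (rule LIMSEQ_le_const) (use le in blast)
    then have "tnsq (I1 k) (\<lambda>x i. a x i - (g x i - b x i)) \<le> 0" by (simp only: mult_zero_right add_0_left)
    then show ?thesis by (rule antisym[OF _ tnsq_nonneg])
  qed
  \<comment> \<open>The sum of the two limits equals g only almost everywhere, so the first one is redefined as g - b.\<close>
  have va': "(v, \<lambda>x i. g x i - b x i) \<in> D0 ph k"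
    by (rule D0_cong[OF va v(1) _ V1.L2_diff[OF g b(1)] ab]) simp
  have bound: "tnsq (I1 k) u \<le> 4 * tnsq (I1 k) g"
  proof -
    have le: "tnsq (I1 k) u \<le> 2 * (2 * tnsq (I1 k) g + 2 * tnsq (I1 k) (\<lambda>x i. p n x i - g x i)) + 2 * tnsq (I1 k) (\<lambda>x i. H n x i - u x i)" for n
    proof -
      have LH: "H n \<in> L2 ph (V1 k)" by (rule pV_L2[OF H(1)])
      have Lp: "p n \<in> L2 ph (V1 k)" by (rule pV_L2[OF p(1)])
      have "tnsq (I1 k) u \<le> 2 * tnsq (I1 k) (H n) + 2 * tnsq (I1 k) (\<lambda>x i. u x i - H n x i)"
        using V1.tnsq_add_le[OF LH V1.L2_diff[OF u(1) LH]] by simp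
      moreover have "tnsq (I1 k) (H n) \<le> tnsq (I1 k) (p n)" using pBox_bounds(1)[OF H(1)[of n] k] by (simp add: H(2))
      moreover have "tnsq (I1 k) (p n) \<le> 2 * tnsq (I1 k) g + 2 * tnsq (I1 k) (\<lambda>x i. p n x i - g x i)"
        using V1.tnsq_add_le[OF g V1.L2_diff[OF Lp g]] by simp
      ultimately show ?thesis using tnsq_commute[of "I1 k" u "H n"] by simp
    qed
    have "(\<lambda>n. 2 * (2 * tnsq (I1 k) g + 2 * tnsq (I1 k) (\<lambda>x i. p n x i - g x i)) + 2 * tnsq (I1 k) (\<lambda>x i. H n x i - u x i))
        \<longlonglongrightarrow> 2 * (2 * tnsq (I1 k) g + 2 * 0) + 2 * 0"
      by (intro tendsto_add tendsto_mult tendsto_const u plim)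
    then have "tnsq (I1 k) u \<le> 2 * (2 * tnsq (I1 k) g + 2 * 0) + 2 * 0"
      by (rule LIMSEQ_le_const) (use le in blast)
    then show ?thesis by simp
  qed
  have orth: "ip ph (I1 k) Df b = 0" if "(f, Df) \<in> D0 ph k" for f Df
  proof (rule limit_eq)
    have Df: "Df \<in> L2 ph (V1 k)" using that by (simp add: D0_iff)
    show "(\<lambda>n. ip ph (I1 k) Df (pA1 k (pD1 k (H n)))) \<longlonglongrightarrow> ip ph (I1 k) Df b"
      by (rule V1.tendsto_ip_right[OF pV_L2[OF E] b(1) Df b(2)])
    show "(\<lambda>n. 0) \<longlonglongrightarrow> (0::complex)" by simp
    show "ip ph (I1 k) Df (pA1 k (pD1 k (H n))) = 0" for n by (rule ip_range_pA1[OF that B k])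
  qed
  show ?thesis
    by (rule that[OF uv va' uw wb _ bound orth]) simp_all
qed

section \<open>The inverse of Box and the Bergman projection\<close>

lemma Box_iff: "(u, g) \<in> Box \<phi> k \<longleftrightarrow> (\<exists>v a w b. (u, v) \<in> D0_adj \<phi> k \<and> (v, a) \<in> D0 \<phi> k \<and>
    (u, w) \<in> D1 \<phi> k \<and> (w, b) \<in> D1_adj \<phi> k \<and> g = (\<lambda>x i. a x i + b x i))"
  unfolding Box_def by blast

lemma Box_L2:
  assumes "(u, g) \<in> Box ph k" shows "u \<in> L2 ph (V1 k)" "g \<in> L2 ph (V1 k)"
  using assms by (auto simp: Box_iff D0_adj_iff D0_iff D1_adj_iff intro: V1.L2_add)

lemma Box_symmetric:
  fixes u y g h :: "'n::finite space \<Rightarrow> 'n idx1 \<Rightarrow> complex"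
  assumes ug: "(u, g) \<in> Box ph k" and yh: "(y, h) \<in> Box ph k"
  shows "ip ph (I1 k) g y = ip ph (I1 k) u h"
proof -
  obtain v a w b where 1: "(u, v) \<in> D0_adj ph k" "(v, a) \<in> D0 ph k" "(u, w) \<in> D1 ph k" "(w, b) \<in> D1_adj ph k"
    and g: "g = (\<lambda>x i. a x i + b x i)" using ug unfolding Box_iff by blast
  obtain v' a' w' b' where 2: "(y, v') \<in> D0_adj ph k" "(v', a') \<in> D0 ph k" "(y, w') \<in> D1 ph k" "(w', b') \<in> D1_adj ph k"
    and h: "h = (\<lambda>x i. a' x i + b' x i)" using yh unfolding Box_iff by blast
  have L: "a \<in> L2 ph (V1 k)" "b \<in> L2 ph (V1 k)" "a' \<in> L2 ph (V1 k)" "b' \<in> L2 ph (V1 k)"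
    using 1(2,4) 2(2,4) by (auto simp: D0_iff D1_adj_iff)
  note Lu = Box_L2[OF ug] and Ly = Box_L2[OF yh]
  have a: "ip ph (I1 k) a y = ip ph (I0 k) v v'" using 2(1) 1(2) unfolding D0_adj_iff by blast
  have a': "ip ph (I1 k) a' u = ip ph (I0 k) v' v" using 1(1) 2(2) unfolding D0_adj_iff by blast
  have b: "ip ph (I2 k) w' w = ip ph (I1 k) y b" using 1(4) 2(3) unfolding D1_adj_iff by blast
  have b': "ip ph (I2 k) w w' = ip ph (I1 k) u b'" using 2(4) 1(3) unfolding D1_adj_iff by blast
  have "ip ph (I1 k) g y = ip ph (I1 k) a y + ip ph (I1 k) b y" unfolding g by (rule V1.ip_add_left[OF L(1,2) Ly(1)])
  also have "ip ph (I1 k) b y = ip ph (I2 k) w w'"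
    unfolding ip_cnj[of ph "I1 k" b y] b[symmetric] by (rule ip_cnj[symmetric])
  also have "ip ph (I1 k) a y = ip ph (I1 k) u a'"
    unfolding a ip_cnj[of ph "I1 k" u a'] a' by (rule ip_cnj)
  also have "ip ph (I1 k) u a' + ip ph (I2 k) w w' = ip ph (I1 k) u h"
    unfolding b' h by (rule V1.ip_add_right[OF L(3,4) Lu(1), symmetric])
  finally show ?thesis .
qed

lemma (in tuples) AE_eqI:
  assumes "f \<in> L2 ph V" "g \<in> L2 ph V" "tnsq I (\<lambda>x i. f x i - g x i) = 0"
  shows "AE x in lborel. f x = g x"
  using tnsq_0_AE[OF L2_diff[OF assms(1,2)] assms(3)] by eventually_elim auto

text \<open>The difference of two solutions is orthogonal to every right-hand side $\Box y$, in particular to itself.\<close>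

lemma Box_unique:
  fixes u u' g :: "'n::finite space \<Rightarrow> 'n idx1 \<Rightarrow> complex"
  assumes u: "(u, g) \<in> Box ph k" and u': "(u', g) \<in> Box ph k" and k: "k \<ge> 2"
  shows "tnsq (I1 k) (\<lambda>x i. u x i - u' x i) = 0" "AE x in lborel. u x = u' x"
proof -
  let ?d = "\<lambda>x i. u x i - u' x i"
  note L = Box_L2(1)[OF u] Box_L2(1)[OF u']
  have d: "?d \<in> L2 ph (V1 k)" by (rule V1.L2_diff[OF L])
  obtain y where y: "(y, ?d) \<in> Box ph k"
    by (rule Box_solvable[OF d k]) (unfold Box_iff, blast)
  have "ip ph (I1 k) ?d ?d = ip ph (I1 k) u ?d - ip ph (I1 k) u' ?d" by (rule V1.ip_diff_left[OF L d])
  also have "\<dots> = 0" unfolding Box_symmetric[OF u y, symmetric] Box_symmetric[OF u' y, symmetric] by simp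
  finally show 0: "tnsq (I1 k) ?d = 0" by (simp add: V1.ip_self[OF d])
  show "AE x in lborel. u x = u' x" by (rule V1.AE_eqI[OF L 0])
qed

theorem bounded_inverse_exists:
  assumes k: "k \<ge> 2"
  shows "\<exists>N. bounded_inverse_Box (ph :: 'n::finite space \<Rightarrow> real) k N"
proof -
  have ex: "\<exists>u. (u, g) \<in> Box ph k \<and> tnsq (I1 k) u \<le> 4 * tnsq (I1 k) g" if "g \<in> L2 ph (V1 k)"
    for g :: "'n space \<Rightarrow> 'n idx1 \<Rightarrow> complex"
    by (rule Box_solvable[OF that k]) (unfold Box_iff, blast)
  define N where "N g = (SOME u. (u, g) \<in> Box ph k \<and> tnsq (I1 k) u \<le> 4 * tnsq (I1 k) g)"
    for g :: "'n space \<Rightarrow> 'n idx1 \<Rightarrow> complex"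
  have N: "(N g, g) \<in> Box ph k" "tnsq (I1 k) (N g) \<le> 4 * tnsq (I1 k) g" if "g \<in> L2 ph (V1 k)" for g
    unfolding N_def using someI_ex[OF ex[OF that]] by blast+
  have "bounded_inverse_Box ph k N"
    unfolding bounded_inverse_Box_def
  proof (intro conjI ballI exI[of _ 2] N(1))
    show "case p of (u, g) \<Rightarrow> AE x in lborel. N g x = u x" if "p \<in> Box ph k" for p
    proof (cases p)
      case (Pair u g)
      then show ?thesis using that Box_unique(2)[OF N(1)[OF Box_L2(2)] _ k, of u g u] by simp
    qed
    fix g :: "'n space \<Rightarrow> 'n idx1 \<Rightarrow> complex" assume g: "g \<in> L2 ph (V1 k)"
    have "sqrt (tnsq (I1 k) (N g)) \<le> sqrt (4 * tnsq (I1 k) g)" using N(2)[OF g] by simp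
    then show "nrm ph (I1 k) (N g) \<le> 2 * nrm ph (I1 k) g"
      by (simp add: V1.nrm_eq[OF g] V1.nrm_eq[OF Box_L2(1)[OF N(1)[OF g]]] real_sqrt_mult)
  qed
  then show ?thesis by blast
qed

text \<open>The domain of $\mathscr D_0$ contains the polynomial tuples and is therefore dense.\<close>

lemma D0_adj_unique:
  assumes h: "(u, h) \<in> D0_adj ph k" and h': "(u, h') \<in> D0_adj ph k"
  shows "tnsq (I0 k) (\<lambda>x i. h x i - h' x i) = 0"
proof -
  let ?d = "\<lambda>x i. h x i - h' x i"
  have L: "h \<in> L2 ph (V0 k)" "h' \<in> L2 ph (V0 k)" using h h' by (auto simp: D0_adj_iff)
  have d: "?d \<in> L2 ph (V0 k)" by (rule V0.L2_diff[OF L])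
  have orth: "ip ph (I0 k) p ?d = 0" if p: "pV (V0 k) (Suc e) p" for e p
  proof -
    have "ip ph (I0 k) p ?d = ip ph (I0 k) p h - ip ph (I0 k) p h'" by (rule V0.ip_diff_right[OF L pV_L2[OF p]])
    moreover have "ip ph (I1 k) (pD0 k p) u = ip ph (I0 k) p h" "ip ph (I1 k) (pD0 k p) u = ip ph (I0 k) p h'"
      using h h' pD0_in_D0[OF p] unfolding D0_adj_iff by blast+
    ultimately show ?thesis by simp
  qed
  have "tnsq (I0 k) ?d \<le> 0 + e" if e: "e > 0" for e
  proof -
    obtain c p where p: "pV (V0 k) (Suc c) p" "tnsq (I0 k) (\<lambda>x i. p x i - ?d x i) < e"
      using V0_dense[OF d e] by blast
    note Lp = pV_L2[OF p(1)]
    have dp: "(\<lambda>x i. ?d x i - p x i) \<in> L2 ph (V0 k)" by (rule V0.L2_diff[OF d Lp])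
    have "ip ph (I0 k) (\<lambda>x i. ?d x i - p x i) ?d = ip ph (I0 k) ?d ?d"
      unfolding V0.ip_diff_left[OF d Lp d] orth[OF p(1)] by simp
    then have "2 * norm (complex_of_real (tnsq (I0 k) ?d)) \<le> tnsq (I0 k) (\<lambda>x i. ?d x i - p x i) + tnsq (I0 k) ?d"
      using V0.norm_ip_le[OF dp d, of 1] by (simp add: V0.ip_self[OF d])
    then show ?thesis using p(2) tnsq_commute[of "I0 k" ?d p] unfolding norm_of_real by simp
  qed
  then have "tnsq (I0 k) ?d \<le> 0" by (rule field_le_epsilon)
  then show ?thesis by (rule antisym[OF _ tnsq_nonneg])
qed

theorem corollary3p1:
  fixes \<phi> :: "real^4^'n::finite \<Rightarrow> real" and k :: nat
    and f :: "real^4^'n \<Rightarrow> 2 list \<Rightarrow> complex"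
  assumes "k \<ge> 2"
    and "\<phi> = (\<lambda>x. (norm x)\<^sup>2)"
    and "f \<in> Domain (D0 \<phi> k)"
  shows "AE x in lborel. \<forall>i.
    bergman_proj \<phi> k f x i = f x i - app (D0_adj \<phi> k) (N_op \<phi> k (app (D0 \<phi> k) f)) x i"
  unfolding assms(2)
proof -
  define g where "g = app (D0 ph k) f"
  define u where "u = N_op ph k g"
  define h where "h = app (D0_adj ph k) u"
  have fg: "(f, g) \<in> D0 ph k"
    unfolding g_def app_def using assms(3) unfolding assms(2) Domain_iff by (rule someI_ex)
  have fL: "f \<in> L2 ph (V0 k)" and gL: "g \<in> L2 ph (V1 k)" using fg by (auto simp: D0_iff)
  have "bounded_inverse_Box (ph :: 'n space \<Rightarrow> real) k (N_op ph k)"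
    unfolding N_op_def by (rule someI_ex[OF bounded_inverse_exists[OF assms(1)]])
  then have ug: "(u, g) \<in> Box ph k" unfolding bounded_inverse_Box_def u_def using gL by blast
  obtain u' v a w b where s: "(u', v) \<in> D0_adj ph k" "(v, a) \<in> D0 ph k" "(u', w) \<in> D1 ph k" "(w, b) \<in> D1_adj ph k"
    "g = (\<lambda>x i. a x i + b x i)"
    and orth: "\<And>f Df. (f, Df) \<in> D0 ph k \<Longrightarrow> ip ph (I1 k) Df b = 0"
    by (rule Box_solvable[OF gL assms(1)]) blast
  have vL: "v \<in> L2 ph (V0 k)" and aL: "a \<in> L2 ph (V1 k)" and bL: "b \<in> L2 ph (V1 k)"
    using s(2,4) by (auto simp: D0_iff D1_adj_iff)
  \<comment> \<open>Both g and a lie in the range of the first operator, so b = g - a is orthogonal to itself.\<close>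
  have b0: "tnsq (I1 k) b = 0"
  proof -
    have "ip ph (I1 k) g b = ip ph (I1 k) a b + ip ph (I1 k) b b"
      unfolding s(5) by (rule V1.ip_add_left[OF aL bL bL])
    then have "ip ph (I1 k) b b = 0" using orth[OF fg] orth[OF s(2)] by simp
    then show ?thesis by (simp add: V1.ip_self[OF bL])
  qed
  have vg: "(v, g) \<in> D0 ph k"
  proof (rule D0_cong[OF s(2) vL _ gL])
    have "(\<lambda>x i. a x i - g x i) = (\<lambda>x i. - b x i)" unfolding s(5) by simp
    then have "tnsq (I1 k) (\<lambda>x i. a x i - g x i) = tnsq (I1 k) b" by (simp add: tnsq_def nsq_def)
    then show "tnsq (I1 k) (\<lambda>x i. a x i - g x i) = 0" using b0 by simp
  qed simp
  have "(u', g) \<in> Box ph k" unfolding Box_iff using s by blast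
  then have "tnsq (I1 k) (\<lambda>x i. u' x i - u x i) = 0" using Box_unique(1)[OF _ ug assms(1)] by blast
  then have uv: "(u, v) \<in> D0_adj ph k" by (rule D0_adj_cong[OF s(1) Box_L2(1)[OF ug]])
  then have uh: "(u, h) \<in> D0_adj ph k"
    unfolding h_def app_def by (rule someI[where P = "\<lambda>h. (u, h) \<in> D0_adj ph k"])
  from this have hL: "h \<in> L2 ph (V0 k)" by (simp add: D0_adj_iff)
  have hg: "(h, g) \<in> D0 ph k"
    by (rule D0_cong[OF vg hL D0_adj_unique[OF uv uh] gL]) simp
  let ?p = "\<lambda>x i. f x i - h x i"
  have p: "?p \<in> bergman ph k" using D0_diff[OF fg hg] by (simp add: bergman_def)
  have pL: "?p \<in> L2 ph (V0 k)" by (rule V0.L2_diff[OF fL hL])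
  have porth: "ip ph (I0 k) (\<lambda>x i. f x i - ?p x i) q = 0" if "q \<in> bergman ph k" for q
  proof -
    have "ip ph (I1 k) (\<lambda>x i. 0) u = ip ph (I0 k) q h"
      using uh that unfolding D0_adj_iff bergman_def by blast
    then have "ip ph (I0 k) q h = 0" by (simp add: ip_def)
    then have "ip ph (I0 k) h q = 0" using ip_cnj[of ph "I0 k" h q] by simp
    then show ?thesis by simp
  qed
  define P where "P = bergman_proj ph k f"
  have P: "P \<in> bergman ph k" "\<And>q. q \<in> bergman ph k \<Longrightarrow> ip ph (I0 k) (\<lambda>x i. f x i - P x i) q = 0"
  proof -
    have "\<exists>p. p \<in> bergman ph k \<and> (\<forall>h\<in>bergman ph k. ip ph (I0 k) (\<lambda>x i. f x i - p x i) h = 0)"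
      using p porth by blast
    from someI_ex[OF this] show "P \<in> bergman ph k" "\<And>q. q \<in> bergman ph k \<Longrightarrow> ip ph (I0 k) (\<lambda>x i. f x i - P x i) q = 0"
      unfolding P_def bergman_proj_def by blast+
  qed
  have PL: "P \<in> L2 ph (V0 k)" using P(1) by (simp add: bergman_def D0_iff)
  let ?r = "\<lambda>x i. P x i - ?p x i"
  have rL: "?r \<in> L2 ph (V0 k)" by (rule V0.L2_diff[OF PL pL])
  have "?r \<in> bergman ph k"
    using D0_diff[of P "\<lambda>x i. 0" k ?p "\<lambda>x i. 0"] P(1) p by (simp add: bergman_def)
  from porth[OF this] P(2)[OF this]
  have "ip ph (I0 k) (\<lambda>x i. (f x i - ?p x i) - (f x i - P x i)) ?r = 0"
    by (subst V0.ip_diff_left[OF V0.L2_diff[OF fL pL] V0.L2_diff[OF fL PL] rL]) simp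
  moreover have "(\<lambda>x i. (f x i - ?p x i) - (f x i - P x i)) = ?r" by (simp add: fun_eq_iff)
  ultimately have "ip ph (I0 k) ?r ?r = 0" by (simp only:)
  then have "tnsq (I0 k) ?r = 0" by (simp add: V0.ip_self[OF rL])
  from V0.AE_eqI[OF PL pL this]
  show "AE x in lborel. \<forall>i. bergman_proj ph k f x i = f x i - app (D0_adj ph k) (N_op ph k (app (D0 ph k) f)) x i"
    unfolding P_def h_def u_def g_def by eventually_elim simp
qed

end
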